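(* Let $(A,\mathfrak{m})$ be a Noetherian local ring, $M$ a finitely generated $A$-module, and $I$ an ideal of $A$ (not necessarily $\mathfrak m$-primary, nor with $M/IM$ of finite length) such that $\operatorname{grade}(I,M) > 0$. Then $$\rho^{I}(M) \leq \max\{0,\ a_{1}(G_{I}(M)) + 1\}.$$
   Context: $G_I(A) = \bigoplus_{n\ge 0} I^n/I^{n+1}$ and $G_I(M) = \bigoplus_{n\ge 0} I^nM/I^{n+1}M$, a graded $G_I(A)$-module; $G_I(A)_+ = \bigoplus_{n\ge 1} I^n/I^{n+1}$. For a graded module $L$, $\operatorname{end}(L) = \sup\{n \in \mathbb{Z} \mid L_n \neq 0\}$ (equal to $-\infty$ if $L=0$), and $a_1(G_I(M)) = \operatorname{end}\big(H^1_{G_I(A)_+}(G_I(M))\big)$. For an ideal $J$, the Ratliff-Rush submodule is $\widetilde{JM} = \bigcup_{j\geq 0}(J^{j+1}M :_M J^j)$; thus $\widetilde{I^nM}$ is obtained by taking $J = I^n$ (and for $n=0$, $\widetilde{I^0M}=I^0M=M$). When $\operatorname{grade}(I,M)>0$ one has $\widetilde{I^nM} = I^nM$ for all $n \gg 0$, and one sets $\rho^I(M) = \min\{n \geq 0 \mid \widetilde{I^iM} = I^iM \text{ for all } i \geq n\}$. *)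

theory Defs
  imports
    "HOL-Algebra.Algebra"
    "HOL-Library.Extended_Real"
    "HOL-Library.Extended_Nat"
begin

section \<open>Local rings, finitely generated modules, submodules $IM$\<close>

locale noetherian_local_ring = cring R + noetherian_ring R for R (structure) +
  fixes \<mm> :: "'a set"
  assumes maximalideal_mm: "maximalideal \<mm> R"
    and maximalideal_unique: "maximalideal J R \<Longrightarrow> J = \<mm>"

definition submodule_gen ::
  "('a, 'r) ring_scheme \<Rightarrow> ('a, 'b, 'm) module_scheme \<Rightarrow> 'b set \<Rightarrow> 'b set" where
  "submodule_gen R M S = \<Inter>{N. submodule N R M \<and> S \<subseteq> N}"

definition finitely_generated_module ::
  "('a, 'r) ring_scheme \<Rightarrow> ('a, 'b, 'm) module_scheme \<Rightarrow> bool" where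
  "finitely_generated_module R M \<longleftrightarrow>
     module R M \<and> (\<exists>S \<subseteq> carrier M. finite S \<and> carrier M = submodule_gen R M S)"

definition ideal_smult ::
  "('a, 'r) ring_scheme \<Rightarrow> ('a, 'b, 'm) module_scheme \<Rightarrow> 'a set \<Rightarrow> 'b set" where
  "ideal_smult R M I = submodule_gen R M {a \<odot>\<^bsub>M\<^esub> m | a m. a \<in> I \<and> m \<in> carrier M}"

definition ideal_pow :: "('a, 'r) ring_scheme \<Rightarrow> 'a set \<Rightarrow> nat \<Rightarrow> 'a set" where
  "ideal_pow R I n = I [^]\<^bsub>ideals_set R\<^esub> n"

text \<open>The quotient module $M/N$. Its fields \<open>mult\<close> and \<open>one\<close>, present in every
  \<^typ>\<open>('a, 'b) module\<close> record, carry no meaning; likewise for the other modules below.\<close>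

definition quot_module ::
  "('a, 'r) ring_scheme \<Rightarrow> ('a, 'b, 'm) module_scheme \<Rightarrow> 'b set \<Rightarrow> ('a, 'b set) module" where
  "quot_module R M N =
     \<lparr>carrier = a_rcosets\<^bsub>M\<^esub> N, monoid.mult = undefined, monoid.one = undefined,
      ring.zero = N, ring.add = set_add M,
      smult = (\<lambda>a U. \<Union>x\<in>U. N +>\<^bsub>M\<^esub> (a \<odot>\<^bsub>M\<^esub> x))\<rparr>"


section \<open>Grade\<close>

definition regular_element ::
  "('a, 'r) ring_scheme \<Rightarrow> ('a, 'b, 'm) module_scheme \<Rightarrow> 'a \<Rightarrow> bool" where
  "regular_element R M x \<longleftrightarrow>
     x \<in> carrier R \<and> (\<forall>m \<in> carrier M. x \<odot>\<^bsub>M\<^esub> m = \<zero>\<^bsub>M\<^esub> \<longrightarrow> m = \<zero>\<^bsub>M\<^esub>)"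

definition regular_sequence ::
  "('a, 'r) ring_scheme \<Rightarrow> ('a, 'b, 'm) module_scheme \<Rightarrow> 'a list \<Rightarrow> bool" where
  "regular_sequence R M xs \<longleftrightarrow>
     set xs \<subseteq> carrier R \<and>
     (\<forall>i < length xs.
        regular_element R
          (quot_module R M (ideal_smult R M (genideal R (set (take i xs))))) (xs ! i)) \<and>
     ideal_smult R M (genideal R (set xs)) \<noteq> carrier M"

text \<open>The convention $\mathrm{grade}(I,M) = \infty$ for $IM = M$ is the usual one.\<close>

definition grade ::
  "('a, 'r) ring_scheme \<Rightarrow> 'a set \<Rightarrow> ('a, 'b, 'm) module_scheme \<Rightarrow> enat" where
  "grade R I M =
     (if ideal_smult R M I = carrier M then \<infinity>
      else Sup {enat (length xs) | xs. set xs \<subseteq> I \<and> regular_sequence R M xs})"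


section \<open>Ratliff-Rush submodules\<close>

definition module_colon ::
  "('a, 'r) ring_scheme \<Rightarrow> ('a, 'b, 'm) module_scheme \<Rightarrow> 'b set \<Rightarrow> 'a set \<Rightarrow> 'b set" where
  "module_colon R M N J = {m \<in> carrier M. \<forall>a \<in> J. a \<odot>\<^bsub>M\<^esub> m \<in> N}"

definition ratliff_rush ::
  "('a, 'r) ring_scheme \<Rightarrow> ('a, 'b, 'm) module_scheme \<Rightarrow> 'a set \<Rightarrow> 'b set" where
  "ratliff_rush R M J =
     (\<Union>j. module_colon R M (ideal_smult R M (ideal_pow R J (j + 1))) (ideal_pow R J j))"

text \<open>Meaningful when the set of such \<open>n\<close> is nonempty, in particular for positive grade.\<close>

definition rho ::
  "('a, 'r) ring_scheme \<Rightarrow> 'a set \<Rightarrow> ('a, 'b, 'm) module_scheme \<Rightarrow> nat" where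
  "rho R I M =
     (LEAST n. \<forall>i \<ge> n. ratliff_rush R M (ideal_pow R I i) = ideal_smult R M (ideal_pow R I i))"


section \<open>Associated graded ring and module\<close>

text \<open>An element of $\bigoplus_n I^n/I^{n+1}$ is a finitely supported sequence \<open>f\<close> with
  $f_n \in I^n/I^{n+1}$, the latter regarded as an ideal of $A/I^{n+1}$; similarly for \<open>M\<close>.
  For cosets $X \in I^i/I^{i+1}$ and $Y \in I^j/I^{j+1}$ all products $xy$ with $x \in X$,
  $y \in Y$ lie in one coset of $I^{i+j+1}$, namely the product of \<open>X\<close> and \<open>Y\<close>.\<close>

definition gr_ring :: "('a, 'r) ring_scheme \<Rightarrow> 'a set \<Rightarrow> (nat \<Rightarrow> 'a set) ring" where
  "gr_ring R I =
     \<lparr>carrier = {f. (\<forall>n. f n \<in> (\<lambda>a. ideal_pow R I (n + 1) +>\<^bsub>R\<^esub> a) ` ideal_pow R I n) \<and>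
                    finite {n. f n \<noteq> ideal_pow R I (n + 1)}},
      monoid.mult = (\<lambda>f g n. \<Oplus>\<^bsub>R Quot ideal_pow R I (n + 1)\<^esub> i \<in> {..n}.
                        rcoset_mult R (ideal_pow R I (n + 1)) (f i) (g (n - i))),
      monoid.one = (\<lambda>n. if n = 0 then ideal_pow R I 1 +>\<^bsub>R\<^esub> \<one>\<^bsub>R\<^esub> else ideal_pow R I (n + 1)),
      ring.zero = (\<lambda>n. ideal_pow R I (n + 1)),
      ring.add = (\<lambda>f g n. f n <+>\<^bsub>R\<^esub> g n)\<rparr>"

definition gr_module ::
  "('a, 'r) ring_scheme \<Rightarrow> 'a set \<Rightarrow> ('a, 'b, 'm) module_scheme
     \<Rightarrow> (nat \<Rightarrow> 'a set, nat \<Rightarrow> 'b set) module" where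
  "gr_module R I M =
     (let IM = (\<lambda>n. ideal_smult R M (ideal_pow R I n)) in
     \<lparr>carrier = {f. (\<forall>n. f n \<in> (\<lambda>m. IM (n + 1) +>\<^bsub>M\<^esub> m) ` IM n) \<and>
                    finite {n. f n \<noteq> IM (n + 1)}},
      monoid.mult = undefined,
      monoid.one = undefined,
      ring.zero = (\<lambda>n. IM (n + 1)),
      ring.add = (\<lambda>f g n. f n <+>\<^bsub>M\<^esub> g n),
      smult = (\<lambda>f g n. \<Oplus>\<^bsub>quot_module R M (IM (n + 1))\<^esub> i \<in> {..n}.
                        (\<Union>a \<in> f i. \<Union>m \<in> g (n - i). IM (n + 1) +>\<^bsub>M\<^esub> (a \<odot>\<^bsub>M\<^esub> m)))\<rparr>)"

text \<open>The homogeneous component of degree \<open>d\<close> of $G_I(A)$ or $G_I(M)$; it is zero for negative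
  \<open>d\<close>.\<close>

definition gr_component :: "(nat \<Rightarrow> 'c, 'r) ring_scheme \<Rightarrow> int \<Rightarrow> (nat \<Rightarrow> 'c) set" where
  "gr_component L d = {f \<in> carrier L. \<forall>n. int n \<noteq> d \<longrightarrow> f n = \<zero>\<^bsub>L\<^esub> n}"

definition gr_irrelevant :: "('a, 'r) ring_scheme \<Rightarrow> 'a set \<Rightarrow> (nat \<Rightarrow> 'a set) set" where
  "gr_irrelevant R I = {f \<in> carrier (gr_ring R I). f 0 = \<zero>\<^bsub>gr_ring R I\<^esub> 0}"


section \<open>Localization of a module at an element\<close>

text \<open>The fraction $m/x^k$, as the set of all pairs \<open>(m', k')\<close> with $m'/x^{k'} = m/x^k$.\<close>

definition fraction ::
  "('a, 'r) ring_scheme \<Rightarrow> ('a, 'b, 'm) module_scheme \<Rightarrow> 'a \<Rightarrow> 'b \<Rightarrow> nat \<Rightarrow> ('b \<times> nat) set" where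
  "fraction R N x m k =
     {(m', k'). m' \<in> carrier N \<and>
        (\<exists>l. (x [^]\<^bsub>R\<^esub> (l + k')) \<odot>\<^bsub>N\<^esub> m = (x [^]\<^bsub>R\<^esub> (l + k)) \<odot>\<^bsub>N\<^esub> m')}"

definition localization ::
  "('a, 'r) ring_scheme \<Rightarrow> ('a, 'b, 'm) module_scheme \<Rightarrow> 'a \<Rightarrow> ('a, ('b \<times> nat) set) module" where
  "localization R N x =
     \<lparr>carrier = {fraction R N x m k | m k. m \<in> carrier N},
      monoid.mult = undefined,
      monoid.one = undefined,
      ring.zero = fraction R N x \<zero>\<^bsub>N\<^esub> 0,
      ring.add = (\<lambda>U Y. \<Union>(m, k) \<in> U. \<Union>(m', k') \<in> Y.
               fraction R N x
                 ((x [^]\<^bsub>R\<^esub> k') \<odot>\<^bsub>N\<^esub> m \<oplus>\<^bsub>N\<^esub> (x [^]\<^bsub>R\<^esub> k) \<odot>\<^bsub>N\<^esub> m') (k + k')),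
      smult = (\<lambda>a U. \<Union>(m, k) \<in> U. fraction R N x (a \<odot>\<^bsub>N\<^esub> m) k)\<rparr>"

text \<open>The component of degree \<open>n\<close> of $N_x$, for \<open>x\<close> homogeneous of degree \<open>d\<close> and
  \<open>Ng\<close> the grading of \<open>N\<close>.\<close>

definition localization_component ::
  "('a, 'r) ring_scheme \<Rightarrow> ('a, 'b, 'm) module_scheme \<Rightarrow> (int \<Rightarrow> 'b set)
     \<Rightarrow> 'a \<Rightarrow> int \<Rightarrow> int \<Rightarrow> ('b \<times> nat) set set" where
  "localization_component R N Ng x d n =
     {fraction R N x m k | m k. m \<in> Ng (n + int k * d)}"

text \<open>The canonical map $N_x \to N_{xy}$, $m/x^k \mapsto y^k m/(xy)^k$.\<close>

definition localization_map ::
  "('a, 'r) ring_scheme \<Rightarrow> ('a, 'b, 'm) module_scheme \<Rightarrow> 'a \<Rightarrow> 'a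
     \<Rightarrow> ('b \<times> nat) set \<Rightarrow> ('b \<times> nat) set" where
  "localization_map R N x y U =
     (\<Union>(m, k) \<in> U. fraction R N (x \<otimes>\<^bsub>R\<^esub> y) ((y [^]\<^bsub>R\<^esub> k) \<odot>\<^bsub>N\<^esub> m) k)"


section \<open>Graded local cohomology\<close>

text \<open>Local cohomology is taken to be the cohomology of the Cech complex
  $$0 \to N \to \bigoplus_i N_{x_i} \to \bigoplus_{i<j} N_{x_i x_j} \to \cdots
    \to N_{x_1 \cdots x_r} \to 0$$
  on homogeneous generators $x_1, \ldots, x_r$ of the ideal, with its natural grading.
  A list \<open>xs\<close> contains pairs \<open>(x, d)\<close> of an element and its degree. A cochain of degree \<open>p\<close>
  is a family indexed by the \<open>p\<close>-element sets of positions in \<open>xs\<close>.\<close>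

definition cech_faces :: "('a \<times> int) list \<Rightarrow> nat \<Rightarrow> nat set set" where
  "cech_faces xs p = {S. S \<subseteq> {..<length xs} \<and> card S = p}"

definition cech_elt :: "('a, 'r) ring_scheme \<Rightarrow> ('a \<times> int) list \<Rightarrow> nat set \<Rightarrow> 'a" where
  "cech_elt R xs S = (\<Otimes>\<^bsub>R\<^esub> i \<in> S. fst (xs ! i))"

definition cech_deg :: "('a \<times> int) list \<Rightarrow> nat set \<Rightarrow> int" where
  "cech_deg xs S = (\<Sum>i \<in> S. snd (xs ! i))"

text \<open>The additive group of homogeneous elements of degree \<open>n\<close> of the \<open>p\<close>-th term.\<close>

definition cech_cochains ::
  "('a, 'r) ring_scheme \<Rightarrow> ('a, 'b, 'm) module_scheme \<Rightarrow> (int \<Rightarrow> 'b set)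
     \<Rightarrow> ('a \<times> int) list \<Rightarrow> nat \<Rightarrow> int \<Rightarrow> (nat set \<Rightarrow> ('b \<times> nat) set) monoid" where
  "cech_cochains R N Ng xs p n =
     \<lparr>carrier = (\<Pi>\<^sub>E S \<in> cech_faces xs p.
                   localization_component R N Ng (cech_elt R xs S) (cech_deg xs S) n),
      monoid.mult = (\<lambda>c c'. \<lambda>S \<in> cech_faces xs p.
                       c S \<oplus>\<^bsub>localization R N (cech_elt R xs S)\<^esub> c' S),
      monoid.one = (\<lambda>S \<in> cech_faces xs p. \<zero>\<^bsub>localization R N (cech_elt R xs S)\<^esub>)\<rparr>"

definition cech_differential ::
  "('a, 'r) ring_scheme \<Rightarrow> ('a, 'b, 'm) module_scheme \<Rightarrow> ('a \<times> int) list \<Rightarrow> nat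
     \<Rightarrow> (nat set \<Rightarrow> ('b \<times> nat) set) \<Rightarrow> (nat set \<Rightarrow> ('b \<times> nat) set)" where
  "cech_differential R N xs p c =
     (\<lambda>T \<in> cech_faces xs (p + 1).
        \<Oplus>\<^bsub>localization R N (cech_elt R xs T)\<^esub> t \<in> T.
          (let v = localization_map R N (cech_elt R xs (T - {t})) (fst (xs ! t)) (c (T - {t}))
           in if even (card {s \<in> T. s < t}) then v
              else \<ominus>\<^bsub>localization R N (cech_elt R xs T)\<^esub> v))"

definition cech_cocycles ::
  "('a, 'r) ring_scheme \<Rightarrow> ('a, 'b, 'm) module_scheme \<Rightarrow> (int \<Rightarrow> 'b set)
     \<Rightarrow> ('a \<times> int) list \<Rightarrow> nat \<Rightarrow> int \<Rightarrow> (nat set \<Rightarrow> ('b \<times> nat) set) set" where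
  "cech_cocycles R N Ng xs p n =
     {c \<in> carrier (cech_cochains R N Ng xs p n).
        cech_differential R N xs p c = \<one>\<^bsub>cech_cochains R N Ng xs (p + 1) n\<^esub>}"

definition cech_coboundaries ::
  "('a, 'r) ring_scheme \<Rightarrow> ('a, 'b, 'm) module_scheme \<Rightarrow> (int \<Rightarrow> 'b set)
     \<Rightarrow> ('a \<times> int) list \<Rightarrow> nat \<Rightarrow> int \<Rightarrow> (nat set \<Rightarrow> ('b \<times> nat) set) set" where
  "cech_coboundaries R N Ng xs p n =
     (case p of 0 \<Rightarrow> {\<one>\<^bsub>cech_cochains R N Ng xs 0 n\<^esub>}
      | Suc q \<Rightarrow> cech_differential R N xs q ` carrier (cech_cochains R N Ng xs q n))"

definition cech_cohomology ::
  "('a, 'r) ring_scheme \<Rightarrow> ('a, 'b, 'm) module_scheme \<Rightarrow> (int \<Rightarrow> 'b set)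
     \<Rightarrow> ('a \<times> int) list \<Rightarrow> nat \<Rightarrow> int \<Rightarrow> (nat set \<Rightarrow> ('b \<times> nat) set) set monoid" where
  "cech_cohomology R N Ng xs p n =
     (cech_cochains R N Ng xs p n)\<lparr>carrier := cech_cocycles R N Ng xs p n\<rparr>
       Mod cech_coboundaries R N Ng xs p n"

definition homogeneous_generators ::
  "('a, 'r) ring_scheme \<Rightarrow> (int \<Rightarrow> 'a set) \<Rightarrow> 'a set \<Rightarrow> ('a \<times> int) list \<Rightarrow> bool" where
  "homogeneous_generators R Rg J xs \<longleftrightarrow>
     (\<forall>(x, d) \<in> set xs. x \<in> Rg d) \<and> J = genideal R (fst ` set xs)"

text \<open>The group $H^p_J(N)_n$, for a graded module \<open>(N, Ng)\<close> over a graded ring \<open>(R, Rg)\<close> and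
  a finitely generated homogeneous ideal \<open>J\<close>. Up to isomorphism it does not depend on the chosen
  generators.\<close>

definition local_cohomology ::
  "('a, 'r) ring_scheme \<Rightarrow> (int \<Rightarrow> 'a set) \<Rightarrow> ('a, 'b, 'm) module_scheme \<Rightarrow> (int \<Rightarrow> 'b set)
     \<Rightarrow> 'a set \<Rightarrow> nat \<Rightarrow> int \<Rightarrow> (nat set \<Rightarrow> ('b \<times> nat) set) set monoid" where
  "local_cohomology R Rg N Ng J p n =
     cech_cohomology R N Ng (SOME xs. homogeneous_generators R Rg J xs) p n"

text \<open>A graded module enters only through the family of its homogeneous components, which are
  groups written multiplicatively. The supremum of the empty set is $-\infty$.\<close>

definition graded_end :: "(int \<Rightarrow> 'h monoid) \<Rightarrow> ereal" where
  "graded_end L = Sup {ereal (of_int n) | n. carrier (L n) \<noteq> {\<one>\<^bsub>L n\<^esub>}}"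

definition a_invariant ::
  "nat \<Rightarrow> ('a, 'r) ring_scheme \<Rightarrow> 'a set \<Rightarrow> ('a, 'b, 'm) module_scheme \<Rightarrow> ereal" where
  "a_invariant p R I M =
     graded_end (local_cohomology (gr_ring R I) (gr_component (gr_ring R I))
                   (gr_module R I M) (gr_component (gr_module R I M))
                   (gr_irrelevant R I) p)"

end

theory Submission
  imports Defs
begin

text \<open>
  Write $\widetilde{I^nM}$ for the Ratliff-Rush submodule of $I^n$. For $n > 0$ it consists of the
  \<open>m\<close> with $I^p m \subseteq I^{p+n}M$ for all large \<open>p\<close> (\<open>ratliff_rush_iff\<close>). The theorem follows
  once $\widetilde{I^nM} = I^nM$ is known for each $n > 0$ such that $H^1_{G_+}(G_I(M))_k = 0$ for
  all $k \ge n$ (\<open>ratliff_rush_eq_of_vanishing\<close>). Two facts give this.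

  The first turns cohomology into elements (\<open>ratliff_rush_descent\<close>): if
  $H^1_{G_+}(G_I(M))_n = 0$, then $\widetilde{I^nM} \subseteq I^nM + \widetilde{I^{n+1}M}$. Let
  $y \in \widetilde{I^nM}$, and let $x_i$ be the generators of $G_+$ on which the Cech complex is
  built; apart from zeros, $x_i$ is the class of some $a_i$ in degree $d_i > 0$. For large \<open>s\<close> the element
  $a_i^s y$ lies in $I^{sd_i+n}M$, and the fractions $[a_i^s y]/x_i^s$ form a 1-cocycle in
  degree \<open>n\<close>, because $x_j^s [a_i^s y] = [a_i^s a_j^s y] = x_i^s [a_j^s y]$. If the cocycle is the
  coboundary of the class of $v \in I^nM$, then for $u = y - v$ some power of each $a_i$ multiplies
  \<open>u\<close> one step deeper into the filtration than its degree predicts. Since the $x_i$ generate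
  $G_+$, a power of $G_+$ does the same, that is, $I^p u \subseteq I^{p+n+1}M$ for large \<open>p\<close>. In
  terms of the exact sequence $0 \to G_I(M) \to L \to L(-1) \to 0$ with
  $L = \bigoplus_n M/I^{n+1}M$, the cocycle represents the image of \<open>y\<close> under the connecting map
  $H^0(L)_{n-1} \to H^1(G_I(M))_n$.

  Iterating, $\widetilde{I^nM} \subseteq I^nM + \widetilde{I^pM}$ for every $p \ge n$. The second
  fact is that $\widetilde{I^pM} = I^pM$ for large \<open>p\<close> when \<open>I\<close> contains an \<open>M\<close>-regular
  element \<open>x\<close> (\<open>ratliff_rush_eventually\<close>). It comes from the Artin-Rees lemma applied to the
  filtration $x(I^nM : I)$ and gives $I^{p+1}M : I \subseteq I^pM$ for large \<open>p\<close>. The Artin-Rees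
  lemma rests on a graded form of Hilbert's basis theorem (\<open>graded_family_acc\<close>).

  If \<open>I\<close> contains no such element, positive grade means $IM = M$, and then all submodules in
  question equal \<open>M\<close>.
\<close>



section \<open>Submodules and powers of an ideal\<close>

lemma (in cring) ideal_of_closed:
  assumes H: "H \<subseteq> carrier R" and z: "\<zero> \<in> H"
    and add: "\<And>a b. a \<in> H \<Longrightarrow> b \<in> H \<Longrightarrow> a \<oplus> b \<in> H"
    and mult: "\<And>a r. a \<in> H \<Longrightarrow> r \<in> carrier R \<Longrightarrow> r \<otimes> a \<in> H"
  shows "ideal H R"
proof (rule idealI[OF ring_axioms])
  show "subgroup H (add_monoid R)"
  proof (rule add.subgroupI[OF H])
    show "H \<noteq> {}" using z by blast
    fix a assume a: "a \<in> H"
    hence "(\<ominus> \<one>) \<otimes> a = \<ominus> a" using H by (simp add: l_minus subset_iff)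
    thus "\<ominus> a \<in> H" using mult[OF a, of "\<ominus> \<one>"] by simp
  qed (rule add)
  show "x \<otimes> a \<in> H" if "a \<in> H" "x \<in> carrier R" for a x using mult[OF that] .
  show "a \<otimes> x \<in> H" if "a \<in> H" "x \<in> carrier R" for a x
    using mult[OF that] m_comm[of a x] that H by auto
qed

lemma (in module) submodule_gen_least:
  "submodule N R M \<Longrightarrow> S \<subseteq> N \<Longrightarrow> submodule_gen R M S \<subseteq> N"
  by (auto simp: submodule_gen_def)

lemma (in module) submodule_gen_superset: "S \<subseteq> submodule_gen R M S"
  by (auto simp: submodule_gen_def)

lemma (in module) submodule_submodule_gen:
  assumes "S \<subseteq> carrier M"
  shows "submodule (submodule_gen R M S) R M"
proof (rule submoduleI)
  show "submodule_gen R M S \<subseteq> carrier M"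
    by (rule submodule_gen_least[OF carrier_is_submodule assms])
  show "\<zero>\<^bsub>M\<^esub> \<in> submodule_gen R M S"
    unfolding submodule_gen_def
    by (auto dest!: submodule.axioms(1) intro: subgroup.one_closed[where G = "add_monoid M", simplified])
qed (auto simp: submodule_gen_def intro: submoduleE)

lemma (in module) submodule_zero_mem: "submodule N R M \<Longrightarrow> \<zero>\<^bsub>M\<^esub> \<in> N"
  by (auto dest!: submodule.axioms(1) intro: subgroup.one_closed[where G = "add_monoid M", simplified])

lemma (in module) submodule_minus_mem:
  "submodule N R M \<Longrightarrow> a \<in> N \<Longrightarrow> b \<in> N \<Longrightarrow> a \<ominus>\<^bsub>M\<^esub> b \<in> N"
  by (simp add: a_minus_def submoduleE)

lemma (in module) zero_submodule: "submodule {\<zero>\<^bsub>M\<^esub>} R M"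
  by (rule submoduleI) auto

lemma (in module) submodule_additive_subgroup:
  "submodule N R M \<Longrightarrow> additive_subgroup N M"
  by (simp add: additive_subgroup_def submodule_def)

lemma (in module) smult_minus_distr:
  "a \<in> carrier R \<Longrightarrow> x \<in> carrier M \<Longrightarrow> y \<in> carrier M \<Longrightarrow>
     a \<odot>\<^bsub>M\<^esub> (x \<ominus>\<^bsub>M\<^esub> y) = a \<odot>\<^bsub>M\<^esub> x \<ominus>\<^bsub>M\<^esub> a \<odot>\<^bsub>M\<^esub> y"
  by (simp add: a_minus_def smult_r_distr smult_r_minus)

lemma (in module) submodule_of_closed:
  assumes H: "H \<subseteq> carrier M" and z: "\<zero>\<^bsub>M\<^esub> \<in> H"
    and add: "\<And>a b. a \<in> H \<Longrightarrow> b \<in> H \<Longrightarrow> a \<oplus>\<^bsub>M\<^esub> b \<in> H"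
    and smult: "\<And>c x. c \<in> carrier R \<Longrightarrow> x \<in> H \<Longrightarrow> c \<odot>\<^bsub>M\<^esub> x \<in> H"
  shows "submodule H R M"
proof (rule submoduleI[OF H z _ add smult])
  fix x assume x: "x \<in> H"
  hence "\<ominus> \<one> \<odot>\<^bsub>M\<^esub> x = \<ominus>\<^bsub>M\<^esub> x" using H smult_l_minus[OF R.one_closed, of x] by auto
  thus "\<ominus>\<^bsub>M\<^esub> x \<in> H" using smult[OF _ x, of "\<ominus> \<one>"] by simp
qed

text \<open>An inclusion $JS \subseteq N$ need only be tested on generators of \<open>J\<close>, or on generators
  of the span of \<open>S\<close>, because the elements that satisfy it form an ideal, or a submodule.\<close>

lemma (in module) scalar_colon_ideal:
  assumes N: "submodule N R M" and S: "S \<subseteq> carrier M"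
  shows "ideal {a \<in> carrier R. \<forall>m\<in>S. a \<odot>\<^bsub>M\<^esub> m \<in> N} R"
  using S
  by (intro R.ideal_of_closed)
     (auto simp: subset_iff smult_l_distr smult_assoc1 submodule_zero_mem[OF N] submoduleE(4,5)[OF N])

lemma (in module) module_colonI:
  "m \<in> carrier M \<Longrightarrow> (\<And>a. a \<in> J \<Longrightarrow> a \<odot>\<^bsub>M\<^esub> m \<in> N) \<Longrightarrow> m \<in> module_colon R M N J"
  by (simp add: module_colon_def)

lemma (in module) module_colonD:
  "m \<in> module_colon R M N J \<Longrightarrow> a \<in> J \<Longrightarrow> a \<odot>\<^bsub>M\<^esub> m \<in> N"
  "m \<in> module_colon R M N J \<Longrightarrow> m \<in> carrier M"
  by (simp_all add: module_colon_def)

lemma (in module) vector_colon_submodule: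
  assumes N: "submodule N R M" and J: "J \<subseteq> carrier R"
  shows "submodule (module_colon R M N J) R M"
proof (rule submodule_of_closed)
  show "module_colon R M N J \<subseteq> carrier M" using module_colonD(2) by blast
  show "\<zero>\<^bsub>M\<^esub> \<in> module_colon R M N J"
    using J submodule_zero_mem[OF N] by (intro module_colonI) (auto simp: subset_iff)
  fix x y assume x: "x \<in> module_colon R M N J" and y: "y \<in> module_colon R M N J"
  note xc = module_colonD(2)[OF x] module_colonD(2)[OF y]
  have "a \<odot>\<^bsub>M\<^esub> (x \<oplus>\<^bsub>M\<^esub> y) \<in> N" if "a \<in> J" for a
    using submoduleE(5)[OF N module_colonD(1)[OF x that] module_colonD(1)[OF y that]]
      smult_r_distr[OF subsetD[OF J that] xc] by simp
  thus "x \<oplus>\<^bsub>M\<^esub> y \<in> module_colon R M N J" using xc by (intro module_colonI) simp_all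
next
  fix a x assume a: "a \<in> carrier R" and x: "x \<in> module_colon R M N J"
  note xc = module_colonD(2)[OF x]
  have "b \<odot>\<^bsub>M\<^esub> (a \<odot>\<^bsub>M\<^esub> x) \<in> N" if b: "b \<in> J" for b
  proof -
    have bc: "b \<in> carrier R" using J b by blast
    have "b \<odot>\<^bsub>M\<^esub> (a \<odot>\<^bsub>M\<^esub> x) = a \<odot>\<^bsub>M\<^esub> (b \<odot>\<^bsub>M\<^esub> x)"
      using smult_assoc1[OF a bc xc] smult_assoc1[OF bc a xc] R.m_comm[OF a bc] by simp
    thus ?thesis using submoduleE(4)[OF N a module_colonD(1)[OF x b]] by simp
  qed
  thus "a \<odot>\<^bsub>M\<^esub> x \<in> module_colon R M N J" using a xc by (intro module_colonI) simp_all
qed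

lemma (in module) ideal_smult_submodule:
  "J \<subseteq> carrier R \<Longrightarrow> submodule (ideal_smult R M J) R M"
  unfolding ideal_smult_def by (rule submodule_submodule_gen) auto

lemma (in module) ideal_smult_mem:
  "a \<in> J \<Longrightarrow> m \<in> carrier M \<Longrightarrow> a \<odot>\<^bsub>M\<^esub> m \<in> ideal_smult R M J"
  unfolding ideal_smult_def by (rule subsetD[OF submodule_gen_superset]) blast

lemma (in module) ideal_smult_least:
  assumes "submodule N R M" "\<And>a m. a \<in> J \<Longrightarrow> m \<in> carrier M \<Longrightarrow> a \<odot>\<^bsub>M\<^esub> m \<in> N"
  shows "ideal_smult R M J \<subseteq> N"
  unfolding ideal_smult_def
proof (rule submodule_gen_least[OF assms(1)])
  show "{a \<odot>\<^bsub>M\<^esub> m | a m. a \<in> J \<and> m \<in> carrier M} \<subseteq> N" using assms(2) by blast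
qed

lemma ideal_pow_0: "ideal_pow R I 0 = carrier R"
  by (simp add: ideal_pow_def ideals_set_def)

lemma ideal_pow_Suc: "ideal_pow R I (Suc n) = ideal_prod R (ideal_pow R I n) I"
  by (simp add: ideal_pow_def) (simp add: ideals_set_def)

locale adic_module = module +
  fixes I :: "'a set"
  assumes ideal_I: "ideal I R"
begin

abbreviation Ipow :: "nat \<Rightarrow> 'a set" where "Ipow n \<equiv> ideal_pow R I n"
abbreviation IM :: "nat \<Rightarrow> 'c set" where "IM n \<equiv> ideal_smult R M (Ipow n)"

lemma Ipow_ideal: "ideal (Ipow n) R"
proof -
  interpret S: comm_monoid "ideals_set R" by (rule R.ideals_set_is_comm_monoid)
  have "I \<in> carrier (ideals_set R)" using ideal_I by (simp add: ideals_set_def)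
  from S.nat_pow_closed[OF this, of n] show ?thesis
    unfolding ideal_pow_def by (simp add: ideals_set_def)
qed

lemma Ipow_closed [simp]: "a \<in> Ipow n \<Longrightarrow> a \<in> carrier R"
  using ideal.Icarr[OF Ipow_ideal] .

lemma I_closed [simp]: "a \<in> I \<Longrightarrow> a \<in> carrier R"
  using ideal.Icarr[OF ideal_I] .

lemma Ipow_subset: "Ipow n \<subseteq> carrier R" by auto

lemmas Ipow_0 = ideal_pow_0[of R I]

lemma Ipow_add: "Ipow (m + n) = ideal_prod R (Ipow m) (Ipow n)"
proof -
  interpret S: comm_monoid "ideals_set R" by (rule R.ideals_set_is_comm_monoid)
  have "I \<in> carrier (ideals_set R)" using ideal_I by (simp add: ideals_set_def)
  from S.nat_pow_mult[OF this, of m n] show ?thesis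
    unfolding ideal_pow_def by (simp add: ideals_set_def)
qed

lemma Ipow_1: "Ipow (Suc 0) = I"
proof -
  interpret S: comm_monoid "ideals_set R" by (rule R.ideals_set_is_comm_monoid)
  have "I \<in> carrier (ideals_set R)" using ideal_I by (simp add: ideals_set_def)
  from S.nat_pow_eone[OF this] show ?thesis unfolding ideal_pow_def by simp
qed

lemma ideal_pow_Ipow: "ideal_pow R (Ipow n) j = Ipow (n * j)"
proof -
  interpret S: comm_monoid "ideals_set R" by (rule R.ideals_set_is_comm_monoid)
  have "I \<in> carrier (ideals_set R)" using ideal_I by (simp add: ideals_set_def)
  from S.nat_pow_pow[OF this, of n j] show ?thesis unfolding ideal_pow_def by simp
qed

lemma Ipow_mult: "a \<in> Ipow m \<Longrightarrow> b \<in> Ipow n \<Longrightarrow> a \<otimes> b \<in> Ipow (m + n)"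
  by (simp add: Ipow_add ideal_prod.prod)

lemma Ipow_add_mem: "a \<in> Ipow m \<Longrightarrow> b \<in> Ipow m \<Longrightarrow> a \<oplus> b \<in> Ipow m"
  using Ipow_ideal[of m] by (simp add: additive_subgroup.a_closed ideal.axioms(1))

lemma Ipow_zero_mem [simp]: "\<zero> \<in> Ipow m"
  using Ipow_ideal[of m] by (simp add: additive_subgroup.zero_closed ideal.axioms(1))

lemma Ipow_antimono: "m \<le> n \<Longrightarrow> Ipow n \<subseteq> Ipow m"
proof (induction n rule: dec_induct)
  case (step n)
  have "Ipow (Suc n) \<subseteq> Ipow n"
    unfolding ideal_pow_Suc using R.ideal_prod_inter[OF Ipow_ideal ideal_I] by auto
  with step show ?case by auto
qed simp

lemma Ipow_power: "a \<in> Ipow p \<Longrightarrow> a [^] (k::nat) \<in> Ipow (k * p)"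
proof (induction k)
  case (Suc k)
  thus ?case using Ipow_mult[of "a [^] k" "k * p" a p] by (simp add: add.commute)
qed (simp add: Ipow_0)

text \<open>The elements of $I^{m+n}$ are sums of products $ab$ with $a \in I^m$ and $b \in I^n$; most
  statements about powers of \<open>I\<close> below are reduced to such products by this rule.\<close>

lemma Ipow_add_induct [consumes 1, case_names prod sum]:
  assumes "c \<in> Ipow (m + n)"
    and "\<And>a b. a \<in> Ipow m \<Longrightarrow> b \<in> Ipow n \<Longrightarrow> P (a \<otimes> b)"
    and "\<And>a b. a \<in> Ipow (m + n) \<Longrightarrow> b \<in> Ipow (m + n) \<Longrightarrow> P a \<Longrightarrow> P b \<Longrightarrow> P (a \<oplus> b)"
  shows "P c"
proof -
  have "c \<in> ideal_prod R (Ipow m) (Ipow n)" using assms(1) by (simp add: Ipow_add)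
  hence "P c \<and> c \<in> ideal_prod R (Ipow m) (Ipow n)"
  proof (induction rule: ideal_prod.induct)
    case (prod i j) thus ?case by (simp add: assms(2) ideal_prod.prod)
  next
    case (sum a b) thus ?case by (simp add: assms(3) Ipow_add ideal_prod.sum)
  qed
  thus ?thesis ..
qed

lemma IM_submodule: "submodule (IM n) R M"
  by (simp add: ideal_smult_submodule Ipow_subset)

lemma IM_closed [simp]: "x \<in> IM n \<Longrightarrow> x \<in> carrier M"
  using submoduleE(1)[OF IM_submodule] by auto

lemma IM_0: "IM 0 = carrier M"
proof
  show "carrier M \<subseteq> IM 0"
  proof
    fix x assume x: "x \<in> carrier M"
    have "\<one> \<odot>\<^bsub>M\<^esub> x \<in> IM 0" by (rule ideal_smult_mem) (simp_all add: Ipow_0 x)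
    thus "x \<in> IM 0" using x by simp
  qed
  show "IM 0 \<subseteq> carrier M" using IM_closed by blast
qed

lemma IM_smult: "a \<in> Ipow p \<Longrightarrow> m \<in> IM q \<Longrightarrow> a \<odot>\<^bsub>M\<^esub> m \<in> IM (p + q)"
proof -
  assume a: "a \<in> Ipow p" and m: "m \<in> IM q"
  have "IM q \<subseteq> module_colon R M (IM (p + q)) (Ipow p)"
  proof (rule ideal_smult_least)
    show "submodule (module_colon R M (IM (p + q)) (Ipow p)) R M"
      by (rule vector_colon_submodule[OF IM_submodule Ipow_subset])
    fix b m assume "b \<in> Ipow q" "m \<in> carrier M"
    thus "b \<odot>\<^bsub>M\<^esub> m \<in> module_colon R M (IM (p + q)) (Ipow p)"
      using ideal_smult_mem[OF Ipow_mult] by (intro module_colonI) (simp_all add: smult_assoc1)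
  qed
  with a m show ?thesis using module_colonD(1) by blast
qed

lemma IM_least:
  assumes "submodule N R M" "\<And>a m. a \<in> Ipow p \<Longrightarrow> m \<in> IM q \<Longrightarrow> a \<odot>\<^bsub>M\<^esub> m \<in> N"
  shows "IM (p + q) \<subseteq> N"
proof (rule ideal_smult_least[OF assms(1)])
  fix c m assume c: "c \<in> Ipow (p + q)" and m: "m \<in> carrier M"
  from c show "c \<odot>\<^bsub>M\<^esub> m \<in> N"
  proof (induction rule: Ipow_add_induct)
    case (prod a b)
    thus ?case using m assms(2)[of a "b \<odot>\<^bsub>M\<^esub> m"] by (simp add: smult_assoc1 ideal_smult_mem)
  next
    case (sum a b)
    thus ?case using m assms(1) by (simp add: smult_l_distr submoduleE)
  qed
qed

lemma IM_antimono: "m \<le> n \<Longrightarrow> IM n \<subseteq> IM m"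
  by (rule ideal_smult_least[OF IM_submodule]) (rule ideal_smult_mem[OF subsetD[OF Ipow_antimono]])

lemma IM_add_mem: "a \<in> IM m \<Longrightarrow> b \<in> IM m \<Longrightarrow> a \<oplus>\<^bsub>M\<^esub> b \<in> IM m"
  using submoduleE(5)[OF IM_submodule] .

lemma IM_zero_mem [simp]: "\<zero>\<^bsub>M\<^esub> \<in> IM m"
  by (rule submodule_zero_mem[OF IM_submodule])

text \<open>In the definition \<open>p\<close> runs over the multiples of \<open>n\<close> only, but the condition
  $I^p m \subseteq I^{p+n}M$ passes from \<open>p\<close> to all larger exponents.\<close>

lemma ratliff_rush_iff:
  assumes "n > 0"
  shows "m \<in> ratliff_rush R M (Ipow n) \<longleftrightarrow>
    m \<in> carrier M \<and> (\<exists>s. \<forall>p\<ge>s. \<forall>a\<in>Ipow p. a \<odot>\<^bsub>M\<^esub> m \<in> IM (p + n))"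
proof safe
  assume "m \<in> ratliff_rush R M (Ipow n)"
  then obtain j where m: "m \<in> carrier M"
    and j: "\<And>a. a \<in> Ipow (n * j) \<Longrightarrow> a \<odot>\<^bsub>M\<^esub> m \<in> IM (n * j + n)"
    unfolding ratliff_rush_def module_colon_def ideal_pow_Ipow
    by (auto simp: algebra_simps)
  show "m \<in> carrier M" by fact
  have "a \<odot>\<^bsub>M\<^esub> m \<in> IM (p + n)" if "p \<ge> n * j" "a \<in> Ipow p" for p a
  proof -
    from that(1) have p: "p = (p - n * j) + n * j" by simp
    from that(2) have "a \<in> Ipow ((p - n * j) + n * j)" using p by simp
    hence "a \<odot>\<^bsub>M\<^esub> m \<in> IM (((p - n * j) + n * j) + n)"
    proof (induction rule: Ipow_add_induct)
      case (prod b c)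
      thus ?case using m IM_smult[OF _ j, of b "p - n * j" c] by (simp add: smult_assoc1 add.assoc)
    next
      case (sum b c)
      thus ?case using m by (simp add: smult_l_distr IM_add_mem)
    qed
    thus ?thesis using p by simp
  qed
  thus "\<exists>s. \<forall>p\<ge>s. \<forall>a\<in>Ipow p. a \<odot>\<^bsub>M\<^esub> m \<in> IM (p + n)" by blast
next
  fix s assume m: "m \<in> carrier M" and s: "\<forall>p\<ge>s. \<forall>a\<in>Ipow p. a \<odot>\<^bsub>M\<^esub> m \<in> IM (p + n)"
  have "n * s \<ge> s" using assms by simp
  with s have "\<forall>a\<in>Ipow (n * s). a \<odot>\<^bsub>M\<^esub> m \<in> IM (n * (s + 1))"
    by (metis mult.commute mult_Suc Suc_eq_plus1 add.commute)
  thus "m \<in> ratliff_rush R M (Ipow n)"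
    unfolding ratliff_rush_def module_colon_def ideal_pow_Ipow using m by blast
qed

lemma IM_subset_ratliff_rush: "IM n \<subseteq> ratliff_rush R M (Ipow n)"
proof
  fix m assume m: "m \<in> IM n"
  have "m \<in> module_colon R M (ideal_smult R M (ideal_pow R (Ipow n) (0 + 1))) (ideal_pow R (Ipow n) 0)"
    using m by (auto simp: module_colon_def ideal_pow_Ipow Ipow_0 intro: submoduleE(4)[OF IM_submodule])
  thus "m \<in> ratliff_rush R M (Ipow n)" unfolding ratliff_rush_def by blast
qed

lemma ratliff_rush_closed: "m \<in> ratliff_rush R M J \<Longrightarrow> m \<in> carrier M"
  by (auto simp: ratliff_rush_def module_colon_def)

end


section \<open>Chain conditions and stable filtrations\<close>

lemma (in abelian_group) minus_zero_imp_eq: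
  assumes "a \<in> carrier G" "b \<in> carrier G" "a \<ominus> b = \<zero>"
  shows "a = b"
proof -
  have "a = (a \<ominus> b) \<oplus> b" using assms(1,2) by (simp add: a_minus_def a_assoc l_neg)
  thus ?thesis using assms by simp
qed

definition (in module) submodule_acc :: bool where
  "submodule_acc \<longleftrightarrow> (\<forall>W :: nat \<Rightarrow> 'c set. (\<forall>i. submodule (W i) R M \<and> W i \<subseteq> W (Suc i)) \<longrightarrow>
     (\<exists>k. \<forall>i\<ge>k. W i = W k))"

lemma (in noetherian_ring) ideal_acc:
  fixes L :: "nat \<Rightarrow> 'a set"
  assumes L: "\<And>i. ideal (L i) R" and mono: "\<And>i. L i \<subseteq> L (Suc i)"
  shows "\<exists>k. \<forall>i\<ge>k. L i = L k"
proof -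
  have le: "L i \<subseteq> L j" if "i \<le> j" for i j using lift_Suc_mono_le[of L, OF mono that] .
  have "subset.chain {I. ideal I R} (range L)"
    unfolding subset_chain_def
  proof (intro conjI ballI)
    show "range L \<subseteq> {I. ideal I R}" using L by blast
    fix J K assume "J \<in> range L" "K \<in> range L"
    then obtain i j where "J = L i" "K = L j" by blast
    thus "J \<subseteq> K \<or> K \<subseteq> J" using le[of i j] le[of j i] nat_le_linear[of i j] by blast
  qed
  from ideal_chain_is_trivial[OF _ this] obtain k where k: "\<Union>(range L) = L k" by blast
  have "L i = L k" if "i \<ge> k" for i using k le[OF that] by blast
  thus ?thesis by blast
qed

lemma (in module) submodule_add_line:
  assumes P: "submodule P R M" and m: "m \<in> carrier M"
  shows "submodule {a \<odot>\<^bsub>M\<^esub> m \<oplus>\<^bsub>M\<^esub> p | a p. a \<in> carrier R \<and> p \<in> P} R M" (is "submodule ?N R M")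
proof (rule submodule_of_closed)
  have Pc: "p \<in> carrier M" if "p \<in> P" for p using submoduleE(1)[OF P] that by blast
  show "?N \<subseteq> carrier M" using m Pc by auto
  have "\<zero>\<^bsub>M\<^esub> = \<zero> \<odot>\<^bsub>M\<^esub> m \<oplus>\<^bsub>M\<^esub> \<zero>\<^bsub>M\<^esub>" using m by simp
  thus "\<zero>\<^bsub>M\<^esub> \<in> ?N" using submodule_zero_mem[OF P] by blast
  {
    fix x y assume "x \<in> ?N" "y \<in> ?N"
    then obtain a p b q where x: "x = a \<odot>\<^bsub>M\<^esub> m \<oplus>\<^bsub>M\<^esub> p" and y: "y = b \<odot>\<^bsub>M\<^esub> m \<oplus>\<^bsub>M\<^esub> q"
      and ab: "a \<in> carrier R" "b \<in> carrier R" and pq: "p \<in> P" "q \<in> P" by blast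
    have "x \<oplus>\<^bsub>M\<^esub> y = (a \<oplus> b) \<odot>\<^bsub>M\<^esub> m \<oplus>\<^bsub>M\<^esub> (p \<oplus>\<^bsub>M\<^esub> q)"
      using ab m Pc[OF pq(1)] Pc[OF pq(2)] x y by (simp add: smult_l_distr M.a_ac)
    thus "x \<oplus>\<^bsub>M\<^esub> y \<in> ?N" using ab submoduleE(5)[OF P pq] by blast
  next
    fix c x assume c: "c \<in> carrier R" and "x \<in> ?N"
    then obtain a p where x: "x = a \<odot>\<^bsub>M\<^esub> m \<oplus>\<^bsub>M\<^esub> p" and a: "a \<in> carrier R" and p: "p \<in> P" by blast
    have "c \<odot>\<^bsub>M\<^esub> x = (c \<otimes> a) \<odot>\<^bsub>M\<^esub> m \<oplus>\<^bsub>M\<^esub> c \<odot>\<^bsub>M\<^esub> p"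
      using a m c Pc[OF p] x by (simp add: smult_assoc1 smult_r_distr)
    thus "c \<odot>\<^bsub>M\<^esub> x \<in> ?N" using a c submoduleE(4)[OF P c p] by blast
  }
qed

text \<open>In a module generated by \<open>P\<close> and \<open>m\<close>, a submodule \<open>W\<close> is controlled by its intersection
  with \<open>P\<close> and by this ideal of coefficients of \<open>m\<close>.\<close>

lemma (in module) leading_ideal:
  assumes P: "submodule P R M" and W: "submodule W R M" and m: "m \<in> carrier M"
  shows "ideal {a \<in> carrier R. \<exists>p\<in>P. a \<odot>\<^bsub>M\<^esub> m \<oplus>\<^bsub>M\<^esub> p \<in> W} R" (is "ideal ?L R")
proof (rule R.ideal_of_closed)
  have Pc: "p \<in> carrier M" if "p \<in> P" for p using submoduleE(1)[OF P] that by blast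
  show "?L \<subseteq> carrier R" by blast
  have "\<zero> \<odot>\<^bsub>M\<^esub> m \<oplus>\<^bsub>M\<^esub> \<zero>\<^bsub>M\<^esub> \<in> W" using m submodule_zero_mem[OF W] by simp
  thus "\<zero> \<in> ?L" using submodule_zero_mem[OF P] by blast
  fix a assume "a \<in> ?L"
  then obtain p where ac: "a \<in> carrier R" and p: "p \<in> P" and w: "a \<odot>\<^bsub>M\<^esub> m \<oplus>\<^bsub>M\<^esub> p \<in> W" by blast
  {
    fix b assume "b \<in> ?L"
    then obtain q where bc: "b \<in> carrier R" and q: "q \<in> P" and w': "b \<odot>\<^bsub>M\<^esub> m \<oplus>\<^bsub>M\<^esub> q \<in> W" by blast
    have "(a \<oplus> b) \<odot>\<^bsub>M\<^esub> m \<oplus>\<^bsub>M\<^esub> (p \<oplus>\<^bsub>M\<^esub> q) = (a \<odot>\<^bsub>M\<^esub> m \<oplus>\<^bsub>M\<^esub> p) \<oplus>\<^bsub>M\<^esub> (b \<odot>\<^bsub>M\<^esub> m \<oplus>\<^bsub>M\<^esub> q)"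
      using ac bc m Pc[OF p] Pc[OF q] by (simp add: smult_l_distr M.a_ac)
    with submoduleE(5)[OF W w w'] submoduleE(5)[OF P p q] ac bc show "a \<oplus> b \<in> ?L" by force
  next
    fix c assume c: "c \<in> carrier R"
    have "(c \<otimes> a) \<odot>\<^bsub>M\<^esub> m \<oplus>\<^bsub>M\<^esub> c \<odot>\<^bsub>M\<^esub> p = c \<odot>\<^bsub>M\<^esub> (a \<odot>\<^bsub>M\<^esub> m \<oplus>\<^bsub>M\<^esub> p)"
      using ac m c Pc[OF p] by (simp add: smult_assoc1 smult_r_distr)
    with submoduleE(4)[OF W c w] submoduleE(4)[OF P c p] ac c show "c \<otimes> a \<in> ?L" by force
  }
qed

lemma (in module) submodule_Int:
  assumes N: "submodule N R M" and P: "submodule P R M"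
  shows "submodule (N \<inter> P) R M"
  using submoduleE(1)[OF N]
  by (intro submodule_of_closed) (auto simp: submodule_zero_mem[OF N] submodule_zero_mem[OF P]
      submoduleE(4,5)[OF N] submoduleE(4,5)[OF P])

text \<open>Induction on the number of generators: along a chain of submodules of $Am + P$ both the
  intersections with \<open>P\<close> and the coefficient ideals of \<open>m\<close> become stationary.\<close>

lemma (in module) finitely_generated_acc:
  assumes noeth: "noetherian_ring R" and fg: "finitely_generated_module R M"
  shows submodule_acc
proof -
  have "\<exists>k. \<forall>i\<ge>k. W i = W k"
    if "finite S" "S \<subseteq> carrier M" "\<And>i. submodule (W i) R M" "\<And>i. W i \<subseteq> submodule_gen R M S"
      "\<And>i. W i \<subseteq> W (Suc i)" for S and W :: "nat \<Rightarrow> 'c set"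
    using that
  proof (induction S arbitrary: W rule: finite_induct)
    case empty
    have "submodule_gen R M {} \<subseteq> {\<zero>\<^bsub>M\<^esub>}" by (rule submodule_gen_least[OF zero_submodule]) simp
    hence "W i = {\<zero>\<^bsub>M\<^esub>}" for i using empty(3)[of i] submodule_zero_mem[OF empty(2), of i] by blast
    thus ?case by simp
  next
    case (insert m S W)
    let ?P = "submodule_gen R M S"
    have m: "m \<in> carrier M" and S: "S \<subseteq> carrier M" using insert.prems(1) by auto
    have P: "submodule ?P R M" by (rule submodule_submodule_gen[OF S])
    have Pc: "p \<in> carrier M" if "p \<in> ?P" for p using submoduleE(1)[OF P] that by blast
    define L where "L i = {a \<in> carrier R. \<exists>p\<in>?P. a \<odot>\<^bsub>M\<^esub> m \<oplus>\<^bsub>M\<^esub> p \<in> W i}" for i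
    have le: "W i \<subseteq> W j" if "i \<le> j" for i j using lift_Suc_mono_le[of W, OF insert.prems(4) that] .
    have "\<exists>k. \<forall>i\<ge>k. L i = L k"
    proof (rule noetherian_ring.ideal_acc[OF noeth])
      show "ideal (L i) R" for i unfolding L_def by (rule leading_ideal[OF P insert.prems(2) m])
      show "L i \<subseteq> L (Suc i)" for i using insert.prems(4)[of i] by (auto simp: L_def)
    qed
    then obtain k where k: "\<And>i. i \<ge> k \<Longrightarrow> L i = L k" by blast
    have "\<exists>k. \<forall>i\<ge>k. W i \<inter> ?P = W k \<inter> ?P"
      by (rule insert.IH[OF S]) (use insert.prems(4) in \<open>auto intro: submodule_Int insert.prems(2) P\<close>)
    then obtain l where l: "\<And>i. i \<ge> l \<Longrightarrow> W i \<inter> ?P = W l \<inter> ?P" by blast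
    have "W i = W (max k l)" if i: "i \<ge> max k l" for i
    proof
      show "W (max k l) \<subseteq> W i" by (rule le[OF i])
      show "W i \<subseteq> W (max k l)"
      proof
        fix w assume w: "w \<in> W i"
        have "submodule_gen R M (insert m S) \<subseteq> {a \<odot>\<^bsub>M\<^esub> m \<oplus>\<^bsub>M\<^esub> p | a p. a \<in> carrier R \<and> p \<in> ?P}"
        proof (rule submodule_gen_least[OF submodule_add_line[OF P m]])
          have "m = \<one> \<odot>\<^bsub>M\<^esub> m \<oplus>\<^bsub>M\<^esub> \<zero>\<^bsub>M\<^esub>" using m by simp
          moreover have "p = \<zero> \<odot>\<^bsub>M\<^esub> m \<oplus>\<^bsub>M\<^esub> p" if "p \<in> S" for p using m S that by (simp add: subset_iff)
          ultimately show "insert m S \<subseteq> {a \<odot>\<^bsub>M\<^esub> m \<oplus>\<^bsub>M\<^esub> p | a p. a \<in> carrier R \<and> p \<in> ?P}"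
            using submodule_gen_superset[of S] submodule_zero_mem[OF P] by blast
        qed
        with w insert.prems(3)[of i] obtain a p
          where wap: "w = a \<odot>\<^bsub>M\<^esub> m \<oplus>\<^bsub>M\<^esub> p" and a: "a \<in> carrier R" and p: "p \<in> ?P" by blast
        from w wap a p have "a \<in> L i" by (auto simp: L_def)
        hence "a \<in> L (max k l)" using k[of i] k[of "max k l"] i by simp
        then obtain q where q: "q \<in> ?P" and aq: "a \<odot>\<^bsub>M\<^esub> m \<oplus>\<^bsub>M\<^esub> q \<in> W (max k l)" by (auto simp: L_def)
        have am: "a \<odot>\<^bsub>M\<^esub> m \<in> carrier M" using a m by simp
        have eq: "w \<ominus>\<^bsub>M\<^esub> (a \<odot>\<^bsub>M\<^esub> m \<oplus>\<^bsub>M\<^esub> q) = p \<ominus>\<^bsub>M\<^esub> q"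
          using am Pc[OF p] Pc[OF q] unfolding wap a_minus_def
          by (simp add: M.minus_add M.a_ac M.r_neg1 M.r_neg)
        have "w \<ominus>\<^bsub>M\<^esub> (a \<odot>\<^bsub>M\<^esub> m \<oplus>\<^bsub>M\<^esub> q) \<in> W i"
          by (rule submodule_minus_mem[OF insert.prems(2) w]) (use aq le[OF i] in blast)
        moreover have "p \<ominus>\<^bsub>M\<^esub> q \<in> ?P" by (rule submodule_minus_mem[OF P p q])
        ultimately have "p \<ominus>\<^bsub>M\<^esub> q \<in> W (max k l)"
          using l[of i] l[of "max k l"] i eq by auto
        from submoduleE(5)[OF insert.prems(2) this aq]
        have "(p \<ominus>\<^bsub>M\<^esub> q) \<oplus>\<^bsub>M\<^esub> (a \<odot>\<^bsub>M\<^esub> m \<oplus>\<^bsub>M\<^esub> q) \<in> W (max k l)" .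
        moreover have "(p \<ominus>\<^bsub>M\<^esub> q) \<oplus>\<^bsub>M\<^esub> (a \<odot>\<^bsub>M\<^esub> m \<oplus>\<^bsub>M\<^esub> q) = w"
          using am Pc[OF p] Pc[OF q] unfolding wap a_minus_def
          by (simp add: M.a_ac M.r_neg1 M.r_neg2 M.r_neg)
        ultimately show "w \<in> W (max k l)" by simp
      qed
    qed
    thus ?case by blast
  qed
  moreover obtain S where "S \<subseteq> carrier M" "finite S" "carrier M = submodule_gen R M S"
    using fg by (auto simp: finitely_generated_module_def)
  ultimately show ?thesis unfolding submodule_acc_def by (metis submoduleE(1))
qed

text \<open>\<open>span_by bs n\<close> is $J^nM$ for $J = (bs)$; the recursion separates the monomials that contain
  the first generator from the others.\<close>

fun (in module) span_by :: "'a list \<Rightarrow> nat \<Rightarrow> 'c set" where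
  "span_by [] 0 = carrier M"
| "span_by [] (Suc n) = {\<zero>\<^bsub>M\<^esub>}"
| "span_by (b # bs) 0 = carrier M"
| "span_by (b # bs) (Suc n) =
     {x \<oplus>\<^bsub>M\<^esub> b \<odot>\<^bsub>M\<^esub> y | x y. x \<in> span_by bs (Suc n) \<and> y \<in> span_by (b # bs) n}"

lemma (in module) span_by_0 [simp]: "span_by bs 0 = carrier M"
  by (cases bs) auto

lemma (in module) submodule_add_scaled:
  assumes P: "submodule P R M" and Q: "submodule Q R M" and b: "b \<in> carrier R"
  shows "submodule {x \<oplus>\<^bsub>M\<^esub> b \<odot>\<^bsub>M\<^esub> y | x y. x \<in> P \<and> y \<in> Q} R M" (is "submodule ?N R M")
proof (rule submodule_of_closed)
  have Pc: "p \<in> carrier M" if "p \<in> P" for p using submoduleE(1)[OF P] that by blast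
  have Qc: "p \<in> carrier M" if "p \<in> Q" for p using submoduleE(1)[OF Q] that by blast
  show "?N \<subseteq> carrier M" using Pc Qc b by auto
  have "\<zero>\<^bsub>M\<^esub> = \<zero>\<^bsub>M\<^esub> \<oplus>\<^bsub>M\<^esub> b \<odot>\<^bsub>M\<^esub> \<zero>\<^bsub>M\<^esub>" using b by simp
  thus "\<zero>\<^bsub>M\<^esub> \<in> ?N" using submodule_zero_mem[OF P] submodule_zero_mem[OF Q] by blast
  {
    fix x x' assume "x \<in> ?N" "x' \<in> ?N"
    then obtain p q p' q' where x: "x = p \<oplus>\<^bsub>M\<^esub> b \<odot>\<^bsub>M\<^esub> q" "x' = p' \<oplus>\<^bsub>M\<^esub> b \<odot>\<^bsub>M\<^esub> q'"
      and p: "p \<in> P" "p' \<in> P" and q: "q \<in> Q" "q' \<in> Q" by blast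
    have "x \<oplus>\<^bsub>M\<^esub> x' = (p \<oplus>\<^bsub>M\<^esub> p') \<oplus>\<^bsub>M\<^esub> b \<odot>\<^bsub>M\<^esub> (q \<oplus>\<^bsub>M\<^esub> q')"
      using b p q x Pc Qc by (simp add: smult_r_distr M.a_ac)
    thus "x \<oplus>\<^bsub>M\<^esub> x' \<in> ?N" using submoduleE(5)[OF P p] submoduleE(5)[OF Q q] by blast
  next
    fix c x assume c: "c \<in> carrier R" and "x \<in> ?N"
    then obtain p q where x: "x = p \<oplus>\<^bsub>M\<^esub> b \<odot>\<^bsub>M\<^esub> q" and p: "p \<in> P" and q: "q \<in> Q" by blast
    have "c \<odot>\<^bsub>M\<^esub> (b \<odot>\<^bsub>M\<^esub> q) = b \<odot>\<^bsub>M\<^esub> (c \<odot>\<^bsub>M\<^esub> q)"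
      using smult_assoc1[OF b c Qc[OF q]] smult_assoc1[OF c b Qc[OF q]] R.m_comm[OF b c] by simp
    hence "c \<odot>\<^bsub>M\<^esub> x = c \<odot>\<^bsub>M\<^esub> p \<oplus>\<^bsub>M\<^esub> b \<odot>\<^bsub>M\<^esub> (c \<odot>\<^bsub>M\<^esub> q)"
      using b c Pc[OF p] Qc[OF q] x by (simp add: smult_r_distr)
    thus "c \<odot>\<^bsub>M\<^esub> x \<in> ?N" using submoduleE(4)[OF P c p] submoduleE(4)[OF Q c q] by blast
  }
qed

lemma (in module) span_by_submodule:
  "set bs \<subseteq> carrier R \<Longrightarrow> submodule (span_by bs n) R M"
  by (induction bs n rule: span_by.induct)
     (simp_all add: carrier_is_submodule zero_submodule submodule_add_scaled)

lemma (in module) smult_commute: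
  "a \<in> carrier R \<Longrightarrow> b \<in> carrier R \<Longrightarrow> x \<in> carrier M \<Longrightarrow> a \<odot>\<^bsub>M\<^esub> (b \<odot>\<^bsub>M\<^esub> x) = b \<odot>\<^bsub>M\<^esub> (a \<odot>\<^bsub>M\<^esub> x)"
  using smult_assoc1[of a b x] smult_assoc1[of b a x] R.m_comm[of a b] by simp

lemma (in module) span_by_step:
  "set bs \<subseteq> carrier R \<Longrightarrow> c \<in> set bs \<Longrightarrow> x \<in> span_by bs n \<Longrightarrow> c \<odot>\<^bsub>M\<^esub> x \<in> span_by bs (Suc n)"
proof (induction bs arbitrary: n x)
  case (Cons b bs)
  have b: "b \<in> carrier R" and bs: "set bs \<subseteq> carrier R" and c: "c \<in> carrier R"
    using Cons.prems by auto
  have cl: "y \<in> carrier M" if "y \<in> span_by (b # bs) k" for y k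
    using submoduleE(1)[OF span_by_submodule[OF Cons.prems(1)]] that by blast
  have cl': "y \<in> carrier M" if "y \<in> span_by bs k" for y k
    using submoduleE(1)[OF span_by_submodule[OF bs]] that by blast
  show ?case
  proof (cases "c = b")
    case True
    have "c \<odot>\<^bsub>M\<^esub> x = \<zero>\<^bsub>M\<^esub> \<oplus>\<^bsub>M\<^esub> b \<odot>\<^bsub>M\<^esub> x" using True b cl[OF Cons.prems(3)] by simp
    thus ?thesis using Cons.prems(3) submodule_zero_mem[OF span_by_submodule[OF bs]]
      unfolding span_by.simps by blast
  next
    case False
    hence cbs: "c \<in> set bs" using Cons.prems by simp
    from Cons.prems(3) show ?thesis
    proof (induction n arbitrary: x)
      case 0
      have "c \<odot>\<^bsub>M\<^esub> x \<in> span_by bs (Suc 0)" using Cons.IH[OF bs cbs, of x 0] 0 by simp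
      moreover have "c \<odot>\<^bsub>M\<^esub> x = c \<odot>\<^bsub>M\<^esub> x \<oplus>\<^bsub>M\<^esub> b \<odot>\<^bsub>M\<^esub> \<zero>\<^bsub>M\<^esub>" using b c 0 by simp
      ultimately show ?case
        using submodule_zero_mem[OF span_by_submodule[OF Cons.prems(1)]] unfolding span_by.simps(4) by blast
    next
      case (Suc n)
      then obtain u y where x: "x = u \<oplus>\<^bsub>M\<^esub> b \<odot>\<^bsub>M\<^esub> y" and u: "u \<in> span_by bs (Suc n)"
        and y: "y \<in> span_by (b # bs) n" by auto
      have "c \<odot>\<^bsub>M\<^esub> x = c \<odot>\<^bsub>M\<^esub> u \<oplus>\<^bsub>M\<^esub> b \<odot>\<^bsub>M\<^esub> (c \<odot>\<^bsub>M\<^esub> y)"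
        using x b c cl[OF y] cl'[OF u] by (simp add: smult_r_distr smult_commute)
      thus ?case using Suc.IH[OF y] Cons.IH[OF bs cbs u] unfolding span_by.simps(4)[of b bs "Suc n"] by blast
    qed
  qed
qed simp

text \<open>These are the homogeneous submodules of the Rees module $\bigoplus_n J^nM$, $J = (bs)$, over
  the polynomial ring with one variable for each member of \<open>bs\<close>.\<close>

definition (in module) graded_family :: "'a list \<Rightarrow> (nat \<Rightarrow> 'c set) \<Rightarrow> bool" where
  "graded_family bs F \<longleftrightarrow> (\<forall>n. submodule (F n) R M \<and> F n \<subseteq> span_by bs n \<and>
     (\<forall>c\<in>set bs. \<forall>x\<in>F n. c \<odot>\<^bsub>M\<^esub> x \<in> F (Suc n)))"

text \<open>This is $bJ^{n-1}M$ with $J = (b, bs)$, so that $J^nM$ is the sum of \<open>span_by bs n\<close> and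
  \<open>multiples_of b bs n\<close> in every degree, $J^{-1}M$ being zero.\<close>

definition (in module) multiples_of :: "'a \<Rightarrow> 'a list \<Rightarrow> nat \<Rightarrow> 'c set" where
  "multiples_of b bs n = (case n of 0 \<Rightarrow> {\<zero>\<^bsub>M\<^esub>} | Suc k \<Rightarrow> {b \<odot>\<^bsub>M\<^esub> y | y. y \<in> span_by (b # bs) k})"

text \<open>Elements of $J^nM$ are polynomials in the generators with coefficients in \<open>M\<close>. Collecting the
  coefficients of the lowest power $b^j$ that occurs plays the role of the leading coefficients in
  Hilbert's basis theorem; lowest powers are at hand because the degree is bounded by \<open>n\<close>.\<close>

definition (in module) lowest_coeffs :: "'a \<Rightarrow> 'a list \<Rightarrow> (nat \<Rightarrow> 'c set) \<Rightarrow> nat \<Rightarrow> nat \<Rightarrow> 'c set" where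
  "lowest_coeffs b bs F j n =
     {u \<in> span_by bs n. \<exists>v\<in>multiples_of b bs n. (b [^] j) \<odot>\<^bsub>M\<^esub> (u \<oplus>\<^bsub>M\<^esub> v) \<in> F (n + j)}"

lemma (in module) lowest_coeffsI:
  "u \<in> span_by bs n \<Longrightarrow> v \<in> multiples_of b bs n \<Longrightarrow> (b [^] j) \<odot>\<^bsub>M\<^esub> (u \<oplus>\<^bsub>M\<^esub> v) \<in> F (n + j) \<Longrightarrow>
     u \<in> lowest_coeffs b bs F j n"
  unfolding lowest_coeffs_def by blast

lemma (in module) multiples_of_submodule:
  assumes "set (b # bs) \<subseteq> carrier R"
  shows "submodule (multiples_of b bs n) R M"
proof (cases n)
  case (Suc k)
  have "submodule {x \<oplus>\<^bsub>M\<^esub> b \<odot>\<^bsub>M\<^esub> y | x y. x \<in> {\<zero>\<^bsub>M\<^esub>} \<and> y \<in> span_by (b # bs) k} R M"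
    using assms by (intro submodule_add_scaled zero_submodule span_by_submodule) auto
  moreover have "{x \<oplus>\<^bsub>M\<^esub> b \<odot>\<^bsub>M\<^esub> y | x y. x \<in> {\<zero>\<^bsub>M\<^esub>} \<and> y \<in> span_by (b # bs) k} = multiples_of b bs n"
    using assms submoduleE(1)[OF span_by_submodule[OF assms]] Suc by (force simp: multiples_of_def)
  ultimately show ?thesis by simp
qed (simp add: multiples_of_def zero_submodule)

lemma (in module) multiples_of_step:
  assumes bs: "set (b # bs) \<subseteq> carrier R" and c: "c \<in> set bs" and v: "v \<in> multiples_of b bs n"
  shows "c \<odot>\<^bsub>M\<^esub> v \<in> multiples_of b bs (Suc n)"
proof (cases n)
  case 0
  have "c \<odot>\<^bsub>M\<^esub> v = b \<odot>\<^bsub>M\<^esub> \<zero>\<^bsub>M\<^esub>" using 0 v bs c by (auto simp: multiples_of_def)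
  moreover have "\<zero>\<^bsub>M\<^esub> \<in> span_by (b # bs) n" by (rule submodule_zero_mem[OF span_by_submodule[OF bs]])
  ultimately show ?thesis unfolding multiples_of_def by auto
next
  case (Suc k)
  then obtain y where y: "y \<in> span_by (b # bs) k" and v': "v = b \<odot>\<^bsub>M\<^esub> y" using v by (auto simp: multiples_of_def)
  have yc: "y \<in> carrier M" using y submoduleE(1)[OF span_by_submodule[OF bs]] by blast
  have "c \<odot>\<^bsub>M\<^esub> y \<in> span_by (b # bs) n" using span_by_step[OF bs _ y, of c] c Suc by simp
  moreover have "c \<odot>\<^bsub>M\<^esub> v = b \<odot>\<^bsub>M\<^esub> (c \<odot>\<^bsub>M\<^esub> y)" using v' bs c yc by (auto intro!: smult_commute)
  ultimately show ?thesis by (auto simp: multiples_of_def)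
qed

lemma (in module) lowest_coeffs_family:
  assumes bs: "set (b # bs) \<subseteq> carrier R" and F: "graded_family (b # bs) F"
  shows "graded_family bs (lowest_coeffs b bs F j)"
proof -
  have b: "b \<in> carrier R" and bs': "set bs \<subseteq> carrier R" using bs by auto
  have bj: "b [^] j \<in> carrier R" using b by simp
  have Fs: "submodule (F k) R M" and Fstep: "\<And>c x. c \<in> set (b # bs) \<Longrightarrow> x \<in> F k \<Longrightarrow> c \<odot>\<^bsub>M\<^esub> x \<in> F (Suc k)" for k
    using F by (auto simp: graded_family_def)
  note S = span_by_submodule[OF bs'] and T = multiples_of_submodule[OF bs]
  have Sc: "u \<in> carrier M" if "u \<in> span_by bs k" for u k using submoduleE(1)[OF S] that by blast
  have Tc: "u \<in> carrier M" if "u \<in> multiples_of b bs k" for u k using submoduleE(1)[OF T] that by blast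
  have step: "c \<odot>\<^bsub>M\<^esub> u \<in> lowest_coeffs b bs F j (Suc n)" if c: "c \<in> set bs" and u: "u \<in> lowest_coeffs b bs F j n" for c u n
  proof -
    from u obtain v where u1: "u \<in> span_by bs n" and v: "v \<in> multiples_of b bs n"
      and w: "(b [^] j) \<odot>\<^bsub>M\<^esub> (u \<oplus>\<^bsub>M\<^esub> v) \<in> F (n + j)" by (auto simp: lowest_coeffs_def)
    have cc: "c \<in> carrier R" using c bs by auto
    have "(b [^] j) \<odot>\<^bsub>M\<^esub> (c \<odot>\<^bsub>M\<^esub> u \<oplus>\<^bsub>M\<^esub> c \<odot>\<^bsub>M\<^esub> v) = c \<odot>\<^bsub>M\<^esub> ((b [^] j) \<odot>\<^bsub>M\<^esub> (u \<oplus>\<^bsub>M\<^esub> v))"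
      using cc bj Sc[OF u1] Tc[OF v] by (simp add: smult_r_distr smult_commute[of c])
    moreover have "c \<odot>\<^bsub>M\<^esub> ((b [^] j) \<odot>\<^bsub>M\<^esub> (u \<oplus>\<^bsub>M\<^esub> v)) \<in> F (Suc n + j)" using Fstep[OF _ w] c by simp
    ultimately have "(b [^] j) \<odot>\<^bsub>M\<^esub> (c \<odot>\<^bsub>M\<^esub> u \<oplus>\<^bsub>M\<^esub> c \<odot>\<^bsub>M\<^esub> v) \<in> F (Suc n + j)" by simp
    thus ?thesis
      using span_by_step[OF bs' c u1] multiples_of_step[OF bs c v] unfolding lowest_coeffs_def by blast
  qed
  have "submodule (lowest_coeffs b bs F j n) R M" for n
  proof (rule submodule_of_closed)
    show "lowest_coeffs b bs F j n \<subseteq> carrier M" using Sc by (auto simp: lowest_coeffs_def)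
    have "(b [^] j) \<odot>\<^bsub>M\<^esub> (\<zero>\<^bsub>M\<^esub> \<oplus>\<^bsub>M\<^esub> \<zero>\<^bsub>M\<^esub>) \<in> F (n + j)" using bj submodule_zero_mem[OF Fs] by simp
    thus "\<zero>\<^bsub>M\<^esub> \<in> lowest_coeffs b bs F j n"
      using submodule_zero_mem[OF S] submodule_zero_mem[OF T] unfolding lowest_coeffs_def by blast
    {
      fix u u' assume "u \<in> lowest_coeffs b bs F j n" "u' \<in> lowest_coeffs b bs F j n"
      then obtain v v' where u: "u \<in> span_by bs n" "u' \<in> span_by bs n"
        and v: "v \<in> multiples_of b bs n" "v' \<in> multiples_of b bs n"
        and w: "(b [^] j) \<odot>\<^bsub>M\<^esub> (u \<oplus>\<^bsub>M\<^esub> v) \<in> F (n + j)" "(b [^] j) \<odot>\<^bsub>M\<^esub> (u' \<oplus>\<^bsub>M\<^esub> v') \<in> F (n + j)"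
        unfolding lowest_coeffs_def by blast
      have "(b [^] j) \<odot>\<^bsub>M\<^esub> ((u \<oplus>\<^bsub>M\<^esub> u') \<oplus>\<^bsub>M\<^esub> (v \<oplus>\<^bsub>M\<^esub> v')) =
          (b [^] j) \<odot>\<^bsub>M\<^esub> (u \<oplus>\<^bsub>M\<^esub> v) \<oplus>\<^bsub>M\<^esub> (b [^] j) \<odot>\<^bsub>M\<^esub> (u' \<oplus>\<^bsub>M\<^esub> v')"
        using bj u[THEN Sc] v[THEN Tc] by (simp add: smult_r_distr M.a_ac)
      thus "u \<oplus>\<^bsub>M\<^esub> u' \<in> lowest_coeffs b bs F j n"
        by (intro lowest_coeffsI[OF submoduleE(5)[OF S u] submoduleE(5)[OF T v]]) (simp only: submoduleE(5)[OF Fs w])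
    next
      fix c u assume c: "c \<in> carrier R" and "u \<in> lowest_coeffs b bs F j n"
      then obtain v where u: "u \<in> span_by bs n" and v: "v \<in> multiples_of b bs n"
        and w: "(b [^] j) \<odot>\<^bsub>M\<^esub> (u \<oplus>\<^bsub>M\<^esub> v) \<in> F (n + j)" unfolding lowest_coeffs_def by blast
      have "(b [^] j) \<odot>\<^bsub>M\<^esub> (c \<odot>\<^bsub>M\<^esub> u \<oplus>\<^bsub>M\<^esub> c \<odot>\<^bsub>M\<^esub> v) = c \<odot>\<^bsub>M\<^esub> ((b [^] j) \<odot>\<^bsub>M\<^esub> (u \<oplus>\<^bsub>M\<^esub> v))"
        using c bj Sc[OF u] Tc[OF v] by (simp add: smult_r_distr smult_commute[of c])
      thus "c \<odot>\<^bsub>M\<^esub> u \<in> lowest_coeffs b bs F j n"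
        by (intro lowest_coeffsI[OF submoduleE(4)[OF S c u] submoduleE(4)[OF T c v]]) (simp only: submoduleE(4)[OF Fs c w])
    }
  qed
  thus ?thesis using step unfolding graded_family_def by (auto simp: lowest_coeffs_def)
qed

lemma (in module) lowest_coeffs_mono:
  assumes "\<And>n. F n \<subseteq> F' n"
  shows "lowest_coeffs b bs F j n \<subseteq> lowest_coeffs b bs F' j n"
  using assms unfolding lowest_coeffs_def by blast

lemma (in module) lowest_coeffs_Suc:
  assumes bs: "set (b # bs) \<subseteq> carrier R" and F: "graded_family (b # bs) F"
  shows "lowest_coeffs b bs F j n \<subseteq> lowest_coeffs b bs F (Suc j) n"
proof
  fix u assume "u \<in> lowest_coeffs b bs F j n"
  then obtain v where u: "u \<in> span_by bs n" and v: "v \<in> multiples_of b bs n"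
    and w: "(b [^] j) \<odot>\<^bsub>M\<^esub> (u \<oplus>\<^bsub>M\<^esub> v) \<in> F (n + j)" by (auto simp: lowest_coeffs_def)
  have b: "b \<in> carrier R" and bs': "set bs \<subseteq> carrier R" using bs by auto
  have uv: "u \<oplus>\<^bsub>M\<^esub> v \<in> carrier M"
    using u v submoduleE(1)[OF span_by_submodule[OF bs']] submoduleE(1)[OF multiples_of_submodule[OF bs]]
    by (intro M.a_closed) blast+
  have "b \<odot>\<^bsub>M\<^esub> ((b [^] j) \<odot>\<^bsub>M\<^esub> (u \<oplus>\<^bsub>M\<^esub> v)) \<in> F (Suc (n + j))"
    using F w unfolding graded_family_def by (metis list.set_intros(1))
  moreover have "b \<odot>\<^bsub>M\<^esub> ((b [^] j) \<odot>\<^bsub>M\<^esub> (u \<oplus>\<^bsub>M\<^esub> v)) = (b [^] Suc j) \<odot>\<^bsub>M\<^esub> (u \<oplus>\<^bsub>M\<^esub> v)"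
    using smult_assoc1[of b "b [^] j", OF _ _ uv] b by (simp add: R.m_comm)
  ultimately have "(b [^] Suc j) \<odot>\<^bsub>M\<^esub> (u \<oplus>\<^bsub>M\<^esub> v) \<in> F (n + Suc j)" by simp
  thus "u \<in> lowest_coeffs b bs F (Suc j) n" by (rule lowest_coeffsI[OF u v])
qed

text \<open>From an element of \<open>F'\<close> in degree \<open>n\<close> that is divisible by $b^j$ one subtracts an element of
  \<open>F\<close> with the same coefficient at $b^j$; the difference is divisible by $b^{j+1}$. After $n$
  subtractions only a multiple of $b^n$ is left, which is its own lowest term.\<close>

lemma (in module) lowest_coeffs_determine:
  assumes bs: "set (b # bs) \<subseteq> carrier R"
    and F: "graded_family (b # bs) F" and F': "graded_family (b # bs) F'"
    and sub: "\<And>n. F n \<subseteq> F' n"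
    and eq: "\<And>j. lowest_coeffs b bs F j = lowest_coeffs b bs F' j"
  shows "F = F'"
proof -
  have b: "b \<in> carrier R" and bs': "set bs \<subseteq> carrier R" using bs by auto
  have Fs: "submodule (F k) R M" and Fs': "submodule (F' k) R M" and Fsp: "F' k \<subseteq> span_by (b # bs) k" for k
    using F F' by (auto simp: graded_family_def)
  have cl: "y \<in> carrier M" if "y \<in> span_by (b # bs) k" for y k
    using submoduleE(1)[OF span_by_submodule[OF bs]] that by blast
  have cl': "y \<in> carrier M" if "y \<in> span_by bs k" for y k
    using submoduleE(1)[OF span_by_submodule[OF bs']] that by blast
  have main: "(b [^] j) \<odot>\<^bsub>M\<^esub> y \<in> F (d + j)"
    if "y \<in> span_by (b # bs) d" "(b [^] j) \<odot>\<^bsub>M\<^esub> y \<in> F' (d + j)" for d j y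
    using that
  proof (induction d arbitrary: j y)
    case 0
    hence "y \<in> lowest_coeffs b bs F' j 0" by (simp add: lowest_coeffs_def multiples_of_def)
    hence "y \<in> lowest_coeffs b bs F j 0" by (simp add: eq)
    thus ?case by (auto simp: lowest_coeffs_def multiples_of_def)
  next
    case (Suc d)
    have bj: "b [^] j \<in> carrier R" using b by simp
    from Suc.prems(1) obtain u y' where y: "y = u \<oplus>\<^bsub>M\<^esub> b \<odot>\<^bsub>M\<^esub> y'" and u: "u \<in> span_by bs (Suc d)"
      and y': "y' \<in> span_by (b # bs) d" unfolding span_by.simps by blast
    have mult: "multiples_of b bs (Suc d) = {b \<odot>\<^bsub>M\<^esub> y | y. y \<in> span_by (b # bs) d}"
      by (simp add: multiples_of_def)
    have "u \<in> lowest_coeffs b bs F' j (Suc d)"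
      using Suc.prems(2) y' unfolding y by (intro lowest_coeffsI[OF u, of "b \<odot>\<^bsub>M\<^esub> y'"]) (auto simp: mult)
    hence "u \<in> lowest_coeffs b bs F j (Suc d)" by (simp only: eq)
    then obtain z where z: "z \<in> span_by (b # bs) d"
      and w: "(b [^] j) \<odot>\<^bsub>M\<^esub> (u \<oplus>\<^bsub>M\<^esub> b \<odot>\<^bsub>M\<^esub> z) \<in> F (Suc d + j)"
      unfolding lowest_coeffs_def mult by blast
    note c = cl[OF y'] cl[OF z] cl'[OF u]
    let ?t = "y' \<ominus>\<^bsub>M\<^esub> z"
    have t: "?t \<in> span_by (b # bs) d" by (rule submodule_minus_mem[OF span_by_submodule[OF bs] y' z])
    have e1: "y \<ominus>\<^bsub>M\<^esub> (u \<oplus>\<^bsub>M\<^esub> b \<odot>\<^bsub>M\<^esub> z) = b \<odot>\<^bsub>M\<^esub> ?t"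
      using b c unfolding y a_minus_def
      by (simp add: smult_r_distr smult_r_minus M.minus_add M.a_ac M.r_neg1 M.r_neg2)
    have e2: "(b [^] Suc j) \<odot>\<^bsub>M\<^esub> ?t = (b [^] j) \<odot>\<^bsub>M\<^esub> y \<ominus>\<^bsub>M\<^esub> (b [^] j) \<odot>\<^bsub>M\<^esub> (u \<oplus>\<^bsub>M\<^esub> b \<odot>\<^bsub>M\<^esub> z)"
      using smult_assoc1[OF bj b, of ?t] smult_minus_distr[OF bj, of y "u \<oplus>\<^bsub>M\<^esub> b \<odot>\<^bsub>M\<^esub> z"] e1 b c
        cl[OF Suc.prems(1)] by simp
    have "(b [^] Suc j) \<odot>\<^bsub>M\<^esub> ?t \<in> F' (d + Suc j)"
      unfolding e2 using submodule_minus_mem[OF Fs' Suc.prems(2), of "(b [^] j) \<odot>\<^bsub>M\<^esub> (u \<oplus>\<^bsub>M\<^esub> b \<odot>\<^bsub>M\<^esub> z)"] w sub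
      by auto
    from Suc.IH[OF t this]
    have "(b [^] j) \<odot>\<^bsub>M\<^esub> y \<ominus>\<^bsub>M\<^esub> (b [^] j) \<odot>\<^bsub>M\<^esub> (u \<oplus>\<^bsub>M\<^esub> b \<odot>\<^bsub>M\<^esub> z) \<in> F (Suc d + j)"
      unfolding e2 by simp
    from submoduleE(5)[OF Fs this w]
    show ?case using bj b c cl[OF Suc.prems(1)] by (simp add: a_minus_def M.a_assoc M.l_neg)
  qed
  have "F' n \<subseteq> F n" for n
  proof
    fix x assume "x \<in> F' n"
    with main[of x n 0] Fsp[of n] show "x \<in> F n" using cl[of x n] by auto
  qed
  with sub show ?thesis by (intro ext) blast
qed

text \<open>Hilbert's basis theorem for the Rees module, in graded form. For a chain $F_i$ the families
  \<open>lowest_coeffs b bs (F i) j\<close> grow with \<open>i\<close> and with \<open>j\<close>. Once the diagonal $i = j$ is stationary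
  from \<open>k\<close> on, so is everything with $i, j \ge k$, and only the finitely many chains with $j < k$
  remain.\<close>

lemma (in module) graded_family_acc:
  fixes F :: "nat \<Rightarrow> nat \<Rightarrow> 'c set"
  assumes acc: submodule_acc
  shows "set bs \<subseteq> carrier R \<Longrightarrow> (\<And>i. graded_family bs (F i)) \<Longrightarrow> (\<And>i n. F i n \<subseteq> F (Suc i) n) \<Longrightarrow>
    \<exists>k. \<forall>i\<ge>k. F i = F k"
proof (induction bs arbitrary: F)
  case Nil
  have "\<exists>k. \<forall>i\<ge>k. F i 0 = F k 0"
  proof (rule acc[unfolded submodule_acc_def, rule_format, of "\<lambda>i. F i 0"])
    show "submodule (F i 0) R M \<and> F i 0 \<subseteq> F (Suc i) 0" for i
      using Nil(2)[of i] Nil(3)[of i 0] unfolding graded_family_def by blast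
  qed
  then obtain k where k: "\<And>i. i \<ge> k \<Longrightarrow> F i 0 = F k 0" by blast
  have z: "F i (Suc n) = {\<zero>\<^bsub>M\<^esub>}" for i n
  proof -
    have "F i (Suc n) \<subseteq> span_by [] (Suc n)" "submodule (F i (Suc n)) R M"
      using Nil(2)[of i] unfolding graded_family_def by blast+
    thus ?thesis using submodule_zero_mem by auto
  qed
  have "F i n = F k n" if "i \<ge> k" for i n using k[OF that] z by (cases n) auto
  thus ?case by blast
next
  case (Cons b bs)
  note bs = Cons.prems(1) and fam = Cons.prems(2)
  have bs': "set bs \<subseteq> carrier R" using bs by simp
  define L where "L i j = lowest_coeffs b bs (F i) j" for i j
  have Ffam: "graded_family bs (L i j)" for i j
    unfolding L_def by (rule lowest_coeffs_family[OF bs fam])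
  have Fle: "F i n \<subseteq> F i' n" if "i \<le> i'" for i i' n
    using lift_Suc_mono_le[of "\<lambda>i. F i n", OF Cons.prems(3) that] .
  have L1: "L i j n \<subseteq> L i' j n" if "i \<le> i'" for i i' j n
    unfolding L_def by (rule lowest_coeffs_mono[OF Fle[OF that]])
  have L2: "L i j n \<subseteq> L i j' n" if "j \<le> j'" for i j j' n
    using lift_Suc_mono_le[of "\<lambda>j. L i j n", OF _ that] lowest_coeffs_Suc[OF bs fam] unfolding L_def by blast
  have L12: "L i j n \<subseteq> L i' j' n" if "i \<le> i'" "j \<le> j'" for i i' j j' n
    using L1[OF that(1)] L2[OF that(2)] by blast
  have "\<exists>k. \<forall>i\<ge>k. L i i = L k k"
    by (rule Cons.IH[OF bs' Ffam]) (rule L12; simp)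
  then obtain k where k: "\<And>i. i \<ge> k \<Longrightarrow> L i i = L k k" by blast
  have "\<exists>K. \<forall>i\<ge>K. L i j = L K j" for j
    by (rule Cons.IH[OF bs' Ffam]) (rule L1; simp)
  then obtain K where K: "\<And>j i. i \<ge> K j \<Longrightarrow> L i j = L (K j) j" by metis
  define N where "N = k + (\<Sum>j<k. K j)"
  have KN: "K j \<le> N" if "j < k" for j
    using member_le_sum[of j "{..<k}" K] that by (simp add: N_def)
  have kN: "k \<le> N" by (simp add: N_def)
  have stab: "L i j = L N j" if i: "i \<ge> N" for i j
  proof (cases "j < k")
    case True
    thus ?thesis using K[of j i] K[of j N] KN[OF True] i by simp
  next
    case False
    have "L i' j = L k k" if i': "i' \<ge> k" for i'
    proof
      fix n
      have "L k k n \<subseteq> L i' j n" using i' False by (intro L12) auto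
      moreover have "L i' j n \<subseteq> L (max i' j) (max i' j) n" by (rule L12) auto
      moreover have "L (max i' j) (max i' j) = L k k" by (rule k) (use i' in simp)
      ultimately show "L i' j n = L k k n" by auto
    qed
    thus ?thesis using i kN by simp
  qed
  have "F i = F N" if i: "i \<ge> N" for i
    using lowest_coeffs_determine[OF bs fam fam Fle[OF i], of ] stab[OF i] unfolding L_def by simp
  thus ?case by blast
qed

text \<open>For an \<open>I\<close>-filtration \<open>F\<close> this is the smallest one that agrees with \<open>F\<close> up to \<open>k\<close>.\<close>

primrec (in module) stable_filtration :: "'a set \<Rightarrow> (nat \<Rightarrow> 'c set) \<Rightarrow> nat \<Rightarrow> nat \<Rightarrow> 'c set" where
  "stable_filtration I F k 0 = F 0"
| "stable_filtration I F k (Suc n) = (if Suc n \<le> k then F (Suc n) else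
     submodule_gen R M {a \<odot>\<^bsub>M\<^esub> x | a x. a \<in> I \<and> x \<in> stable_filtration I F k n})"

context adic_module
begin

lemma IM_subset_span_by:
  assumes "set bs \<subseteq> carrier R" "I = Idl (set bs)"
  shows "IM n \<subseteq> span_by bs n"
proof (induction n)
  case (Suc n)
  let ?C = "{a \<in> carrier R. \<forall>m\<in>span_by bs n. a \<odot>\<^bsub>M\<^esub> m \<in> span_by bs (Suc n)}"
  note S = span_by_submodule[OF assms(1)]
  have "ideal ?C R" by (rule scalar_colon_ideal[OF S submoduleE(1)[OF S]])
  moreover have "set bs \<subseteq> ?C" using assms(1) span_by_step[OF assms(1)] by blast
  ultimately have "I \<subseteq> ?C" unfolding assms(2) by (rule R.genideal_minimal)
  hence "IM (Suc 0 + n) \<subseteq> span_by bs (Suc n)"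
    using Suc by (intro IM_least[OF S]) (auto simp: Ipow_1)
  thus ?case by simp
qed (auto dest: IM_closed)

text \<open>The Artin-Rees lemma: an \<open>I\<close>-filtration below the \<open>I\<close>-adic one is stable. It is the union of
  the increasing chain of its approximations \<open>stable_filtration I F k\<close>, and the chain stops.\<close>

lemma artin_rees:
  assumes noeth: "noetherian_ring R" and acc: submodule_acc
    and F: "\<And>n. submodule (F n) R M" "\<And>n. F n \<subseteq> IM n"
    and step: "\<And>n a x. a \<in> I \<Longrightarrow> x \<in> F n \<Longrightarrow> a \<odot>\<^bsub>M\<^esub> x \<in> F (Suc n)"
  shows "\<exists>c. \<forall>n\<ge>c. F (Suc n) \<subseteq> submodule_gen R M {a \<odot>\<^bsub>M\<^esub> x | a x. a \<in> I \<and> x \<in> F n}"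
proof -
  obtain S where "S \<subseteq> carrier R" "finite S" "I = Idl S"
    using noetherian_ring.finetely_gen[OF noeth ideal_I] by blast
  then obtain bs where bs: "set bs \<subseteq> carrier R" and I: "I = Idl (set bs)"
    using finite_list by metis
  have bsI: "set bs \<subseteq> I" unfolding I by (rule R.genideal_self[OF bs])
  define G where "G = stable_filtration I F"
  have G0: "G k 0 = F 0" and GS: "G k (Suc n) = (if Suc n \<le> k then F (Suc n) else
      submodule_gen R M {a \<odot>\<^bsub>M\<^esub> x | a x. a \<in> I \<and> x \<in> G k n})" for k n by (simp_all add: G_def)
  have Glow: "G k n = F n" if "n \<le> k" for k n using that by (cases n) (auto simp: G0 GS)
  have GF: "submodule (G k n) R M \<and> G k n \<subseteq> F n" for k n
  proof (induction n)
    case (Suc n)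
    let ?S = "{a \<odot>\<^bsub>M\<^esub> x | a x. a \<in> I \<and> x \<in> G k n}"
    have "?S \<subseteq> F (Suc n)" using Suc step by blast
    moreover from this have "?S \<subseteq> carrier M" using submoduleE(1)[OF F(1)] by blast
    ultimately show ?case using F(1) submodule_submodule_gen submodule_gen_least[OF F(1)] by (simp add: GS)
  qed (simp add: G0 F(1))
  have Gstep: "a \<odot>\<^bsub>M\<^esub> x \<in> G k (Suc n)" if "a \<in> I" "x \<in> G k n" for a x k n
  proof (cases "Suc n \<le> k")
    case True
    have "x \<in> F n" using GF that(2) by blast
    thus ?thesis using True step[OF that(1)] by (simp add: GS)
  next
    case False
    have "a \<odot>\<^bsub>M\<^esub> x \<in> {a \<odot>\<^bsub>M\<^esub> x | a x. a \<in> I \<and> x \<in> G k n}" using that by blast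
    thus ?thesis using False subsetD[OF submodule_gen_superset] by (simp add: GS)
  qed
  have "\<exists>k. \<forall>i\<ge>k. G i = G k"
  proof (rule graded_family_acc[OF acc bs])
    show "graded_family bs (G i)" for i
      unfolding graded_family_def using GF F(2) IM_subset_span_by[OF bs I] Gstep bsI by blast
    show "G i n \<subseteq> G (Suc i) n" for i n
    proof (induction n)
      case (Suc n)
      show ?case
      proof (cases "Suc n \<le> Suc i")
        case True
        thus ?thesis using GF[of i "Suc n"] Glow[OF True] by simp
      next
        case False
        have "{a \<odot>\<^bsub>M\<^esub> x | a x. a \<in> I \<and> x \<in> G i n} \<subseteq> G (Suc i) (Suc n)"
          using Suc Gstep by blast
        thus ?thesis using False GF submodule_gen_least by (simp add: GS[of i])
      qed
    qed (simp add: G0)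
  qed
  then obtain k where k: "\<And>i. i \<ge> k \<Longrightarrow> G i = G k" by blast
  have "F (Suc n) \<subseteq> submodule_gen R M {a \<odot>\<^bsub>M\<^esub> x | a x. a \<in> I \<and> x \<in> F n}" if n: "n \<ge> k" for n
  proof -
    have "F (Suc n) = G (Suc n) (Suc n)" by (simp add: Glow)
    also have "\<dots> = G n (Suc n)" using k[of n] k[of "Suc n"] n by simp
    also have "\<dots> = submodule_gen R M {a \<odot>\<^bsub>M\<^esub> x | a x. a \<in> I \<and> x \<in> F n}" by (simp add: GS Glow)
    finally show ?thesis by simp
  qed
  thus ?thesis by blast
qed

text \<open>Multiplication by a regular \<open>x\<close> embeds the modules $I^nM : I$ into $I^nM$; the image is an
  \<open>I\<close>-filtration, so that $x(I^{n+1}M : I) = I \cdot x(I^nM : I) \subseteq xI^nM$ for large \<open>n\<close>.\<close>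

lemma colon_eventually_subset:
  assumes noeth: "noetherian_ring R" and acc: submodule_acc
    and x: "x \<in> I" and reg: "\<And>m. m \<in> carrier M \<Longrightarrow> x \<odot>\<^bsub>M\<^esub> m = \<zero>\<^bsub>M\<^esub> \<Longrightarrow> m = \<zero>\<^bsub>M\<^esub>"
  shows "\<exists>c. \<forall>n\<ge>c. module_colon R M (IM (Suc n)) I \<subseteq> IM n"
proof -
  let ?C = "\<lambda>n. module_colon R M (IM n) I"
  have Ic: "I \<subseteq> carrier R" by auto
  have xc: "x \<in> carrier R" using x by simp
  have C: "submodule (?C n) R M" for n by (rule vector_colon_submodule[OF IM_submodule Ic])
  define sc where "sc N = {u \<oplus>\<^bsub>M\<^esub> x \<odot>\<^bsub>M\<^esub> y | u y. u \<in> {\<zero>\<^bsub>M\<^esub>} \<and> y \<in> N}" for N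
  have sc_sub: "submodule (sc N) R M" if "submodule N R M" for N
    unfolding sc_def by (rule submodule_add_scaled[OF zero_submodule that xc])
  have scI: "x \<odot>\<^bsub>M\<^esub> y \<in> sc N" if "y \<in> N" "y \<in> carrier M" for N y
  proof -
    have "x \<odot>\<^bsub>M\<^esub> y = \<zero>\<^bsub>M\<^esub> \<oplus>\<^bsub>M\<^esub> x \<odot>\<^bsub>M\<^esub> y" using that xc by simp
    thus ?thesis using that unfolding sc_def by blast
  qed
  have scE: "\<exists>y\<in>N. z = x \<odot>\<^bsub>M\<^esub> y" if z: "z \<in> sc N" and N: "N \<subseteq> carrier M" for N z
  proof -
    from z obtain y where y: "y \<in> N" and "z = \<zero>\<^bsub>M\<^esub> \<oplus>\<^bsub>M\<^esub> x \<odot>\<^bsub>M\<^esub> y" unfolding sc_def by blast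
    hence "z = x \<odot>\<^bsub>M\<^esub> y" using N xc by auto
    thus ?thesis using y by blast
  qed
  have Cc: "?C n \<subseteq> carrier M" for n by (rule submoduleE(1)[OF C])
  have xI: "x \<odot>\<^bsub>M\<^esub> y \<in> IM n" if "y \<in> ?C n" for y n using module_colonD(1)[OF that x] .
  have aC: "a \<odot>\<^bsub>M\<^esub> y \<in> IM n" if "a \<in> I" "y \<in> ?C n" for a y n using module_colonD(1)[OF that(2,1)] .
  have IC: "y \<in> ?C (Suc n)" if "y \<in> IM n" for y n
    using IM_smult[of _ "Suc 0" y n] that by (intro module_colonI) (auto simp: Ipow_1)
  have "\<exists>c. \<forall>n\<ge>c. sc (?C (Suc n)) \<subseteq> submodule_gen R M {a \<odot>\<^bsub>M\<^esub> z | a z. a \<in> I \<and> z \<in> sc (?C n)}"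
  proof (rule artin_rees[OF noeth acc sc_sub[OF C]])
    show "sc (?C n) \<subseteq> IM n" for n using scE[OF _ Cc] xI by blast
    fix n a z assume a: "a \<in> I" and "z \<in> sc (?C n)"
    then obtain y where y: "y \<in> ?C n" and z: "z = x \<odot>\<^bsub>M\<^esub> y" using scE[OF _ Cc] by blast
    have "a \<odot>\<^bsub>M\<^esub> z = x \<odot>\<^bsub>M\<^esub> (a \<odot>\<^bsub>M\<^esub> y)" unfolding z
      by (rule smult_commute) (use a xc y Cc in auto)
    thus "a \<odot>\<^bsub>M\<^esub> z \<in> sc (?C (Suc n))" using scI[OF IC[OF aC[OF a y]]] aC[OF a y] by simp
  qed
  then obtain c where c: "\<And>n. n \<ge> c \<Longrightarrow>
      sc (?C (Suc n)) \<subseteq> submodule_gen R M {a \<odot>\<^bsub>M\<^esub> z | a z. a \<in> I \<and> z \<in> sc (?C n)}" by blast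
  have "?C (Suc n) \<subseteq> IM n" if n: "n \<ge> c" for n
  proof
    fix y assume y: "y \<in> ?C (Suc n)"
    hence yc: "y \<in> carrier M" using Cc by blast
    have "submodule_gen R M {a \<odot>\<^bsub>M\<^esub> z | a z. a \<in> I \<and> z \<in> sc (?C n)} \<subseteq> sc (IM n)"
    proof (rule submodule_gen_least[OF sc_sub[OF IM_submodule]], clarify)
      fix a z assume a: "a \<in> I" and "z \<in> sc (?C n)"
      then obtain y where y: "y \<in> ?C n" and z: "z = x \<odot>\<^bsub>M\<^esub> y" using scE[OF _ Cc] by blast
      have "a \<odot>\<^bsub>M\<^esub> z = x \<odot>\<^bsub>M\<^esub> (a \<odot>\<^bsub>M\<^esub> y)" unfolding z
        by (rule smult_commute) (use a xc y Cc in auto)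
      thus "a \<odot>\<^bsub>M\<^esub> z \<in> sc (IM n)" using scI[OF aC[OF a y]] aC[OF a y] by simp
    qed
    with c[OF n] scI[OF y yc] have "x \<odot>\<^bsub>M\<^esub> y \<in> sc (IM n)" by blast
    then obtain w where w: "w \<in> IM n" and e: "x \<odot>\<^bsub>M\<^esub> y = x \<odot>\<^bsub>M\<^esub> w"
      using scE[of _ "IM n"] submoduleE(1)[OF IM_submodule] by blast
    have wc: "w \<in> carrier M" using w by simp
    have "x \<odot>\<^bsub>M\<^esub> (y \<ominus>\<^bsub>M\<^esub> w) = \<zero>\<^bsub>M\<^esub>"
      using e smult_minus_distr[OF xc yc wc] xc wc by (simp add: a_minus_def M.r_neg)
    from reg[OF _ this] have "y \<ominus>\<^bsub>M\<^esub> w = \<zero>\<^bsub>M\<^esub>" using yc wc by simp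
    thus "y \<in> IM n" using w M.minus_zero_imp_eq[OF yc wc] by simp
  qed
  thus ?thesis by (intro exI[of _ c] allI impI)
qed

text \<open>From $I^{s+1}m \subseteq I^{s+1+n}M$ the colon lemma strips one factor \<open>I\<close> at a time, as long as
  the exponents on the right stay at least \<open>c\<close>, which $n \ge c$ ensures down to $s = 0$.\<close>

lemma ratliff_rush_eventually:
  assumes noeth: "noetherian_ring R" and acc: submodule_acc
    and x: "x \<in> I" and reg: "\<And>m. m \<in> carrier M \<Longrightarrow> x \<odot>\<^bsub>M\<^esub> m = \<zero>\<^bsub>M\<^esub> \<Longrightarrow> m = \<zero>\<^bsub>M\<^esub>"
  shows "\<exists>c. \<forall>n\<ge>c. ratliff_rush R M (Ipow n) \<subseteq> IM n"
proof -
  obtain c where c: "\<And>n. n \<ge> c \<Longrightarrow> module_colon R M (IM (Suc n)) I \<subseteq> IM n"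
    using colon_eventually_subset[OF assms] by blast
  have "m \<in> IM n" if n: "n \<ge> Suc c" and m: "m \<in> ratliff_rush R M (Ipow n)" for n m
  proof -
    from m n have mc: "m \<in> carrier M"
      and "\<exists>s. \<forall>p\<ge>s. \<forall>a\<in>Ipow p. a \<odot>\<^bsub>M\<^esub> m \<in> IM (p + n)" using ratliff_rush_iff[of n m] by auto
    then obtain s where s: "\<And>a. a \<in> Ipow s \<Longrightarrow> a \<odot>\<^bsub>M\<^esub> m \<in> IM (s + n)" by blast
    thus ?thesis
    proof (induction s)
      case 0
      from 0[of \<one>] show ?case using mc by (simp add: Ipow_0)
    next
      case (Suc s)
      have "a \<odot>\<^bsub>M\<^esub> m \<in> IM (s + n)" if a: "a \<in> Ipow s" for a
      proof (rule subsetD[OF c])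
        show "s + n \<ge> c" using n by simp
        have ac: "a \<in> carrier R" using a by simp
        have "b \<odot>\<^bsub>M\<^esub> (a \<odot>\<^bsub>M\<^esub> m) \<in> IM (Suc (s + n))" if b: "b \<in> I" for b
        proof -
          have "a \<otimes> b \<in> Ipow (Suc s)" using Ipow_mult[OF a, of b "Suc 0"] b by (simp add: Ipow_1)
          from Suc.prems[OF this] show ?thesis
            using ac b mc by (simp add: smult_assoc1[symmetric] R.m_comm)
        qed
        thus "a \<odot>\<^bsub>M\<^esub> m \<in> module_colon R M (IM (Suc (s + n))) I" using ac mc by (intro module_colonI) auto
      qed
      thus ?case by (rule Suc.IH)
    qed
  qed
  thus ?thesis by blast
qed

end


section \<open>The associated graded ring and module\<close>

lemma (in abelian_subgroup) coset_eq_iff: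
  assumes "a \<in> carrier G" "b \<in> carrier G"
  shows "H +> a = H +> b \<longleftrightarrow> a \<ominus> b \<in> H"
proof
  assume "H +> a = H +> b"
  hence "a \<in> H +> b" using a_rcos_self[OF assms(1)] by simp
  thus "a \<ominus> b \<in> H" using a_rcos_module[OF assms(2,1)] by (simp add: a_minus_def)
next
  assume "a \<ominus> b \<in> H"
  hence "a \<in> H +> b" using a_rcos_module[OF assms(2,1)] by (simp add: a_minus_def)
  from a_repr_independence'[OF this assms(2)] show "H +> a = H +> b" by simp
qed

lemma (in abelian_group_hom) hom_finsum_comp:
  assumes "f \<in> A \<rightarrow> carrier G"
  shows "h (finsum G f A) = finsum H (\<lambda>i. h (f i)) A"
  using assms
proof (induction A rule: infinite_finite_induct)
  case (insert x A)
  have "f x \<in> carrier G" "f \<in> A \<rightarrow> carrier G" using insert.prems by auto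
  moreover have "(\<lambda>i. h (f i)) \<in> A \<rightarrow> carrier H"
    using \<open>f \<in> A \<rightarrow> carrier G\<close> hom_closed by blast
  ultimately show ?case using insert by simp
qed (simp_all add: G.finsum_infinite H.finsum_infinite)

lemma (in additive_subgroup) finsum_mem:
  assumes "abelian_group G" "\<And>i. i \<in> A \<Longrightarrow> f i \<in> H"
  shows "finsum G f A \<in> H"
proof -
  interpret G: abelian_group G by fact
  show ?thesis using assms(2)
  proof (induction A rule: infinite_finite_induct)
    case (insert x A)
    hence "f x \<in> carrier G" "f \<in> A \<rightarrow> carrier G" by auto
    thus ?case using insert by simp
  qed (simp_all add: G.finsum_infinite)
qed

text \<open>The additive structure of the associated graded object depends only on the filtration by
  subgroups; the next locale serves the powers of \<open>I\<close> in \<open>A\<close> and the submodules $I^nM$ of \<open>M\<close> alike.\<close>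

locale filtered_group = abelian_group G for G (structure) +
  fixes F :: "nat \<Rightarrow> 'a set"
  assumes F_subgroup: "additive_subgroup (F n) G"
    and F_Suc: "F (Suc n) \<subseteq> F n"
begin

lemma minus_zero_eq: "a \<in> carrier G \<Longrightarrow> a \<ominus> \<zero> = a"
  by (metis a_minus_def add.inv_closed add.r_inv l_zero r_zero zero_closed a_inv_def)

lemma F_abelian: "abelian_subgroup (F n) G"
  by (rule abelian_subgroupI3[OF F_subgroup abelian_group_axioms])

lemma F_closed: "a \<in> F n \<Longrightarrow> a \<in> carrier G"
  using additive_subgroup.a_subset[OF F_subgroup] by blast

lemma F_zero [simp]: "\<zero> \<in> F n"
  by (rule additive_subgroup.zero_closed[OF F_subgroup])

lemma F_add: "a \<in> F n \<Longrightarrow> b \<in> F n \<Longrightarrow> a \<oplus> b \<in> F n"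
  by (rule additive_subgroup.a_closed[OF F_subgroup])

lemma F_uminus: "a \<in> F n \<Longrightarrow> \<ominus> a \<in> F n"
  by (rule additive_subgroup.a_inv_closed[OF F_subgroup])

text \<open>Calculations in $\bigoplus_n F_n/F_{n+1}$ are carried out on representing sequences. These make
  up $\bigoplus_n F_n$, that is, the Rees algebra or the Rees module.\<close>

definition rep_seqs :: "(nat \<Rightarrow> 'a) set" where
  "rep_seqs = {h. (\<forall>n. h n \<in> F n) \<and> finite {n. h n \<noteq> \<zero>}}"

definition cls :: "(nat \<Rightarrow> 'a) \<Rightarrow> nat \<Rightarrow> 'a set" where
  "cls h = (\<lambda>n. F (n + 1) +> h n)"

definition seqs :: "(nat \<Rightarrow> 'a set) set" where
  "seqs = {f. (\<forall>n. f n \<in> (\<lambda>m. F (n + 1) +> m) ` F n) \<and> finite {n. f n \<noteq> F (n + 1)}}"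

definition single :: "nat \<Rightarrow> 'a \<Rightarrow> nat \<Rightarrow> 'a" where
  "single p a = (\<lambda>k. if k = p then a else \<zero>)"

lemma rep_seqs_mem: "h \<in> rep_seqs \<Longrightarrow> h n \<in> F n"
  by (simp add: rep_seqs_def)

lemma rep_seqs_closed: "h \<in> rep_seqs \<Longrightarrow> h n \<in> carrier G"
  by (rule F_closed[OF rep_seqs_mem])

lemma coset_F_iff: "a \<in> carrier G \<Longrightarrow> b \<in> carrier G \<Longrightarrow> F n +> a = F n +> b \<longleftrightarrow> a \<ominus> b \<in> F n"
  by (rule abelian_subgroup.coset_eq_iff[OF F_abelian])

lemma coset_F_zero: "F n +> \<zero> = F n"
  by (rule a_coset_add_zero) (auto dest: F_closed)

lemma coset_F_eq_zero_iff: "a \<in> carrier G \<Longrightarrow> F n +> a = F n \<longleftrightarrow> a \<in> F n"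
  using coset_F_iff[of a \<zero> n] coset_F_zero[of n] by (simp add: minus_zero_eq)

lemma cls_mem_seqs: "h \<in> rep_seqs \<Longrightarrow> cls h \<in> seqs"
proof -
  assume h: "h \<in> rep_seqs"
  have "{n. cls h n \<noteq> F (n + 1)} \<subseteq> {n. h n \<noteq> \<zero>}"
    using coset_F_zero by (auto simp: cls_def)
  moreover have "finite {n. h n \<noteq> \<zero>}" using h by (simp add: rep_seqs_def)
  ultimately have "finite {n. cls h n \<noteq> F (n + 1)}" by (rule finite_subset)
  thus ?thesis using rep_seqs_mem[OF h] by (auto simp: seqs_def cls_def)
qed

lemma seqs_cls:
  assumes "f \<in> seqs"
  obtains h where "h \<in> rep_seqs" "f = cls h"
proof -
  have "\<exists>a\<in>F n. f n = F (n + 1) +> a" for n using assms by (auto simp: seqs_def)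
  then obtain g where g: "\<And>n. g n \<in> F n" "\<And>n. f n = F (n + 1) +> g n" by metis
  define h where "h n = (if f n = F (n + 1) then \<zero> else g n)" for n
  have "finite {n. f n \<noteq> F (n + 1)}" using assms by (simp add: seqs_def)
  moreover have "{n. h n \<noteq> \<zero>} \<subseteq> {n. f n \<noteq> F (n + 1)}" by (auto simp: h_def)
  ultimately have "finite {n. h n \<noteq> \<zero>}" by (rule finite_subset[rotated])
  hence "h \<in> rep_seqs" using g(1) by (simp add: rep_seqs_def h_def)
  moreover have "f n = cls h n" for n
    using g(2)[of n] coset_F_zero[of "n + 1"] unfolding cls_def h_def by (cases "f n = F (n + 1)") auto
  hence "f = cls h" by (rule ext)
  ultimately show ?thesis using that by blast
qed

lemma cls_eq_iff:
  "h \<in> rep_seqs \<Longrightarrow> h' \<in> rep_seqs \<Longrightarrow> cls h = cls h' \<longleftrightarrow> (\<forall>n. h n \<ominus> h' n \<in> F (Suc n))"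
  unfolding cls_def fun_eq_iff by (simp add: coset_F_iff rep_seqs_closed)

lemma rep_seqs_add: "h \<in> rep_seqs \<Longrightarrow> h' \<in> rep_seqs \<Longrightarrow> (\<lambda>n. h n \<oplus> h' n) \<in> rep_seqs"
proof -
  assume h: "h \<in> rep_seqs" and h': "h' \<in> rep_seqs"
  have "{n. h n \<oplus> h' n \<noteq> \<zero>} \<subseteq> {n. h n \<noteq> \<zero>} \<union> {n. h' n \<noteq> \<zero>}" by auto
  moreover have "finite ({n. h n \<noteq> \<zero>} \<union> {n. h' n \<noteq> \<zero>})" using h h' by (simp add: rep_seqs_def)
  ultimately have "finite {n. h n \<oplus> h' n \<noteq> \<zero>}" by (rule finite_subset)
  thus ?thesis using h h' by (simp add: rep_seqs_def F_add)
qed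

lemma rep_seqs_uminus: "h \<in> rep_seqs \<Longrightarrow> (\<lambda>n. \<ominus> h n) \<in> rep_seqs"
proof -
  assume h: "h \<in> rep_seqs"
  have "{n. \<ominus> h n \<noteq> \<zero>} \<subseteq> {n. h n \<noteq> \<zero>}" by auto
  moreover have "finite {n. h n \<noteq> \<zero>}" using h by (simp add: rep_seqs_def)
  ultimately have "finite {n. \<ominus> h n \<noteq> \<zero>}" by (rule finite_subset)
  thus ?thesis using h by (simp add: rep_seqs_def F_uminus)
qed

lemma rep_seqs_zero: "(\<lambda>n. \<zero>) \<in> rep_seqs"
  by (simp add: rep_seqs_def)

lemma cls_zero: "cls (\<lambda>n. \<zero>) = (\<lambda>n. F (n + 1))"
  using coset_F_zero by (simp add: cls_def)

lemma cls_add: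
  "h \<in> rep_seqs \<Longrightarrow> h' \<in> rep_seqs \<Longrightarrow> (\<lambda>n. cls h n <+>\<^bsub>G\<^esub> cls h' n) = cls (\<lambda>n. h n \<oplus> h' n)"
  unfolding cls_def by (simp add: abelian_subgroup.a_rcos_sum[OF F_abelian] rep_seqs_closed)

lemma single_mem: "a \<in> F p \<Longrightarrow> single p a \<in> rep_seqs"
proof -
  assume a: "a \<in> F p"
  have "finite {n. single p a n \<noteq> \<zero>}" by (rule finite_subset[of _ "{p}"]) (auto simp: single_def)
  thus ?thesis using a by (simp add: rep_seqs_def single_def)
qed

lemma cls_single_add:
  "a \<in> F p \<Longrightarrow> b \<in> F p \<Longrightarrow>
     (\<lambda>n. cls (single p a) n <+>\<^bsub>G\<^esub> cls (single p b) n) = cls (single p (a \<oplus> b))"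
  unfolding cls_add[OF single_mem single_mem] by (rule arg_cong[of _ _ cls]) (auto simp: single_def)

lemma cls_single_eq_iff:
  assumes "a \<in> F p" "b \<in> F p"
  shows "cls (single p a) = cls (single p b) \<longleftrightarrow> a \<ominus> b \<in> F (Suc p)"
proof -
  have "\<zero> \<ominus> \<zero> \<in> F n" for n by (simp add: minus_zero_eq)
  thus ?thesis
    unfolding cls_eq_iff[OF single_mem[OF assms(1)] single_mem[OF assms(2)]] by (auto simp: single_def)
qed

lemma graded_abelian_group:
  assumes "carrier L = seqs" "\<zero>\<^bsub>L\<^esub> = (\<lambda>n. F (n + 1))" "ring.add L = (\<lambda>f g n. f n <+>\<^bsub>G\<^esub> g n)"
  shows "abelian_group L"
proof (rule abelian_groupI)
  fix f g assume "f \<in> carrier L" "g \<in> carrier L"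
  then obtain h k where h: "h \<in> rep_seqs" "f = cls h" and k: "k \<in> rep_seqs" "g = cls k"
    using assms(1) by (metis seqs_cls)
  show "f \<oplus>\<^bsub>L\<^esub> g \<in> carrier L"
    using cls_mem_seqs[OF rep_seqs_add[OF h(1) k(1)]] by (simp add: assms h k cls_add)
  have "(\<lambda>n. h n \<oplus> k n) = (\<lambda>n. k n \<oplus> h n)" using h k by (simp add: rep_seqs_closed a_comm)
  thus "f \<oplus>\<^bsub>L\<^esub> g = g \<oplus>\<^bsub>L\<^esub> f" by (simp add: assms h k cls_add)
  fix e assume "e \<in> carrier L"
  then obtain l where l: "l \<in> rep_seqs" "e = cls l" using assms(1) by (metis seqs_cls)
  show "f \<oplus>\<^bsub>L\<^esub> g \<oplus>\<^bsub>L\<^esub> e = f \<oplus>\<^bsub>L\<^esub> (g \<oplus>\<^bsub>L\<^esub> e)"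
    using h k l by (simp add: assms cls_add rep_seqs_add a_assoc rep_seqs_closed)
next
  show "\<zero>\<^bsub>L\<^esub> \<in> carrier L" using cls_mem_seqs[OF rep_seqs_zero] by (simp add: assms cls_zero)
next
  fix f assume "f \<in> carrier L"
  then obtain h where h: "h \<in> rep_seqs" "f = cls h" using assms(1) by (metis seqs_cls)
  have "\<zero>\<^bsub>L\<^esub> \<oplus>\<^bsub>L\<^esub> f = cls (\<lambda>n. \<zero> \<oplus> h n)"
    unfolding assms cls_zero[symmetric] h(2) by (rule cls_add[OF rep_seqs_zero h(1)])
  thus "\<zero>\<^bsub>L\<^esub> \<oplus>\<^bsub>L\<^esub> f = f" using h by (simp add: rep_seqs_closed)
  have "cls (\<lambda>n. \<ominus> h n) \<oplus>\<^bsub>L\<^esub> f = \<zero>\<^bsub>L\<^esub>"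
    unfolding assms cls_zero[symmetric] h(2) cls_add[OF rep_seqs_uminus[OF h(1)] h(1)]
    using h(1) by (simp add: l_neg rep_seqs_closed)
  thus "\<exists>y\<in>carrier L. y \<oplus>\<^bsub>L\<^esub> f = \<zero>\<^bsub>L\<^esub>"
    using cls_mem_seqs[OF rep_seqs_uminus[OF h(1)]] assms(1) by blast
qed

text \<open>An element of the direct sum is the finite sum of its homogeneous components, whence:\<close>

lemma cls_mem_additive:
  assumes h: "h \<in> rep_seqs" and z: "(\<lambda>n. F (n + 1)) \<in> K"
    and add: "\<And>f g. f \<in> K \<Longrightarrow> g \<in> K \<Longrightarrow> (\<lambda>n. f n <+>\<^bsub>G\<^esub> g n) \<in> K"
    and comp: "\<And>p. cls (single p (h p)) \<in> K"
  shows "cls h \<in> K"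
proof -
  have "cls (\<lambda>n. if n \<in> S then h n else \<zero>) \<in> K" if "finite S" for S
    using that
  proof (induction S rule: finite_induct)
    case empty
    show ?case using z by (simp add: cls_zero)
  next
    case (insert p S)
    have fin: "finite {n. h n \<noteq> \<zero>}" using h by (simp add: rep_seqs_def)
    have "finite {n. (if n \<in> S then h n else \<zero>) \<noteq> \<zero>}"
      by (rule finite_subset[OF _ fin]) auto
    hence S: "(\<lambda>n. if n \<in> S then h n else \<zero>) \<in> rep_seqs"
      using rep_seqs_mem[OF h] unfolding rep_seqs_def by simp
    have "(\<lambda>n. if n \<in> insert p S then h n else \<zero>) =
        (\<lambda>n. single p (h p) n \<oplus> (if n \<in> S then h n else \<zero>))"
      using insert.hyps rep_seqs_closed[OF h] by (auto simp: single_def fun_eq_iff)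
    hence "cls (\<lambda>n. if n \<in> insert p S then h n else \<zero>) =
        (\<lambda>n. cls (single p (h p)) n <+>\<^bsub>G\<^esub> cls (\<lambda>n. if n \<in> S then h n else \<zero>) n)"
      using cls_add[OF single_mem[OF rep_seqs_mem[OF h]] S, of p] by simp
    thus ?case using add[OF comp insert.IH] by simp
  qed
  from this[of "{n. h n \<noteq> \<zero>}"] have "cls (\<lambda>n. if n \<in> {n. h n \<noteq> \<zero>} then h n else \<zero>) \<in> K"
    using h by (simp add: rep_seqs_def)
  moreover have "(\<lambda>n. if n \<in> {n. h n \<noteq> \<zero>} then h n else \<zero>) = h" by auto
  ultimately show ?thesis by simp
qed

lemma gr_component_iff:
  assumes "carrier L = seqs" "\<zero>\<^bsub>L\<^esub> = (\<lambda>n. F (n + 1))"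
  shows "gr_component L d =
    (if d < 0 then {\<zero>\<^bsub>L\<^esub>} else {cls (single (nat d) a) | a. a \<in> F (nat d)})"
proof -
  have z: "\<zero>\<^bsub>L\<^esub> \<in> carrier L"
    using cls_mem_seqs[OF rep_seqs_zero] by (simp add: assms cls_zero)
  show ?thesis
  proof (cases "d < 0")
    case True
    have "f = \<zero>\<^bsub>L\<^esub>" if "\<forall>n. int n \<noteq> d \<longrightarrow> f n = \<zero>\<^bsub>L\<^esub> n" for f
    proof
      fix n show "f n = \<zero>\<^bsub>L\<^esub> n" using that True by auto
    qed
    thus ?thesis using True z by (auto simp: gr_component_def)
  next
    case False
    then obtain p where d: "d = int p" by (metis nonneg_int_cases not_less)
    have "gr_component L (int p) = {cls (single p a) | a. a \<in> F p}" (is "?l = ?r")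
    proof (intro equalityI subsetI)
      fix f assume f: "f \<in> ?l"
      then obtain h where h: "h \<in> rep_seqs" "f = cls h"
        using assms(1) by (auto simp: gr_component_def elim: seqs_cls)
      have "cls h n = cls (single p (h p)) n" for n
      proof (cases "n = p")
        case True thus ?thesis by (simp add: cls_def single_def)
      next
        case False
        hence "cls h n = F (n + 1)" using f h assms(2) by (simp add: gr_component_def)
        thus ?thesis using False coset_F_zero[of "n + 1"] by (simp add: cls_def single_def)
      qed
      hence "f = cls (single p (h p))" using h(2) by auto
      thus "f \<in> ?r" using rep_seqs_mem[OF h(1)] by blast
    next
      fix f assume "f \<in> ?r"
      then obtain a where a: "a \<in> F p" "f = cls (single p a)" by blast
      show "f \<in> ?l" unfolding gr_component_def assms a(2)
        using cls_mem_seqs[OF single_mem[OF a(1)]] coset_F_zero by (auto simp: cls_def single_def)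
    qed
    thus ?thesis by (simp add: d)
  qed
qed

end

sublocale adic_module \<subseteq> Rgr: filtered_group R "\<lambda>n. ideal_pow R I n"
proof (intro filtered_group.intro filtered_group_axioms.intro)
  show "abelian_group R" by (rule R.abelian_group_axioms)
  show "additive_subgroup (Ipow n) R" for n by (rule ideal.axioms(1)[OF Ipow_ideal])
  show "Ipow (Suc n) \<subseteq> Ipow n" for n by (rule Ipow_antimono) simp
qed

sublocale adic_module \<subseteq> Mgr: filtered_group M "\<lambda>n. ideal_smult R M (ideal_pow R I n)"
proof (intro filtered_group.intro filtered_group_axioms.intro)
  show "abelian_group M" by (rule M.abelian_group_axioms)
  show "additive_subgroup (IM n) M" for n by (rule submodule_additive_subgroup[OF IM_submodule])
  show "IM (Suc n) \<subseteq> IM n" for n by (rule IM_antimono) simp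
qed


lemma (in abelian_subgroup) quotient_hom:
  assumes "carrier Q = a_rcosets H" "ring.add Q = set_add G" "\<zero>\<^bsub>Q\<^esub> = H"
  shows "abelian_group_hom G Q ((+>) H)"
proof -
  have Q: "abelian_group Q"
  proof (rule abelian_groupI)
    fix A assume A: "A \<in> carrier Q"
    then obtain a where a: "a \<in> carrier G" "A = H +> a" by (auto simp: assms(1) A_RCOSETS_def')
    have "H +> \<zero> = H" by (rule a_rcos_const) simp
    thus "\<zero>\<^bsub>Q\<^esub> \<oplus>\<^bsub>Q\<^esub> A = A" using a a_rcos_sum[of \<zero> a] by (simp add: assms)
    show "\<exists>y\<in>carrier Q. y \<oplus>\<^bsub>Q\<^esub> A = \<zero>\<^bsub>Q\<^esub>"
      using A a_setinv_closed a_rcosets_inv_mult_group_eq by (auto simp: assms)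
    fix B assume B: "B \<in> carrier Q"
    then obtain b where b: "b \<in> carrier G" "B = H +> b" by (auto simp: assms(1) A_RCOSETS_def')
    show "A \<oplus>\<^bsub>Q\<^esub> B \<in> carrier Q" using A B a_setmult_closed by (simp add: assms)
    show "A \<oplus>\<^bsub>Q\<^esub> B = B \<oplus>\<^bsub>Q\<^esub> A" using a b by (simp add: assms a_rcos_sum a_comm)
    fix C assume "C \<in> carrier Q"
    thus "A \<oplus>\<^bsub>Q\<^esub> B \<oplus>\<^bsub>Q\<^esub> C = A \<oplus>\<^bsub>Q\<^esub> (B \<oplus>\<^bsub>Q\<^esub> C)" using A B a_rcosets_assoc by (simp add: assms)
  qed (simp add: assms a_subgroup_in_rcosets)
  have "group_hom (add_monoid G) (add_monoid Q) ((+>) H)"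
    by (intro group_hom.intro group_hom_axioms.intro a_group abelian_group.a_group[OF Q] homI)
       (simp_all add: assms a_rcos_sum a_rcosetsI[OF a_subset])
  thus ?thesis
    by (intro abelian_group_hom.intro abelian_group_hom_axioms.intro abelian_group_axioms Q)
qed

context adic_module
begin

abbreviation "GA \<equiv> gr_ring R I"
abbreviation "GM \<equiv> gr_module R I M"

text \<open>The multiplication of the Rees algebra and its action on the Rees module, which
  \<open>Rgr.cls\<close> and \<open>Mgr.cls\<close> carry over to the associated graded objects.\<close>

definition conv :: "(nat \<Rightarrow> 'a) \<Rightarrow> (nat \<Rightarrow> 'a) \<Rightarrow> nat \<Rightarrow> 'a" where
  "conv h k = (\<lambda>n. \<Oplus>i\<in>{..n}. h i \<otimes> k (n - i))"

definition act :: "(nat \<Rightarrow> 'a) \<Rightarrow> (nat \<Rightarrow> 'c) \<Rightarrow> nat \<Rightarrow> 'c" where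
  "act h g = (\<lambda>n. \<Oplus>\<^bsub>M\<^esub>i\<in>{..n}. h i \<odot>\<^bsub>M\<^esub> g (n - i))"

text \<open>For $u \in I^{p+1}$ and $v \in I^{q+1}$ the product $(u + a)(v + b)$ differs from $ab$ by an
  element of $I^{p+q+1}$.\<close>

lemma product_of_cosets:
  assumes a: "a \<in> Ipow p" and b: "b \<in> Ipow q"
  shows "rcoset_mult R (Ipow (Suc (p + q))) (Ipow (Suc p) +>\<^bsub>R\<^esub> a) (Ipow (Suc q) +>\<^bsub>R\<^esub> b) =
    Ipow (Suc (p + q)) +>\<^bsub>R\<^esub> (a \<otimes> b)"
proof -
  have ac: "a \<in> carrier R" and bc: "b \<in> carrier R" using a b by auto
  have eq: "Ipow (Suc (p + q)) +>\<^bsub>R\<^esub> (a' \<otimes> b') = Ipow (Suc (p + q)) +>\<^bsub>R\<^esub> (a \<otimes> b)"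
    if "a' \<in> Ipow (Suc p) +>\<^bsub>R\<^esub> a" "b' \<in> Ipow (Suc q) +>\<^bsub>R\<^esub> b" for a' b'
  proof -
    from that obtain u v where u: "u \<in> Ipow (Suc p)" and v: "v \<in> Ipow (Suc q)"
      and a': "a' = u \<oplus> a" and b': "b' = v \<oplus> b" by (auto simp: a_r_coset_def r_coset_def)
    have uc: "u \<in> carrier R" and vc: "v \<in> carrier R" using u v by auto
    have v': "v \<in> Ipow q" using v Ipow_antimono[of q "Suc q"] by auto
    have "u \<otimes> v \<in> Ipow (Suc (p + q))" "u \<otimes> b \<in> Ipow (Suc (p + q))" "a \<otimes> v \<in> Ipow (Suc (p + q))"
      using Ipow_mult[OF u v'] Ipow_mult[OF u b] Ipow_mult[OF a v] by simp_all
    hence "(u \<otimes> v \<oplus> u \<otimes> b) \<oplus> a \<otimes> v \<in> Ipow (Suc (p + q))" by (intro Ipow_add_mem)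
    moreover have "a' \<otimes> b' \<ominus> a \<otimes> b = (u \<otimes> v \<oplus> u \<otimes> b) \<oplus> a \<otimes> v"
      unfolding a' b' using ac bc uc vc by algebra
    ultimately have "a' \<otimes> b' \<ominus> a \<otimes> b \<in> Ipow (Suc (p + q))" by simp
    thus ?thesis using ac bc uc vc unfolding a' b' by (subst Rgr.coset_F_iff) simp_all
  qed
  have "a \<in> Ipow (Suc p) +>\<^bsub>R\<^esub> a" "b \<in> Ipow (Suc q) +>\<^bsub>R\<^esub> b"
    using abelian_subgroup.a_rcos_self[OF Rgr.F_abelian] ac bc by auto
  thus ?thesis unfolding rcoset_mult_def using eq by blast
qed

lemma action_of_cosets:
  assumes a: "a \<in> Ipow p" and m: "m \<in> IM q"
  shows "(\<Union>a'\<in>Ipow (Suc p) +>\<^bsub>R\<^esub> a. \<Union>m'\<in>IM (Suc q) +>\<^bsub>M\<^esub> m. IM (Suc (p + q)) +>\<^bsub>M\<^esub> (a' \<odot>\<^bsub>M\<^esub> m')) =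
    IM (Suc (p + q)) +>\<^bsub>M\<^esub> (a \<odot>\<^bsub>M\<^esub> m)"
proof -
  have ac: "a \<in> carrier R" and mc: "m \<in> carrier M" using a m by auto
  have eq: "IM (Suc (p + q)) +>\<^bsub>M\<^esub> (a' \<odot>\<^bsub>M\<^esub> m') = IM (Suc (p + q)) +>\<^bsub>M\<^esub> (a \<odot>\<^bsub>M\<^esub> m)"
    if "a' \<in> Ipow (Suc p) +>\<^bsub>R\<^esub> a" "m' \<in> IM (Suc q) +>\<^bsub>M\<^esub> m" for a' m'
  proof -
    from that obtain u v where u: "u \<in> Ipow (Suc p)" and v: "v \<in> IM (Suc q)"
      and a': "a' = u \<oplus> a" and m': "m' = v \<oplus>\<^bsub>M\<^esub> m" by (auto simp: a_r_coset_def r_coset_def)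
    have uc: "u \<in> carrier R" and vc: "v \<in> carrier M" using u v by auto
    have v': "v \<in> IM q" using v IM_antimono[of q "Suc q"] by auto
    have in1: "u \<odot>\<^bsub>M\<^esub> v \<in> IM (Suc (p + q))" "u \<odot>\<^bsub>M\<^esub> m \<in> IM (Suc (p + q))" "a \<odot>\<^bsub>M\<^esub> v \<in> IM (Suc (p + q))"
      using IM_smult[OF u v'] IM_smult[OF u m] IM_smult[OF a v] by simp_all
    have "(u \<odot>\<^bsub>M\<^esub> v \<oplus>\<^bsub>M\<^esub> u \<odot>\<^bsub>M\<^esub> m) \<oplus>\<^bsub>M\<^esub> a \<odot>\<^bsub>M\<^esub> v \<in> IM (Suc (p + q))"
      by (rule IM_add_mem[OF IM_add_mem[OF in1(1,2)] in1(3)])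
    moreover have "a' \<odot>\<^bsub>M\<^esub> m' \<ominus>\<^bsub>M\<^esub> a \<odot>\<^bsub>M\<^esub> m = (u \<odot>\<^bsub>M\<^esub> v \<oplus>\<^bsub>M\<^esub> u \<odot>\<^bsub>M\<^esub> m) \<oplus>\<^bsub>M\<^esub> a \<odot>\<^bsub>M\<^esub> v"
      unfolding a' m' a_minus_def using ac mc uc vc
      by (simp add: smult_l_distr smult_r_distr M.a_assoc M.r_neg) (simp add: M.a_comm)
    ultimately have "a' \<odot>\<^bsub>M\<^esub> m' \<ominus>\<^bsub>M\<^esub> a \<odot>\<^bsub>M\<^esub> m \<in> IM (Suc (p + q))" by simp
    thus ?thesis using ac mc uc vc unfolding a' m' by (subst Mgr.coset_F_iff) simp_all
  qed
  have "a \<in> Ipow (Suc p) +>\<^bsub>R\<^esub> a" "m \<in> IM (Suc q) +>\<^bsub>M\<^esub> m"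
    using abelian_subgroup.a_rcos_self[OF Rgr.F_abelian] abelian_subgroup.a_rcos_self[OF Mgr.F_abelian] ac mc
    by auto
  thus ?thesis using eq by blast
qed

lemma GA_simps:
  "carrier GA = Rgr.seqs" "\<zero>\<^bsub>GA\<^esub> = (\<lambda>n. Ipow (n + 1))" "ring.add GA = (\<lambda>f g n. f n <+>\<^bsub>R\<^esub> g n)"
  by (simp_all add: gr_ring_def Rgr.seqs_def)

lemma GM_simps:
  "carrier GM = Mgr.seqs" "\<zero>\<^bsub>GM\<^esub> = (\<lambda>n. IM (n + 1))" "ring.add GM = (\<lambda>f g n. f n <+>\<^bsub>M\<^esub> g n)"
  by (simp_all add: gr_module_def Mgr.seqs_def)

lemma GA_mult_cls:
  assumes h: "h \<in> Rgr.rep_seqs" and k: "k \<in> Rgr.rep_seqs"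
  shows "Rgr.cls h \<otimes>\<^bsub>GA\<^esub> Rgr.cls k = Rgr.cls (conv h k)"
proof
  fix n
  let ?J = "Ipow (n + 1)"
  have hom: "abelian_group_hom R (R Quot ?J) ((+>\<^bsub>R\<^esub>) ?J)"
    by (rule abelian_subgroup.quotient_hom[OF Rgr.F_abelian]) (simp_all add: FactRing_def)
  have pc: "h i \<otimes> k (n - i) \<in> carrier R" for i
    using h k by (simp add: Rgr.rep_seqs_closed)
  hence fc: "(\<lambda>i. h i \<otimes> k (n - i)) \<in> {..n} \<rightarrow> carrier R" by simp
  have term_eq: "rcoset_mult R ?J (Rgr.cls h i) (Rgr.cls k (n - i)) = ?J +>\<^bsub>R\<^esub> (h i \<otimes> k (n - i))"
    if "i \<le> n" for i
    using product_of_cosets[OF Rgr.rep_seqs_mem[OF h] Rgr.rep_seqs_mem[OF k], of i "n - i"] that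
    by (simp add: Rgr.cls_def)
  have abQ: "abelian_monoid (R Quot ?J)"
    using hom by (simp add: abelian_group_hom_def abelian_group_def)
  have "(Rgr.cls h \<otimes>\<^bsub>GA\<^esub> Rgr.cls k) n =
      (\<Oplus>\<^bsub>R Quot ?J\<^esub>i\<in>{..n}. rcoset_mult R ?J (Rgr.cls h i) (Rgr.cls k (n - i)))"
    by (simp add: gr_ring_def)
  also have "\<dots> = (\<Oplus>\<^bsub>R Quot ?J\<^esub>i\<in>{..n}. ?J +>\<^bsub>R\<^esub> (h i \<otimes> k (n - i)))"
    using term_eq abelian_group_hom.hom_closed[OF hom pc]
    by (intro abelian_monoid.finsum_cong'[OF abQ]) auto
  also have "\<dots> = ?J +>\<^bsub>R\<^esub> (\<Oplus>i\<in>{..n}. h i \<otimes> k (n - i))"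
    by (rule abelian_group_hom.hom_finsum_comp[OF hom fc, symmetric])
  also have "\<dots> = Rgr.cls (conv h k) n" by (simp add: Rgr.cls_def conv_def)
  finally show "(Rgr.cls h \<otimes>\<^bsub>GA\<^esub> Rgr.cls k) n = Rgr.cls (conv h k) n" .
qed

lemma GM_smult_cls:
  assumes h: "h \<in> Rgr.rep_seqs" and k: "k \<in> Mgr.rep_seqs"
  shows "Rgr.cls h \<odot>\<^bsub>GM\<^esub> Mgr.cls k = Mgr.cls (act h k)"
proof
  fix n
  let ?J = "IM (n + 1)"
  have hom: "abelian_group_hom M (quot_module R M ?J) ((+>\<^bsub>M\<^esub>) ?J)"
    by (rule abelian_subgroup.quotient_hom[OF Mgr.F_abelian]) (simp_all add: quot_module_def)
  have pc: "h i \<odot>\<^bsub>M\<^esub> k (n - i) \<in> carrier M" for i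
    using h k by (simp add: Rgr.rep_seqs_closed Mgr.rep_seqs_closed)
  hence fc: "(\<lambda>i. h i \<odot>\<^bsub>M\<^esub> k (n - i)) \<in> {..n} \<rightarrow> carrier M" by simp
  have term_eq: "(\<Union>a\<in>Rgr.cls h i. \<Union>m\<in>Mgr.cls k (n - i). ?J +>\<^bsub>M\<^esub> (a \<odot>\<^bsub>M\<^esub> m)) = ?J +>\<^bsub>M\<^esub> (h i \<odot>\<^bsub>M\<^esub> k (n - i))"
    if "i \<le> n" for i
    using action_of_cosets[OF Rgr.rep_seqs_mem[OF h] Mgr.rep_seqs_mem[OF k], of i "n - i"] that
    by (simp add: Rgr.cls_def Mgr.cls_def)
  have abQ: "abelian_monoid (quot_module R M ?J)"
    using hom by (simp add: abelian_group_hom_def abelian_group_def)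
  have "(Rgr.cls h \<odot>\<^bsub>GM\<^esub> Mgr.cls k) n =
      (\<Oplus>\<^bsub>quot_module R M ?J\<^esub>i\<in>{..n}. (\<Union>a\<in>Rgr.cls h i. \<Union>m\<in>Mgr.cls k (n - i). ?J +>\<^bsub>M\<^esub> (a \<odot>\<^bsub>M\<^esub> m)))"
    by (simp add: gr_module_def)
  also have "\<dots> = (\<Oplus>\<^bsub>quot_module R M ?J\<^esub>i\<in>{..n}. ?J +>\<^bsub>M\<^esub> (h i \<odot>\<^bsub>M\<^esub> k (n - i)))"
    using term_eq abelian_group_hom.hom_closed[OF hom pc]
    by (intro abelian_monoid.finsum_cong'[OF abQ]) auto
  also have "\<dots> = ?J +>\<^bsub>M\<^esub> (\<Oplus>\<^bsub>M\<^esub>i\<in>{..n}. h i \<odot>\<^bsub>M\<^esub> k (n - i))"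
    by (rule abelian_group_hom.hom_finsum_comp[OF hom fc, symmetric])
  also have "\<dots> = Mgr.cls (act h k) n" by (simp add: Mgr.cls_def act_def)
  finally show "(Rgr.cls h \<odot>\<^bsub>GM\<^esub> Mgr.cls k) n = Mgr.cls (act h k) n" .
qed

lemma finite_support_bound:
  fixes h :: "nat \<Rightarrow> 'x"
  assumes "finite {n. h n \<noteq> z}"
  obtains N where "\<And>n. n > N \<Longrightarrow> h n = z"
proof -
  obtain N where "\<forall>n\<in>{n. h n \<noteq> z}. n \<le> N" using assms finite_nat_set_iff_bounded_le by blast
  thus ?thesis using that[of N] by (metis leD mem_Collect_eq)
qed

lemma rep_seqs_up: "h \<in> Rgr.rep_seqs \<Longrightarrow> h \<in> up R"
proof
  assume h: "h \<in> Rgr.rep_seqs"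
  show "h n \<in> carrier R" for n by (rule Rgr.rep_seqs_closed[OF h])
  obtain N where "\<And>n. n > N \<Longrightarrow> h n = \<zero>"
    using h finite_support_bound[of h \<zero>] by (auto simp: Rgr.rep_seqs_def)
  thus "\<exists>n. bound \<zero> n h" by (intro exI[of _ N] bound.intro)
qed

lemma conv_mem:
  assumes h: "h \<in> Rgr.rep_seqs" and k: "k \<in> Rgr.rep_seqs"
  shows "conv h k \<in> Rgr.rep_seqs"
proof -
  have "conv h k \<in> up R" unfolding conv_def
    by (rule R.up_mult_closed[OF rep_seqs_up[OF h] rep_seqs_up[OF k]])
  then obtain N where "bound \<zero> N (conv h k)" by (auto simp: up_def)
  hence "{n. conv h k n \<noteq> \<zero>} \<subseteq> {..N}" by (auto dest: bound_below)
  hence "finite {n. conv h k n \<noteq> \<zero>}" by (rule finite_subset) simp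
  moreover have "conv h k n \<in> Ipow n" for n unfolding conv_def
  proof (rule additive_subgroup.finsum_mem[OF Rgr.F_subgroup R.abelian_group_axioms])
    fix i assume "i \<in> {..n}"
    thus "h i \<otimes> k (n - i) \<in> Ipow n"
      using Ipow_mult[OF Rgr.rep_seqs_mem[OF h] Rgr.rep_seqs_mem[OF k], of i "n - i"] by simp
  qed
  ultimately show ?thesis by (simp add: Rgr.rep_seqs_def)
qed

lemma act_mem:
  assumes h: "h \<in> Rgr.rep_seqs" and k: "k \<in> Mgr.rep_seqs"
  shows "act h k \<in> Mgr.rep_seqs"
proof -
  obtain N where N: "\<And>n. n > N \<Longrightarrow> h n = \<zero>"
    using h finite_support_bound[of h \<zero>] by (auto simp: Rgr.rep_seqs_def)
  obtain N' where N': "\<And>n. n > N' \<Longrightarrow> k n = \<zero>\<^bsub>M\<^esub>"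
    using k finite_support_bound[of k "\<zero>\<^bsub>M\<^esub>"] by (auto simp: Mgr.rep_seqs_def)
  have "act h k n = \<zero>\<^bsub>M\<^esub>" if n: "n > N + N'" for n
  proof -
    have "h i \<odot>\<^bsub>M\<^esub> k (n - i) = \<zero>\<^bsub>M\<^esub>" for i
      using N[of i] N'[of "n - i"] n Rgr.rep_seqs_closed[OF h, of i] Mgr.rep_seqs_closed[OF k, of "n - i"]
      by (cases "i > N") auto
    thus ?thesis by (simp add: act_def)
  qed
  hence "{n. act h k n \<noteq> \<zero>\<^bsub>M\<^esub>} \<subseteq> {..N + N'}" by (auto simp: not_less[symmetric])
  hence "finite {n. act h k n \<noteq> \<zero>\<^bsub>M\<^esub>}" by (rule finite_subset) simp
  moreover have "act h k n \<in> IM n" for n unfolding act_def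
  proof (rule additive_subgroup.finsum_mem[OF Mgr.F_subgroup M.abelian_group_axioms])
    fix i assume "i \<in> {..n}"
    thus "h i \<odot>\<^bsub>M\<^esub> k (n - i) \<in> IM n"
      using IM_smult[OF Rgr.rep_seqs_mem[OF h] Mgr.rep_seqs_mem[OF k], of i "n - i"] by simp
  qed
  ultimately show ?thesis by (simp add: Mgr.rep_seqs_def)
qed

definition unit_seq :: "nat \<Rightarrow> 'a" where
  "unit_seq = Rgr.single 0 \<one>"

lemma unit_seq_mem: "unit_seq \<in> Rgr.rep_seqs"
  unfolding unit_seq_def by (rule Rgr.single_mem) (simp add: Ipow_0)

lemma GA_one: "\<one>\<^bsub>GA\<^esub> = Rgr.cls unit_seq"
proof
  fix n
  show "\<one>\<^bsub>GA\<^esub> n = Rgr.cls unit_seq n"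
    using Rgr.coset_F_zero[of "Suc n"]
    by (simp add: gr_ring_def Rgr.cls_def unit_seq_def Rgr.single_def)
qed

text \<open>The ring axioms are inherited from the Rees algebra, a subring of $A[t]$ that maps onto
  $G_I(A)$.\<close>

lemma GA_cring: "cring GA"
proof (rule cringI)
  have U: "UP_ring R" by (intro UP_ring.intro R.ring_axioms)
  have U': "UP_cring R" by (intro UP_cring.intro R.is_cring)
  have conv_UP: "h \<otimes>\<^bsub>UP R\<^esub> k = conv h k" if "h \<in> Rgr.rep_seqs" "k \<in> Rgr.rep_seqs" for h k
    using that[THEN rep_seqs_up] by (simp add: UP_def conv_def)
  have add_UP: "h \<oplus>\<^bsub>UP R\<^esub> k = (\<lambda>n. h n \<oplus> k n)" if "h \<in> Rgr.rep_seqs" "k \<in> Rgr.rep_seqs" for h k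
    using that[THEN rep_seqs_up] by (simp add: UP_def)
  have one_UP: "\<one>\<^bsub>UP R\<^esub> = unit_seq" by (simp add: UP_def unit_seq_def Rgr.single_def)
  have in_UP: "h \<in> carrier (UP R)" if "h \<in> Rgr.rep_seqs" for h
    using rep_seqs_up[OF that] by (simp add: UP_def)
  show "abelian_group GA" by (rule Rgr.graded_abelian_group) (simp_all only: GA_simps)
  show "Group.comm_monoid GA"
  proof (rule comm_monoidI)
    show "\<one>\<^bsub>GA\<^esub> \<in> carrier GA" unfolding GA_one GA_simps by (rule Rgr.cls_mem_seqs[OF unit_seq_mem])
  next
    fix f g assume "f \<in> carrier GA" "g \<in> carrier GA"
    then obtain h k where h: "h \<in> Rgr.rep_seqs" "f = Rgr.cls h" and k: "k \<in> Rgr.rep_seqs" "g = Rgr.cls k"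
      by (metis Rgr.seqs_cls GA_simps(1))
    show "f \<otimes>\<^bsub>GA\<^esub> g \<in> carrier GA"
      using Rgr.cls_mem_seqs[OF conv_mem[OF h(1) k(1)]] by (simp add: GA_simps GA_mult_cls h k)
    show "f \<otimes>\<^bsub>GA\<^esub> g = g \<otimes>\<^bsub>GA\<^esub> f"
      using UP_cring.UP_m_comm[OF U' in_UP[OF h(1)] in_UP[OF k(1)]] h k by (simp add: GA_mult_cls conv_UP)
    fix e assume "e \<in> carrier GA"
    then obtain l where l: "l \<in> Rgr.rep_seqs" "e = Rgr.cls l" by (metis Rgr.seqs_cls GA_simps(1))
    show "f \<otimes>\<^bsub>GA\<^esub> g \<otimes>\<^bsub>GA\<^esub> e = f \<otimes>\<^bsub>GA\<^esub> (g \<otimes>\<^bsub>GA\<^esub> e)"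
      using UP_ring.UP_m_assoc[OF U in_UP[OF h(1)] in_UP[OF k(1)] in_UP[OF l(1)]] h k l
      by (simp add: GA_mult_cls conv_UP conv_mem)
  next
    fix f assume "f \<in> carrier GA"
    then obtain h where h: "h \<in> Rgr.rep_seqs" "f = Rgr.cls h" by (metis Rgr.seqs_cls GA_simps(1))
    show "\<one>\<^bsub>GA\<^esub> \<otimes>\<^bsub>GA\<^esub> f = f"
      using UP_ring.UP_l_one[OF U in_UP[OF h(1)]] h unit_seq_mem by (simp add: GA_one GA_mult_cls conv_UP one_UP)
  qed
  fix f g e assume "f \<in> carrier GA" "g \<in> carrier GA" "e \<in> carrier GA"
  then obtain h k l where h: "h \<in> Rgr.rep_seqs" "f = Rgr.cls h" and k: "k \<in> Rgr.rep_seqs" "g = Rgr.cls k"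
    and l: "l \<in> Rgr.rep_seqs" "e = Rgr.cls l"
    by (metis Rgr.seqs_cls GA_simps(1))
  have "conv (\<lambda>n. h n \<oplus> k n) l = (\<lambda>n. conv h l n \<oplus> conv k l n)"
    using UP_ring.UP_l_distr[OF U in_UP[OF h(1)] in_UP[OF k(1)] in_UP[OF l(1)]] h(1) k(1) l(1)
    by (simp add: conv_UP add_UP conv_mem Rgr.rep_seqs_add)
  thus "(f \<oplus>\<^bsub>GA\<^esub> g) \<otimes>\<^bsub>GA\<^esub> e = f \<otimes>\<^bsub>GA\<^esub> e \<oplus>\<^bsub>GA\<^esub> g \<otimes>\<^bsub>GA\<^esub> e"
    using h k l by (simp add: GA_simps(3) GA_mult_cls Rgr.cls_add conv_mem Rgr.rep_seqs_add)
qed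

text \<open>Both sides are the sum of $h_i k_q l_{n-i-q}$ over $i + q \le n$. The induction that
  rearranges the double sum cuts it off at $i + q \le j$.\<close>

lemma act_conv:
  assumes h: "h \<in> Rgr.rep_seqs" and k: "k \<in> Rgr.rep_seqs" and l: "l \<in> Mgr.rep_seqs"
  shows "act (conv h k) l = act h (act k l)"
proof
  fix n
  have c: "h i \<in> carrier R" "k i \<in> carrier R" "l i \<in> carrier M" for i
    using h k l by (simp_all add: Rgr.rep_seqs_closed Mgr.rep_seqs_closed)
  have "j \<le> n \<Longrightarrow>
      (\<Oplus>\<^bsub>M\<^esub>i\<in>{..j}. (\<Oplus>q\<in>{..i}. h q \<otimes> k (i - q)) \<odot>\<^bsub>M\<^esub> l (n - i)) =
      (\<Oplus>\<^bsub>M\<^esub>i\<in>{..j}. h i \<odot>\<^bsub>M\<^esub> (\<Oplus>\<^bsub>M\<^esub>q\<in>{..j - i}. k q \<odot>\<^bsub>M\<^esub> l (n - i - q)))" for j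
  proof (induction j)
    case 0
    show ?case using c by (simp add: Pi_def smult_assoc1)
  next
    case (Suc j)
    have fin: "(\<Oplus>q\<in>{..i}. h q \<otimes> k (i - q)) \<odot>\<^bsub>M\<^esub> l m = (\<Oplus>\<^bsub>M\<^esub>q\<in>{..i}. (h q \<otimes> k (i - q)) \<odot>\<^bsub>M\<^esub> l m)" for i m
    proof -
      have "f \<in> A \<rightarrow> carrier R \<Longrightarrow> (\<Oplus>q\<in>A. f q) \<odot>\<^bsub>M\<^esub> l m = (\<Oplus>\<^bsub>M\<^esub>q\<in>A. f q \<odot>\<^bsub>M\<^esub> l m)"
        if "finite A" for A and f :: "nat \<Rightarrow> 'a"
        using that
      proof (induction A rule: finite_induct)
        case (insert x A)
        hence "f x \<in> carrier R" "f \<in> A \<rightarrow> carrier R" by auto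
        thus ?case using insert c by (simp add: smult_l_distr Pi_def)
      qed (use c in simp)
      thus ?thesis using c by simp
    qed
    have "(\<Oplus>\<^bsub>M\<^esub>i\<in>{..Suc j}. h i \<odot>\<^bsub>M\<^esub> (\<Oplus>\<^bsub>M\<^esub>q\<in>{..Suc j - i}. k q \<odot>\<^bsub>M\<^esub> l (n - i - q))) =
      h (Suc j) \<odot>\<^bsub>M\<^esub> (k 0 \<odot>\<^bsub>M\<^esub> l (n - Suc j)) \<oplus>\<^bsub>M\<^esub>
      (\<Oplus>\<^bsub>M\<^esub>i\<in>{..j}. h i \<odot>\<^bsub>M\<^esub> (\<Oplus>\<^bsub>M\<^esub>q\<in>{..Suc j - i}. k q \<odot>\<^bsub>M\<^esub> l (n - i - q)))"
      using c by (simp add: M.finsum_Suc Pi_def)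
    also have "(\<Oplus>\<^bsub>M\<^esub>i\<in>{..j}. h i \<odot>\<^bsub>M\<^esub> (\<Oplus>\<^bsub>M\<^esub>q\<in>{..Suc j - i}. k q \<odot>\<^bsub>M\<^esub> l (n - i - q))) =
       (\<Oplus>\<^bsub>M\<^esub>i\<in>{..j}. h i \<odot>\<^bsub>M\<^esub> (k (Suc j - i) \<odot>\<^bsub>M\<^esub> l (n - Suc j)) \<oplus>\<^bsub>M\<^esub>
          h i \<odot>\<^bsub>M\<^esub> (\<Oplus>\<^bsub>M\<^esub>q\<in>{..j - i}. k q \<odot>\<^bsub>M\<^esub> l (n - i - q)))"
    proof (rule M.finsum_cong')
      fix i assume i: "i \<in> {..j}"
      hence "Suc j - i = Suc (j - i)" "n - i - Suc (j - i) = n - Suc j" by auto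
      thus "h i \<odot>\<^bsub>M\<^esub> (\<Oplus>\<^bsub>M\<^esub>q\<in>{..Suc j - i}. k q \<odot>\<^bsub>M\<^esub> l (n - i - q)) =
          h i \<odot>\<^bsub>M\<^esub> (k (Suc j - i) \<odot>\<^bsub>M\<^esub> l (n - Suc j)) \<oplus>\<^bsub>M\<^esub>
          h i \<odot>\<^bsub>M\<^esub> (\<Oplus>\<^bsub>M\<^esub>q\<in>{..j - i}. k q \<odot>\<^bsub>M\<^esub> l (n - i - q))"
        using c by (simp add: M.finsum_Suc Pi_def smult_r_distr)
    qed (use c in \<open>auto simp: Pi_def\<close>)
    also have "\<dots> = (\<Oplus>\<^bsub>M\<^esub>i\<in>{..j}. h i \<odot>\<^bsub>M\<^esub> (k (Suc j - i) \<odot>\<^bsub>M\<^esub> l (n - Suc j))) \<oplus>\<^bsub>M\<^esub>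
        (\<Oplus>\<^bsub>M\<^esub>i\<in>{..j}. h i \<odot>\<^bsub>M\<^esub> (\<Oplus>\<^bsub>M\<^esub>q\<in>{..j - i}. k q \<odot>\<^bsub>M\<^esub> l (n - i - q)))"
      using c by (intro M.finsum_addf) (auto simp: Pi_def)
    also have "(\<Oplus>\<^bsub>M\<^esub>i\<in>{..j}. h i \<odot>\<^bsub>M\<^esub> (\<Oplus>\<^bsub>M\<^esub>q\<in>{..j - i}. k q \<odot>\<^bsub>M\<^esub> l (n - i - q))) =
        (\<Oplus>\<^bsub>M\<^esub>i\<in>{..j}. (\<Oplus>q\<in>{..i}. h q \<otimes> k (i - q)) \<odot>\<^bsub>M\<^esub> l (n - i))"
      using Suc by simp
    finally have rhs: "(\<Oplus>\<^bsub>M\<^esub>i\<in>{..Suc j}. h i \<odot>\<^bsub>M\<^esub> (\<Oplus>\<^bsub>M\<^esub>q\<in>{..Suc j - i}. k q \<odot>\<^bsub>M\<^esub> l (n - i - q))) =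
      h (Suc j) \<odot>\<^bsub>M\<^esub> (k 0 \<odot>\<^bsub>M\<^esub> l (n - Suc j)) \<oplus>\<^bsub>M\<^esub>
      ((\<Oplus>\<^bsub>M\<^esub>i\<in>{..j}. h i \<odot>\<^bsub>M\<^esub> (k (Suc j - i) \<odot>\<^bsub>M\<^esub> l (n - Suc j))) \<oplus>\<^bsub>M\<^esub>
        (\<Oplus>\<^bsub>M\<^esub>i\<in>{..j}. (\<Oplus>q\<in>{..i}. h q \<otimes> k (i - q)) \<odot>\<^bsub>M\<^esub> l (n - i)))" .
    have sc: "(\<Oplus>q\<in>{..i}. h q \<otimes> k (i - q)) \<in> carrier R" for i using c by (intro R.finsum_closed) auto
    have "(\<Oplus>\<^bsub>M\<^esub>i\<in>{..Suc j}. (\<Oplus>q\<in>{..i}. h q \<otimes> k (i - q)) \<odot>\<^bsub>M\<^esub> l (n - i)) =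
      (\<Oplus>q\<in>{..Suc j}. h q \<otimes> k (Suc j - q)) \<odot>\<^bsub>M\<^esub> l (n - Suc j) \<oplus>\<^bsub>M\<^esub>
      (\<Oplus>\<^bsub>M\<^esub>i\<in>{..j}. (\<Oplus>q\<in>{..i}. h q \<otimes> k (i - q)) \<odot>\<^bsub>M\<^esub> l (n - i))"
      using c sc by (intro M.finsum_Suc) (auto simp: Pi_def)
    also have "(\<Oplus>q\<in>{..Suc j}. h q \<otimes> k (Suc j - q)) \<odot>\<^bsub>M\<^esub> l (n - Suc j) =
       (\<Oplus>\<^bsub>M\<^esub>q\<in>{..Suc j}. (h q \<otimes> k (Suc j - q)) \<odot>\<^bsub>M\<^esub> l (n - Suc j))" by (rule fin)
    also have "\<dots> = (h (Suc j) \<otimes> k 0) \<odot>\<^bsub>M\<^esub> l (n - Suc j) \<oplus>\<^bsub>M\<^esub>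
       (\<Oplus>\<^bsub>M\<^esub>q\<in>{..j}. (h q \<otimes> k (Suc j - q)) \<odot>\<^bsub>M\<^esub> l (n - Suc j))"
      using c by (subst M.finsum_Suc) (auto simp: Pi_def)
    also have "(\<Oplus>\<^bsub>M\<^esub>q\<in>{..j}. (h q \<otimes> k (Suc j - q)) \<odot>\<^bsub>M\<^esub> l (n - Suc j)) =
       (\<Oplus>\<^bsub>M\<^esub>i\<in>{..j}. h i \<odot>\<^bsub>M\<^esub> (k (Suc j - i) \<odot>\<^bsub>M\<^esub> l (n - Suc j)))"
      using c by (intro M.finsum_cong') (auto simp: Pi_def smult_assoc1)
    finally show ?case
      unfolding rhs using c sc by (simp add: smult_assoc1 M.a_assoc Pi_def M.finsum_closed)
  qed
  from this[of n] show "act (conv h k) l n = act h (act k l) n"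
    by (simp add: act_def conv_def)
qed

lemma GM_module: "module GA GM"
proof (rule moduleI[OF GA_cring])
  show "abelian_group GM" by (rule Mgr.graded_abelian_group) (simp_all only: GM_simps)
next
  fix f x assume "f \<in> carrier GA" "x \<in> carrier GM"
  then obtain h k where h: "h \<in> Rgr.rep_seqs" "f = Rgr.cls h" and k: "k \<in> Mgr.rep_seqs" "x = Mgr.cls k"
    by (metis Rgr.seqs_cls Mgr.seqs_cls GA_simps(1) GM_simps(1))
  show "f \<odot>\<^bsub>GM\<^esub> x \<in> carrier GM"
    using Mgr.cls_mem_seqs[OF act_mem[OF h(1) k(1)]] by (simp add: GM_simps GM_smult_cls h k)
next
  fix f g x assume "f \<in> carrier GA" "g \<in> carrier GA" "x \<in> carrier GM"
  then obtain h l k where h: "h \<in> Rgr.rep_seqs" "f = Rgr.cls h" and l: "l \<in> Rgr.rep_seqs" "g = Rgr.cls l"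
    and k: "k \<in> Mgr.rep_seqs" "x = Mgr.cls k"
    by (metis Rgr.seqs_cls Mgr.seqs_cls GA_simps(1) GM_simps(1))
  have c: "h i \<in> carrier R" "l i \<in> carrier R" "k i \<in> carrier M" for i
    using h k l by (simp_all add: Rgr.rep_seqs_closed Mgr.rep_seqs_closed)
  show "f \<otimes>\<^bsub>GA\<^esub> g \<odot>\<^bsub>GM\<^esub> x = f \<odot>\<^bsub>GM\<^esub> (g \<odot>\<^bsub>GM\<^esub> x)"
    using h k l by (simp add: GA_mult_cls GM_smult_cls conv_mem act_mem act_conv)
  have "act (\<lambda>n. h n \<oplus> l n) k = (\<lambda>n. act h k n \<oplus>\<^bsub>M\<^esub> act l k n)"
  proof
    fix n
    have "act (\<lambda>n. h n \<oplus> l n) k n = (\<Oplus>\<^bsub>M\<^esub>i\<in>{..n}. h i \<odot>\<^bsub>M\<^esub> k (n - i) \<oplus>\<^bsub>M\<^esub> l i \<odot>\<^bsub>M\<^esub> k (n - i))"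
      unfolding act_def using c by (intro M.finsum_cong') (auto simp: smult_l_distr)
    also have "\<dots> = act h k n \<oplus>\<^bsub>M\<^esub> act l k n"
      unfolding act_def using c by (intro M.finsum_addf) auto
    finally show "act (\<lambda>n. h n \<oplus> l n) k n = act h k n \<oplus>\<^bsub>M\<^esub> act l k n" .
  qed
  thus "(f \<oplus>\<^bsub>GA\<^esub> g) \<odot>\<^bsub>GM\<^esub> x = f \<odot>\<^bsub>GM\<^esub> x \<oplus>\<^bsub>GM\<^esub> g \<odot>\<^bsub>GM\<^esub> x"
    using h k l by (simp add: GA_simps(3) GM_simps(3) GM_smult_cls Rgr.cls_add Mgr.cls_add act_mem Rgr.rep_seqs_add)
next
  fix f x y assume "f \<in> carrier GA" "x \<in> carrier GM" "y \<in> carrier GM"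
  then obtain h l k where h: "h \<in> Rgr.rep_seqs" "f = Rgr.cls h" and l: "l \<in> Mgr.rep_seqs" "y = Mgr.cls l"
    and k: "k \<in> Mgr.rep_seqs" "x = Mgr.cls k"
    by (metis Rgr.seqs_cls Mgr.seqs_cls GA_simps(1) GM_simps(1))
  have c: "h i \<in> carrier R" "l i \<in> carrier M" "k i \<in> carrier M" for i
    using h k l by (simp_all add: Rgr.rep_seqs_closed Mgr.rep_seqs_closed)
  have "act h (\<lambda>n. k n \<oplus>\<^bsub>M\<^esub> l n) = (\<lambda>n. act h k n \<oplus>\<^bsub>M\<^esub> act h l n)"
  proof
    fix n
    have "act h (\<lambda>n. k n \<oplus>\<^bsub>M\<^esub> l n) n = (\<Oplus>\<^bsub>M\<^esub>i\<in>{..n}. h i \<odot>\<^bsub>M\<^esub> k (n - i) \<oplus>\<^bsub>M\<^esub> h i \<odot>\<^bsub>M\<^esub> l (n - i))"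
      unfolding act_def using c by (intro M.finsum_cong') (auto simp: smult_r_distr)
    also have "\<dots> = act h k n \<oplus>\<^bsub>M\<^esub> act h l n"
      unfolding act_def using c by (intro M.finsum_addf) auto
    finally show "act h (\<lambda>n. k n \<oplus>\<^bsub>M\<^esub> l n) n = act h k n \<oplus>\<^bsub>M\<^esub> act h l n" .
  qed
  thus "f \<odot>\<^bsub>GM\<^esub> (x \<oplus>\<^bsub>GM\<^esub> y) = f \<odot>\<^bsub>GM\<^esub> x \<oplus>\<^bsub>GM\<^esub> f \<odot>\<^bsub>GM\<^esub> y"
    using h k l by (simp add: GM_simps(3) GM_smult_cls Mgr.cls_add act_mem Mgr.rep_seqs_add)
next
  fix x assume "x \<in> carrier GM"
  then obtain k where k: "k \<in> Mgr.rep_seqs" "x = Mgr.cls k"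
    by (metis Mgr.seqs_cls GM_simps(1))
  have c: "k i \<in> carrier M" for i using k by (simp add: Mgr.rep_seqs_closed)
  have "act unit_seq k n = k n" for n
  proof -
    have "act unit_seq k n = (\<Oplus>\<^bsub>M\<^esub>i\<in>{..n}. if 0 = i then k (n - i) else \<zero>\<^bsub>M\<^esub>)"
      unfolding act_def using c by (intro M.finsum_cong') (auto simp: unit_seq_def Rgr.single_def)
    also have "\<dots> = k n" using c M.finsum_singleton[of 0 "{..n}" "\<lambda>i. k (n - i)"] by auto
    finally show ?thesis .
  qed
  hence "act unit_seq k = k" by (rule ext)
  thus "\<one>\<^bsub>GA\<^esub> \<odot>\<^bsub>GM\<^esub> x = x" using k unit_seq_mem by (simp add: GA_one GM_smult_cls)
qed

text \<open>The classes of $a \in I^p$ and of $m \in I^qM$ in degrees \<open>p\<close> and \<open>q\<close>.\<close>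

definition rcl :: "nat \<Rightarrow> 'a \<Rightarrow> nat \<Rightarrow> 'a set" where
  "rcl p a = Rgr.cls (Rgr.single p a)"

definition mcl :: "nat \<Rightarrow> 'c \<Rightarrow> nat \<Rightarrow> 'c set" where
  "mcl q m = Mgr.cls (Mgr.single q m)"

lemma rcl_closed: "a \<in> Ipow p \<Longrightarrow> rcl p a \<in> carrier GA"
  unfolding rcl_def GA_simps by (rule Rgr.cls_mem_seqs[OF Rgr.single_mem])

lemma rcl_eq_iff: "a \<in> Ipow p \<Longrightarrow> b \<in> Ipow p \<Longrightarrow> rcl p a = rcl p b \<longleftrightarrow> a \<ominus> b \<in> Ipow (Suc p)"
  unfolding rcl_def by (rule Rgr.cls_single_eq_iff)

lemma mcl_eq_iff: "a \<in> IM p \<Longrightarrow> b \<in> IM p \<Longrightarrow> mcl p a = mcl p b \<longleftrightarrow> a \<ominus>\<^bsub>M\<^esub> b \<in> IM (Suc p)"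
  unfolding mcl_def by (rule Mgr.cls_single_eq_iff)

lemma rcl_add: "a \<in> Ipow p \<Longrightarrow> b \<in> Ipow p \<Longrightarrow> rcl p a \<oplus>\<^bsub>GA\<^esub> rcl p b = rcl p (a \<oplus> b)"
  unfolding rcl_def GA_simps by (rule Rgr.cls_single_add)

lemma rcl_mult:
  assumes a: "a \<in> Ipow p" and b: "b \<in> Ipow q"
  shows "rcl p a \<otimes>\<^bsub>GA\<^esub> rcl q b = rcl (p + q) (a \<otimes> b)"
proof -
  have c: "a \<in> carrier R" "b \<in> carrier R" using a b by auto
  have "conv (Rgr.single p a) (Rgr.single q b) n = Rgr.single (p + q) (a \<otimes> b) n" for n
  proof -
    have "conv (Rgr.single p a) (Rgr.single q b) n =
        (\<Oplus>i\<in>{..n}. if p = i then (if n - p = q then a \<otimes> b else \<zero>) else \<zero>)"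
      unfolding conv_def using c by (intro R.finsum_cong') (auto simp: Rgr.single_def)
    also have "\<dots> = Rgr.single (p + q) (a \<otimes> b) n"
    proof (cases "p \<le> n")
      case True
      have "(\<Oplus>i\<in>{..n}. if p = i then (if n - p = q then a \<otimes> b else \<zero>) else \<zero>) = (if n - p = q then a \<otimes> b else \<zero>)"
        using R.finsum_singleton[of p "{..n}" "\<lambda>i. if n - p = q then a \<otimes> b else \<zero>"] True c by auto
      thus ?thesis using True by (auto simp: Rgr.single_def)
    next
      case False
      have "(\<Oplus>i\<in>{..n}. if p = i then (if n - p = q then a \<otimes> b else \<zero>) else \<zero>) = (\<Oplus>i\<in>{..n}. \<zero>)"
        using False c by (intro R.finsum_cong') auto
      thus ?thesis using False by (simp add: Rgr.single_def)
    qed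
    finally show ?thesis .
  qed
  hence "conv (Rgr.single p a) (Rgr.single q b) = Rgr.single (p + q) (a \<otimes> b)" by (rule ext)
  thus ?thesis unfolding rcl_def using GA_mult_cls[OF Rgr.single_mem[OF a] Rgr.single_mem[OF b]] by simp
qed

lemma mcl_smult:
  assumes a: "a \<in> Ipow p" and b: "b \<in> IM q"
  shows "rcl p a \<odot>\<^bsub>GM\<^esub> mcl q b = mcl (p + q) (a \<odot>\<^bsub>M\<^esub> b)"
proof -
  have c: "a \<in> carrier R" "b \<in> carrier M" using a b by auto
  have "act (Rgr.single p a) (Mgr.single q b) n = Mgr.single (p + q) (a \<odot>\<^bsub>M\<^esub> b) n" for n
  proof -
    have "act (Rgr.single p a) (Mgr.single q b) n =
        (\<Oplus>\<^bsub>M\<^esub>i\<in>{..n}. if p = i then (if n - p = q then a \<odot>\<^bsub>M\<^esub> b else \<zero>\<^bsub>M\<^esub>) else \<zero>\<^bsub>M\<^esub>)"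
      unfolding act_def using c by (intro M.finsum_cong') (auto simp: Rgr.single_def Mgr.single_def)
    also have "\<dots> = Mgr.single (p + q) (a \<odot>\<^bsub>M\<^esub> b) n"
    proof (cases "p \<le> n")
      case True
      have "(\<Oplus>\<^bsub>M\<^esub>i\<in>{..n}. if p = i then (if n - p = q then a \<odot>\<^bsub>M\<^esub> b else \<zero>\<^bsub>M\<^esub>) else \<zero>\<^bsub>M\<^esub>) =
          (if n - p = q then a \<odot>\<^bsub>M\<^esub> b else \<zero>\<^bsub>M\<^esub>)"
        using M.finsum_singleton[of p "{..n}" "\<lambda>i. if n - p = q then a \<odot>\<^bsub>M\<^esub> b else \<zero>\<^bsub>M\<^esub>"] True c by auto
      thus ?thesis using True by (auto simp: Mgr.single_def)
    next
      case False
      have "(\<Oplus>\<^bsub>M\<^esub>i\<in>{..n}. if p = i then (if n - p = q then a \<odot>\<^bsub>M\<^esub> b else \<zero>\<^bsub>M\<^esub>) else \<zero>\<^bsub>M\<^esub>) =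
          (\<Oplus>\<^bsub>M\<^esub>i\<in>{..n}. \<zero>\<^bsub>M\<^esub>)"
        using False c by (intro M.finsum_cong') auto
      thus ?thesis using False by (simp add: Mgr.single_def)
    qed
    finally show ?thesis .
  qed
  hence "act (Rgr.single p a) (Mgr.single q b) = Mgr.single (p + q) (a \<odot>\<^bsub>M\<^esub> b)" by (rule ext)
  thus ?thesis unfolding rcl_def mcl_def
    using GM_smult_cls[OF Rgr.single_mem[OF a] Mgr.single_mem[OF b]] by simp
qed

lemma rcl_pow:
  assumes a: "a \<in> Ipow p"
  shows "rcl p a [^]\<^bsub>GA\<^esub> (k::nat) = rcl (k * p) (a [^] k)"
proof (induction k)
  case 0
  show ?case by (simp add: GA_one unit_seq_def rcl_def)
next
  case (Suc k)
  thus ?case using rcl_mult[OF Ipow_power[OF a, of k] a] by (simp add: add.commute)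
qed

lemma GA_component:
  "gr_component GA d = (if d < 0 then {\<zero>\<^bsub>GA\<^esub>} else {rcl (nat d) a | a. a \<in> Ipow (nat d)})"
  unfolding rcl_def by (rule Rgr.gr_component_iff) (simp_all only: GA_simps)

lemma GM_component:
  "gr_component GM d = (if d < 0 then {\<zero>\<^bsub>GM\<^esub>} else {mcl (nat d) a | a. a \<in> IM (nat d)})"
  unfolding mcl_def by (rule Mgr.gr_component_iff) (simp_all only: GM_simps)

lemma rcl_zero: "a \<in> Ipow (Suc p) \<Longrightarrow> rcl p a = \<zero>\<^bsub>GA\<^esub>"
proof -
  assume a: "a \<in> Ipow (Suc p)"
  have "a \<in> Ipow p" using a Ipow_antimono[of p "Suc p"] by auto
  moreover have "a \<ominus> \<zero> \<in> Ipow (Suc p)" using a Rgr.minus_zero_eq[of a] by simp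
  ultimately have "rcl p a = rcl p \<zero>" by (subst rcl_eq_iff) auto
  also have "\<dots> = \<zero>\<^bsub>GA\<^esub>" using Rgr.cls_zero by (simp add: rcl_def Rgr.single_def GA_simps)
  finally show ?thesis .
qed

end


section \<open>Powers of finitely generated ideals\<close>

lemma (in cring) ideal_colon_ideal:
  assumes Q: "ideal Q R" and d: "d \<in> carrier R"
  shows "ideal {c \<in> carrier R. c \<otimes> d \<in> Q} R"
proof -
  interpret Q: ideal Q R by fact
  show ?thesis using d Q.I_l_closed by (intro ideal_of_closed) (auto simp: l_distr m_assoc)
qed

text \<open>A power of an ideal is generated by words in the generators. The induction removes one letter
  \<open>s\<close> by passing from \<open>Q\<close> to $Q : s$.\<close>

lemma (in cring) genideal_pow_subset:
  assumes S: "S \<subseteq> carrier R"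
  shows "ideal Q R \<Longrightarrow> (\<And>w. length w = p \<Longrightarrow> set w \<subseteq> S \<Longrightarrow> foldr (\<otimes>) w \<one> \<in> Q) \<Longrightarrow>
    ideal_pow R (Idl S) p \<subseteq> Q"
proof (induction p arbitrary: Q)
  case 0
  from 0(2)[of "[]"] have "Q = carrier R" using ideal.one_imp_carrier[OF 0(1)] by simp
  thus ?case by (simp add: ideal_pow_0)
next
  case (Suc p)
  interpret Q: ideal Q R by fact
  have words: "foldr (\<otimes>) w \<one> \<in> carrier R" if "set w \<subseteq> S" for w
    using that S by (induction w) auto
  have K: "ideal_pow R (Idl S) p \<subseteq> {c \<in> carrier R. c \<otimes> s \<in> Q}" if s: "s \<in> S" for s
  proof (rule Suc.IH[OF ideal_colon_ideal[OF Suc.prems(1)]])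
    show "s \<in> carrier R" using s S by blast
    fix w assume w: "length w = p" "set w \<subseteq> S"
    have "s \<otimes> foldr (\<otimes>) w \<one> \<in> Q" using Suc.prems(2)[of "s # w"] w s by simp
    thus "foldr (\<otimes>) w \<one> \<in> {c \<in> carrier R. c \<otimes> s \<in> Q}"
      using words[OF w(2)] s S by (auto simp: m_comm)
  qed
  have prod: "c \<otimes> d \<in> Q" if c: "c \<in> ideal_pow R (Idl S) p" and d: "d \<in> Idl S" for c d
  proof (cases "S = {}")
    case False
    hence cc: "c \<in> carrier R" using K c by blast
    have "Idl S \<subseteq> {e \<in> carrier R. e \<otimes> c \<in> Q}"
    proof (rule genideal_minimal[OF ideal_colon_ideal[OF Suc.prems(1) cc]])
      show "S \<subseteq> {e \<in> carrier R. e \<otimes> c \<in> Q}"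
      proof
        fix s assume s: "s \<in> S"
        hence sc: "s \<in> carrier R" using S by blast
        have "c \<otimes> s \<in> Q" using K[OF s] c by blast
        thus "s \<in> {e \<in> carrier R. e \<otimes> c \<in> Q}" using m_comm[OF cc sc] sc by simp
      qed
    qed
    hence dc: "d \<in> carrier R" "d \<otimes> c \<in> Q" using d by blast+
    thus ?thesis using m_comm[OF cc dc(1)] by simp
  next
    case True
    have "ideal_pow R (Idl S) p \<subseteq> carrier R"
      by (rule Suc.IH[OF oneideal]) (use words in auto)
    moreover have "Idl S \<subseteq> {\<zero>}" using True by (intro genideal_minimal zeroideal) simp
    ultimately have "c \<in> carrier R" "d = \<zero>" using c d by blast+
    thus ?thesis by simp
  qed
  show ?case
  proof
    fix e assume "e \<in> ideal_pow R (Idl S) (Suc p)"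
    hence "e \<in> ideal_prod R (ideal_pow R (Idl S) p) (Idl S)" by (simp only: ideal_pow_Suc)
    thus "e \<in> Q" by (induction rule: ideal_prod.induct) (auto intro: prod)
  qed
qed

lemma (in cring) product_of_word:
  assumes "x \<in> carrier R" "set w \<subseteq> carrier R"
  shows "foldr (\<otimes>) w \<one> = x [^] count_list w x \<otimes> foldr (\<otimes>) (filter (\<lambda>y. y \<noteq> x) w) \<one>"
  using assms(2)
proof (induction w)
  case (Cons y w)
  have c: "foldr (\<otimes>) v \<one> \<in> carrier R" if "set v \<subseteq> carrier R" for v
    using that by (induction v) auto
  have f: "foldr (\<otimes>) (filter (\<lambda>y. y \<noteq> x) w) \<one> \<in> carrier R" using Cons.prems by (intro c) auto
  have y: "y \<in> carrier R" using Cons.prems by simp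
  show ?case
  proof (cases "y = x")
    case True
    thus ?thesis using Cons y f assms(1)
      by (simp add: m_assoc[symmetric] m_comm[of x "x [^] count_list w x"])
  next
    case False
    thus ?thesis using Cons y f assms(1) by (simp add: m_lcomm)
  qed
qed simp

text \<open>By the pigeonhole principle a long word in the generators contains a high power of one of them.\<close>

lemma (in cring) genideal_pow_subset_of_nilpotent:
  assumes S: "S \<subseteq> carrier R" "finite S" and Q: "ideal Q R"
    and pow: "\<And>x. x \<in> S \<Longrightarrow> \<exists>k::nat. x [^] k \<in> Q"
  shows "\<exists>N. ideal_pow R (Idl S) N \<subseteq> Q"
proof -
  interpret Q: ideal Q R by fact
  from pow obtain k :: "'a \<Rightarrow> nat" where k: "\<And>x. x \<in> S \<Longrightarrow> x [^] k x \<in> Q" by metis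
  define T where "T = (\<Sum>x\<in>S. k x)"
  have kT: "k x \<le> T" if "x \<in> S" for x unfolding T_def by (rule member_le_sum[OF that _ S(2)]) simp
  have "ideal_pow R (Idl S) (Suc (card S * T)) \<subseteq> Q"
  proof (rule genideal_pow_subset[OF S(1) Q])
    fix w assume w: "length w = Suc (card S * T)" "set w \<subseteq> S"
    have "\<exists>x\<in>S. count_list w x > T"
    proof (rule ccontr)
      assume "\<not> ?thesis"
      hence "(\<Sum>x\<in>S. count_list w x) \<le> (\<Sum>x\<in>S. T)" by (intro sum_mono) (auto simp: not_less)
      thus False using sum_count_set[OF w(2) S(2)] w(1) by simp
    qed
    then obtain x where x: "x \<in> S" "count_list w x > T" by blast
    have xc: "x \<in> carrier R" using x S by blast
    have "x [^] count_list w x = x [^] (count_list w x - k x) \<otimes> x [^] k x"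
      using xc kT[OF x(1)] x(2) by (simp add: nat_pow_mult)
    hence "x [^] count_list w x \<in> Q" using Q.I_l_closed[OF k[OF x(1)], of "x [^] (count_list w x - k x)"] xc by simp
    moreover have "foldr (\<otimes>) v \<one> \<in> carrier R" if "set v \<subseteq> S" for v
      using that S(1) by (induction v) auto
    moreover have "set (filter (\<lambda>y. y \<noteq> x) w) \<subseteq> S" "set w \<subseteq> carrier R" using w(2) S(1) by auto
    ultimately show "foldr (\<otimes>) w \<one> \<in> Q"
      unfolding product_of_word[OF xc \<open>set w \<subseteq> carrier R\<close>] by (intro Q.I_r_closed)
  qed
  thus ?thesis by blast
qed

section \<open>The first cohomology of the Cech complex\<close>

lemma (in module) smult_pow_add:
  "x \<in> carrier R \<Longrightarrow> m \<in> carrier M \<Longrightarrow> (x [^] (a + b :: nat)) \<odot>\<^bsub>M\<^esub> m = (x [^] a) \<odot>\<^bsub>M\<^esub> ((x [^] b) \<odot>\<^bsub>M\<^esub> m)"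
  by (simp add: R.nat_pow_mult[symmetric] smult_assoc1)

lemma (in module) fraction_mem_iff:
  "(m', k') \<in> fraction R M x m k \<longleftrightarrow>
     m' \<in> carrier M \<and> (\<exists>l. (x [^] (l + k')) \<odot>\<^bsub>M\<^esub> m = (x [^] (l + k)) \<odot>\<^bsub>M\<^esub> m')"
  by (simp add: fraction_def)

lemma (in module) fraction_self: "m \<in> carrier M \<Longrightarrow> (m, k) \<in> fraction R M x m k"
  by (auto simp: fraction_mem_iff)

lemma (in module) fraction_subset:
  assumes x: "x \<in> carrier R" and m: "m \<in> carrier M" and m': "m' \<in> carrier M"
    and eq: "(x [^] (l + k')) \<odot>\<^bsub>M\<^esub> m = (x [^] (l + k)) \<odot>\<^bsub>M\<^esub> m'"
  shows "fraction R M x m' k' \<subseteq> fraction R M x m k"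
proof clarify
  fix m'' k'' assume "(m'', k'') \<in> fraction R M x m' k'"
  then obtain l' where m'': "m'' \<in> carrier M"
    and eq': "(x [^] (l' + k'')) \<odot>\<^bsub>M\<^esub> m' = (x [^] (l' + k')) \<odot>\<^bsub>M\<^esub> m''" by (auto simp: fraction_mem_iff)
  have "(x [^] ((l + l' + k') + k'')) \<odot>\<^bsub>M\<^esub> m = (x [^] (l' + k'')) \<odot>\<^bsub>M\<^esub> ((x [^] (l + k')) \<odot>\<^bsub>M\<^esub> m)"
    using x m by (simp add: smult_pow_add[symmetric] algebra_simps)
  also have "\<dots> = (x [^] (l + k)) \<odot>\<^bsub>M\<^esub> ((x [^] (l' + k'')) \<odot>\<^bsub>M\<^esub> m')"
    unfolding eq using x m' by (simp add: smult_pow_add[symmetric] add.commute)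
  also have "\<dots> = (x [^] ((l + l' + k') + k)) \<odot>\<^bsub>M\<^esub> m''"
    unfolding eq' using x m'' by (simp add: smult_pow_add[symmetric] algebra_simps)
  finally show "(m'', k'') \<in> fraction R M x m k" using m'' unfolding fraction_mem_iff by blast
qed

lemma (in module) fraction_eq_iff:
  assumes x: "x \<in> carrier R" and m: "m \<in> carrier M" and m': "m' \<in> carrier M"
  shows "fraction R M x m k = fraction R M x m' k' \<longleftrightarrow>
    (\<exists>l. (x [^] (l + k')) \<odot>\<^bsub>M\<^esub> m = (x [^] (l + k)) \<odot>\<^bsub>M\<^esub> m')"
proof
  assume "fraction R M x m k = fraction R M x m' k'"
  hence "(m', k') \<in> fraction R M x m k" using fraction_self[OF m'] by simp
  thus "\<exists>l. (x [^] (l + k')) \<odot>\<^bsub>M\<^esub> m = (x [^] (l + k)) \<odot>\<^bsub>M\<^esub> m'" by (simp add: fraction_mem_iff)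
next
  assume "\<exists>l. (x [^] (l + k')) \<odot>\<^bsub>M\<^esub> m = (x [^] (l + k)) \<odot>\<^bsub>M\<^esub> m'"
  then obtain l where l: "(x [^] (l + k')) \<odot>\<^bsub>M\<^esub> m = (x [^] (l + k)) \<odot>\<^bsub>M\<^esub> m'" by blast
  show "fraction R M x m k = fraction R M x m' k'"
    using fraction_subset[OF x m m' l] fraction_subset[OF x m' m l[symmetric]] by blast
qed

lemma UN_constant_on:
  assumes "p \<in> U" "\<And>m k. (m, k) \<in> U \<Longrightarrow> f m k = c"
  shows "(\<Union>(m, k)\<in>U. f m k) = c"
proof -
  have "(case u of (m, k) \<Rightarrow> f m k) = c" if "u \<in> U" for u using that assms(2) by (cases u) simp
  thus ?thesis using assms(1) by blast
qed

lemma (in module) localization_add: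
  assumes x: "x \<in> carrier R" and m: "m \<in> carrier M" and m': "m' \<in> carrier M"
  shows "fraction R M x m k \<oplus>\<^bsub>localization R M x\<^esub> fraction R M x m' k' =
    fraction R M x ((x [^] k') \<odot>\<^bsub>M\<^esub> m \<oplus>\<^bsub>M\<^esub> (x [^] k) \<odot>\<^bsub>M\<^esub> m') (k + k')" (is "_ = ?c")
proof -
  have eq: "fraction R M x ((x [^] k1') \<odot>\<^bsub>M\<^esub> m1 \<oplus>\<^bsub>M\<^esub> (x [^] k1) \<odot>\<^bsub>M\<^esub> m1') (k1 + k1') = ?c"
    if "(m1, k1) \<in> fraction R M x m k" "(m1', k1') \<in> fraction R M x m' k'" for m1 k1 m1' k1'
  proof -
    from that obtain l l' where c: "m1 \<in> carrier M" "m1' \<in> carrier M"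
      and l: "(x [^] (l + k1)) \<odot>\<^bsub>M\<^esub> m = (x [^] (l + k)) \<odot>\<^bsub>M\<^esub> m1"
      and l': "(x [^] (l' + k1')) \<odot>\<^bsub>M\<^esub> m' = (x [^] (l' + k')) \<odot>\<^bsub>M\<^esub> m1'"
      by (auto simp: fraction_mem_iff)
    note xs = x m m' c
    have e1: "(x [^] ((l + l') + (k1 + k1'))) \<odot>\<^bsub>M\<^esub> ((x [^] k') \<odot>\<^bsub>M\<^esub> m) =
        (x [^] ((l + l') + (k + k'))) \<odot>\<^bsub>M\<^esub> ((x [^] k1') \<odot>\<^bsub>M\<^esub> m1)"
    proof -
      have "(x [^] ((l + l') + (k1 + k1'))) \<odot>\<^bsub>M\<^esub> ((x [^] k') \<odot>\<^bsub>M\<^esub> m) =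
          (x [^] (l' + k1' + k')) \<odot>\<^bsub>M\<^esub> ((x [^] (l + k1)) \<odot>\<^bsub>M\<^esub> m)"
        using xs by (simp add: smult_pow_add[symmetric] algebra_simps)
      also have "\<dots> = (x [^] ((l + l') + (k + k'))) \<odot>\<^bsub>M\<^esub> ((x [^] k1') \<odot>\<^bsub>M\<^esub> m1)"
        unfolding l using xs by (simp add: smult_pow_add[symmetric] algebra_simps)
      finally show ?thesis .
    qed
    have e2: "(x [^] ((l + l') + (k1 + k1'))) \<odot>\<^bsub>M\<^esub> ((x [^] k) \<odot>\<^bsub>M\<^esub> m') =
        (x [^] ((l + l') + (k + k'))) \<odot>\<^bsub>M\<^esub> ((x [^] k1) \<odot>\<^bsub>M\<^esub> m1')"
    proof -
      have "(x [^] ((l + l') + (k1 + k1'))) \<odot>\<^bsub>M\<^esub> ((x [^] k) \<odot>\<^bsub>M\<^esub> m') =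
          (x [^] (l + k1 + k)) \<odot>\<^bsub>M\<^esub> ((x [^] (l' + k1')) \<odot>\<^bsub>M\<^esub> m')"
        using xs by (simp add: smult_pow_add[symmetric] algebra_simps)
      also have "\<dots> = (x [^] ((l + l') + (k + k'))) \<odot>\<^bsub>M\<^esub> ((x [^] k1) \<odot>\<^bsub>M\<^esub> m1')"
        unfolding l' using xs by (simp add: smult_pow_add[symmetric] algebra_simps)
      finally show ?thesis .
    qed
    show ?thesis
    proof (subst fraction_eq_iff[OF x], goal_cases)
      case 3
      show ?case
        by (rule exI[of _ "l + l'"]) (use xs e1 e2 in \<open>simp add: smult_r_distr\<close>)
    qed (use xs in simp_all)
  qed
  have "(\<Union>(m1', k1')\<in>fraction R M x m' k'. fraction R M x
      ((x [^] k1') \<odot>\<^bsub>M\<^esub> m1 \<oplus>\<^bsub>M\<^esub> (x [^] k1) \<odot>\<^bsub>M\<^esub> m1') (k1 + k1')) = ?c"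
    if "(m1, k1) \<in> fraction R M x m k" for m1 k1
    by (rule UN_constant_on[OF fraction_self[OF m', of k' x] eq[OF that]])
  hence "(\<Union>(m1, k1)\<in>fraction R M x m k. \<Union>(m1', k1')\<in>fraction R M x m' k'. fraction R M x
      ((x [^] k1') \<odot>\<^bsub>M\<^esub> m1 \<oplus>\<^bsub>M\<^esub> (x [^] k1) \<odot>\<^bsub>M\<^esub> m1') (k1 + k1')) = ?c"
    by (rule UN_constant_on[OF fraction_self[OF m, of k x]])
  thus ?thesis by (simp add: localization_def)
qed

lemma (in module) localization_carrier:
  "u \<in> carrier (localization R M x) \<longleftrightarrow> (\<exists>m k. m \<in> carrier M \<and> u = fraction R M x m k)"
  by (auto simp: localization_def)

lemma (in module) localization_zero: "\<zero>\<^bsub>localization R M x\<^esub> = fraction R M x \<zero>\<^bsub>M\<^esub> 0"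
  by (simp add: localization_def)

lemma (in module) localization_abelian_group:
  assumes x: "x \<in> carrier R"
  shows "abelian_group (localization R M x)" (is "abelian_group ?L")
proof (rule abelian_groupI)
  fix u v assume "u \<in> carrier ?L" "v \<in> carrier ?L"
  then obtain m k m' k' where m: "m \<in> carrier M" "u = fraction R M x m k"
    and m': "m' \<in> carrier M" "v = fraction R M x m' k'" by (auto simp: localization_carrier)
  show "u \<oplus>\<^bsub>?L\<^esub> v \<in> carrier ?L"
    unfolding m(2) m'(2) localization_add[OF x m(1) m'(1)] localization_carrier
    using x m m' by (intro exI conjI) auto
  show "u \<oplus>\<^bsub>?L\<^esub> v = v \<oplus>\<^bsub>?L\<^esub> u"
    unfolding m(2) m'(2) localization_add[OF x m(1) m'(1)] localization_add[OF x m'(1) m(1)]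
    using x m(1) m'(1) by (simp add: M.a_comm add.commute)
  fix w assume "w \<in> carrier ?L"
  then obtain m'' k'' where m'': "m'' \<in> carrier M" "w = fraction R M x m'' k''" by (auto simp: localization_carrier)
  have c: "(x [^] k') \<odot>\<^bsub>M\<^esub> m \<oplus>\<^bsub>M\<^esub> (x [^] k) \<odot>\<^bsub>M\<^esub> m' \<in> carrier M"
    "(x [^] k'') \<odot>\<^bsub>M\<^esub> m' \<oplus>\<^bsub>M\<^esub> (x [^] k') \<odot>\<^bsub>M\<^esub> m'' \<in> carrier M"
    using x m m' m'' by simp_all
  show "u \<oplus>\<^bsub>?L\<^esub> v \<oplus>\<^bsub>?L\<^esub> w = u \<oplus>\<^bsub>?L\<^esub> (v \<oplus>\<^bsub>?L\<^esub> w)"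
    unfolding m(2) m'(2) m''(2) localization_add[OF x m(1) m'(1)] localization_add[OF x m'(1) m''(1)]
      localization_add[OF x c(1) m''(1)] localization_add[OF x m(1) c(2)]
    using x m(1) m'(1) m''(1)
    by (simp add: smult_r_distr smult_pow_add[symmetric] M.a_assoc add.commute add.left_commute add.assoc)
next
  show "\<zero>\<^bsub>?L\<^esub> \<in> carrier ?L" unfolding localization_zero localization_carrier by blast
next
  fix u assume "u \<in> carrier ?L"
  then obtain m k where m: "m \<in> carrier M" "u = fraction R M x m k" by (auto simp: localization_carrier)
  show "\<zero>\<^bsub>?L\<^esub> \<oplus>\<^bsub>?L\<^esub> u = u"
    unfolding m(2) localization_zero localization_add[OF x M.zero_closed m(1)] using x m(1) by simp
  have mi: "\<ominus>\<^bsub>M\<^esub> m \<in> carrier M" using m(1) by simp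
  have "fraction R M x (\<ominus>\<^bsub>M\<^esub> m) k \<oplus>\<^bsub>?L\<^esub> u = \<zero>\<^bsub>?L\<^esub>"
    unfolding m(2) localization_zero localization_add[OF x mi m(1)]
    by (subst fraction_eq_iff[OF x]) (use x m(1) in \<open>auto simp: smult_r_minus M.l_neg\<close>)
  thus "\<exists>y\<in>carrier ?L. y \<oplus>\<^bsub>?L\<^esub> u = \<zero>\<^bsub>?L\<^esub>" using mi localization_carrier by blast
qed

lemma (in module) localization_map_fraction:
  assumes x: "x \<in> carrier R" and y: "y \<in> carrier R" and m: "m \<in> carrier M"
  shows "localization_map R M x y (fraction R M x m k) = fraction R M (x \<otimes> y) ((y [^] k) \<odot>\<^bsub>M\<^esub> m) k"
proof -
  have "fraction R M (x \<otimes> y) ((y [^] k1) \<odot>\<^bsub>M\<^esub> m1) k1 = fraction R M (x \<otimes> y) ((y [^] k) \<odot>\<^bsub>M\<^esub> m) k"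
    if "(m1, k1) \<in> fraction R M x m k" for m1 k1
  proof -
    from that obtain l where c: "m1 \<in> carrier M"
      and l: "(x [^] (l + k1)) \<odot>\<^bsub>M\<^esub> m = (x [^] (l + k)) \<odot>\<^bsub>M\<^esub> m1" by (auto simp: fraction_mem_iff)
    have pw: "((x \<otimes> y) [^] (e::nat)) \<odot>\<^bsub>M\<^esub> ((y [^] d) \<odot>\<^bsub>M\<^esub> z) = (y [^] (e + d)) \<odot>\<^bsub>M\<^esub> ((x [^] e) \<odot>\<^bsub>M\<^esub> z)"
      if z: "z \<in> carrier M" for e d :: nat and z
    proof -
      have "((x \<otimes> y) [^] e) \<otimes> (y [^] d) = (y [^] (e + d)) \<otimes> (x [^] e)"
        using x y by (simp add: R.nat_pow_distrib R.nat_pow_mult[symmetric] R.m_ac)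
      thus ?thesis using x y z by (simp add: smult_assoc1[symmetric])
    qed
    show ?thesis
    proof (subst fraction_eq_iff, goal_cases)
      case 4
      show ?case
        by (rule exI[of _ l]) (use c m l in \<open>simp add: pw add.assoc add.commute[of k k1]\<close>)
    qed (use x y c m in simp_all)
  qed
  hence "(\<Union>(m, k)\<in>fraction R M x m k. fraction R M (x \<otimes> y) ((y [^] k) \<odot>\<^bsub>M\<^esub> m) k) =
      fraction R M (x \<otimes> y) ((y [^] k) \<odot>\<^bsub>M\<^esub> m) k"
    by (rule UN_constant_on[OF fraction_self[OF m, of k x]])
  thus ?thesis by (simp add: localization_map_def)
qed

lemma (in abelian_monoid) finsum_one:
  "f i \<in> carrier G \<Longrightarrow> (\<Oplus>t\<in>{i}. f t) = f i"
  by simp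

lemma (in abelian_monoid) finsum_two:
  "i \<noteq> j \<Longrightarrow> f i \<in> carrier G \<Longrightarrow> f j \<in> carrier G \<Longrightarrow> (\<Oplus>t\<in>{i, j}. f t) = f i \<oplus> f j"
  by simp

lemma card_2_ordered:
  assumes "card (T :: nat set) = 2"
  obtains i j where "T = {i, j}" "i < j"
proof -
  from assms obtain i j where "T = {i, j}" "i \<noteq> j" by (auto simp: card_2_iff)
  thus ?thesis using that[of i j] that[of j i] by (cases "i < j") (auto simp: insert_commute)
qed

text \<open>What vanishing of the first Cech cohomology means for fractions $\nu_i/x_i^s$ that agree on
  overlaps already at the level of numerators: they come from one element of the module.\<close>

lemma (in module) cech_cohomology_1_vanishes:
  fixes xs :: "('a \<times> int) list" and Ng :: "int \<Rightarrow> 'c set" and \<nu> :: "nat \<Rightarrow> 'c"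
  defines "g \<equiv> \<lambda>i. fst (xs ! i)"
  assumes g: "\<And>i. i < length xs \<Longrightarrow> g i \<in> carrier R"
    and Ng: "\<And>d. Ng d \<subseteq> carrier M" "\<And>d. \<zero>\<^bsub>M\<^esub> \<in> Ng d"
    and vanish: "carrier (cech_cohomology R M Ng xs 1 n) = {\<one>\<^bsub>cech_cohomology R M Ng xs 1 n\<^esub>}"
    and \<nu>: "\<And>i. i < length xs \<Longrightarrow> \<nu> i \<in> Ng (n + int s * snd (xs ! i))"
    and agree: "\<And>i j. i < length xs \<Longrightarrow> j < length xs \<Longrightarrow>
      (g j [^] s) \<odot>\<^bsub>M\<^esub> \<nu> i = (g i [^] s) \<odot>\<^bsub>M\<^esub> \<nu> j"
  shows "\<exists>w\<in>Ng n. \<forall>i<length xs. \<exists>l. (g i [^] l) \<odot>\<^bsub>M\<^esub> \<nu> i = (g i [^] (l + s)) \<odot>\<^bsub>M\<^esub> w"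
proof -
  let ?C = "cech_cochains R M Ng xs 1 n" and ?D = "cech_cochains R M Ng xs 0 n"
  let ?B = "cech_coboundaries R M Ng xs 1 n"
  have \<nu>c: "\<nu> i \<in> carrier M" if "i < length xs" for i using \<nu>[OF that] Ng by blast
  have gf: "fst (xs ! i) = g i" for i by (simp add: g_def)
  have elt0: "cech_elt R xs {} = \<one>" by (simp add: cech_elt_def)
  have elt1: "cech_elt R xs {i} = g i" if "i < length xs" for i
    using g[OF that] by (simp add: cech_elt_def g_def)
  have elt2: "cech_elt R xs {i, j} = g i \<otimes> g j" if "i < length xs" "j < length xs" "i \<noteq> j" for i j
    using g[OF that(1)] g[OF that(2)] that(3) by (simp add: cech_elt_def g_def)
  have deg0: "cech_deg xs {} = 0" and deg1: "cech_deg xs {i} = snd (xs ! i)" for i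
    by (simp_all add: cech_deg_def)
  have faces0: "cech_faces xs 0 = {{}}" by (auto simp: cech_faces_def finite_subset)
  have faces1: "cech_faces xs 1 = {{i} | i. i < length xs}"
    by (auto simp: cech_faces_def card_1_singleton_iff)
  define c where "c = (\<lambda>S\<in>cech_faces xs 1. fraction R M (cech_elt R xs S) (\<nu> (the_elem S)) s)"
  have c1: "c {i} = fraction R M (g i) (\<nu> i) s" if "i < length xs" for i
    using that faces1 by (simp add: c_def elt1)
  have c_cochain: "c \<in> carrier ?C"
  proof -
    have "c S \<in> localization_component R M Ng (cech_elt R xs S) (cech_deg xs S) n"
      if "S \<in> cech_faces xs 1" for S
    proof -
      from that obtain i where i: "S = {i}" "i < length xs" unfolding faces1 by blast
      show ?thesis unfolding localization_component_def i(1)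
        using c1[OF i(2)] elt1[OF i(2)] \<nu>[OF i(2)] deg1[of i] by auto
    qed
    thus ?thesis by (auto simp: cech_cochains_def c_def)
  qed
  have "cech_differential R M xs 1 c = \<one>\<^bsub>cech_cochains R M Ng xs (1 + 1) n\<^esub>"
  proof
    fix T
    show "cech_differential R M xs 1 c T = \<one>\<^bsub>cech_cochains R M Ng xs (1 + 1) n\<^esub> T"
    proof (cases "T \<in> cech_faces xs (1 + 1)")
      case True
      hence cardT: "card T = 2" and Tsub: "T \<subseteq> {..<length xs}" by (auto simp: cech_faces_def)
      obtain i j where T: "T = {i, j}" and ij: "i < j" by (rule card_2_ordered[OF cardT])
      have i: "i < length xs" and j: "j < length xs" using T Tsub by auto
      let ?L = "localization R M (cech_elt R xs T)"
      note gi = g[OF i] and gj = g[OF j]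
      have eltT: "cech_elt R xs T = g i \<otimes> g j" using elt2[OF i j] ij T by simp
      have L: "abelian_group ?L"
        by (rule localization_abelian_group) (use eltT gi gj in simp)
      have Lm: "abelian_monoid ?L" using L by (simp add: abelian_group_def)
      define v where "v = fraction R M (g i \<otimes> g j) ((g j [^] s) \<odot>\<^bsub>M\<^esub> \<nu> i) s"
      have v: "v \<in> carrier ?L" unfolding localization_carrier v_def eltT using gi gj \<nu>c[OF i] by blast
      have Ti: "T - {i} = {j}" and Tj: "T - {j} = {i}" using T ij by auto
      have vi: "localization_map R M (cech_elt R xs (T - {i})) (fst (xs ! i)) (c (T - {i})) = v"
        unfolding Ti c1[OF j] elt1[OF j] gf
        using localization_map_fraction[OF gj gi \<nu>c[OF j], of s] agree[OF i j] R.m_comm[OF gj gi]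
        by (simp add: v_def)
      have vj: "localization_map R M (cech_elt R xs (T - {j})) (fst (xs ! j)) (c (T - {j})) = v"
        unfolding Tj c1[OF i] elt1[OF i] gf
        using localization_map_fraction[OF gi gj \<nu>c[OF i], of s] by (simp add: v_def)
      have below: "{s \<in> T. s < i} = {}" "{s \<in> T. s < j} = {i}" using T ij by auto
      have ci: "even (card {s \<in> T. s < i})" and cj: "odd (card {s \<in> T. s < j})"
        unfolding below by simp_all
      have mv: "\<ominus>\<^bsub>?L\<^esub> v \<in> carrier ?L" by (rule abelian_group.a_inv_closed[OF L v])
      let ?f = "\<lambda>t. let v = localization_map R M (cech_elt R xs (T - {t})) (fst (xs ! t)) (c (T - {t}))
        in if even (card {s \<in> T. s < t}) then v else \<ominus>\<^bsub>?L\<^esub> v"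
      have fi: "?f i = v" and fj: "?f j = \<ominus>\<^bsub>?L\<^esub> v" using vi vj ci cj by (simp_all add: Let_def)
      have "cech_differential R M xs 1 c T = (\<Oplus>\<^bsub>?L\<^esub>t\<in>T. ?f t)"
        unfolding cech_differential_def by (rule restrict_apply'[OF True])
      also have "\<dots> = (\<Oplus>\<^bsub>?L\<^esub>t\<in>{i, j}. ?f t)" by (rule arg_cong[OF T, of "finsum ?L ?f"])
      also have "\<dots> = ?f i \<oplus>\<^bsub>?L\<^esub> ?f j"
        by (rule abelian_monoid.finsum_two[OF Lm]) (use ij v mv fi fj in simp_all)
      also have "\<dots> = \<zero>\<^bsub>?L\<^esub>" unfolding fi fj by (rule abelian_group.r_neg[OF L v])
      finally show ?thesis using True by (simp add: cech_cochains_def)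
    next
      case False
      thus ?thesis by (simp add: cech_differential_def cech_cochains_def)
    qed
  qed
  hence c_cocycle: "c \<in> cech_cocycles R M Ng xs 1 n"
    using c_cochain by (simp add: cech_cocycles_def)
  have d0: "cech_differential R M xs 0 (\<lambda>S\<in>cech_faces xs 0. fraction R M \<one> w k) {i} =
      fraction R M (g i) ((g i [^] k) \<odot>\<^bsub>M\<^esub> w) k"
    if i: "i < length xs" and w: "w \<in> carrier M" for i w k
  proof -
    let ?L = "localization R M (g i)"
    have Lm: "abelian_monoid ?L"
      using localization_abelian_group[OF g[OF i]] by (simp add: abelian_group_def)
    have v: "fraction R M (g i) ((g i [^] k) \<odot>\<^bsub>M\<^esub> w) k \<in> carrier ?L"
      unfolding localization_carrier using g[OF i] w by blast
    have m: "localization_map R M (cech_elt R xs ({i} - {i})) (fst (xs ! i)) (fraction R M \<one> w k) =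
        fraction R M (g i) ((g i [^] k) \<odot>\<^bsub>M\<^esub> w) k"
      using localization_map_fraction[OF R.one_closed g[OF i] w, of k] g[OF i]
      by (simp add: elt0 gf)
    have T: "{i} \<in> cech_faces xs (0 + 1)" using i faces1 by auto
    let ?c = "\<lambda>S\<in>cech_faces xs 0. fraction R M \<one> w k"
    let ?f = "\<lambda>t. let v = localization_map R M (cech_elt R xs ({i} - {t})) (fst (xs ! t)) (?c ({i} - {t}))
        in if even (card {s \<in> {i}. s < t}) then v else \<ominus>\<^bsub>localization R M (cech_elt R xs {i})\<^esub> v"
    have none: "{s \<in> {i}. s < i} = {}" by auto
    have f: "?f i = fraction R M (g i) ((g i [^] k) \<odot>\<^bsub>M\<^esub> w) k"
      unfolding Let_def none using m by (simp add: faces0)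
    have "cech_differential R M xs 0 ?c {i} = (\<Oplus>\<^bsub>localization R M (cech_elt R xs {i})\<^esub>t\<in>{i}. ?f t)"
      unfolding cech_differential_def by (rule restrict_apply'[OF T])
    also have "\<dots> = ?f i"
      by (rule abelian_monoid.finsum_one) (use Lm v f elt1[OF i] in simp_all)
    finally show ?thesis unfolding f .
  qed
  have B: "?B = cech_differential R M xs 0 ` carrier ?D"
    by (simp add: cech_coboundaries_def)
  have zero_cob: "\<one>\<^bsub>?C\<^esub> \<in> ?B"
  proof -
    let ?z = "\<lambda>S\<in>cech_faces xs 0. fraction R M \<one> \<zero>\<^bsub>M\<^esub> 0"
    have "?z \<in> carrier ?D"
      using Ng(2)[of n] by (auto simp: cech_cochains_def faces0 localization_component_def elt0 deg0)
    moreover have "cech_differential R M xs 0 ?z = \<one>\<^bsub>?C\<^esub>"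
    proof
      fix T show "cech_differential R M xs 0 ?z T = \<one>\<^bsub>?C\<^esub> T"
      proof (cases "T \<in> cech_faces xs 1")
        case True
        then obtain i where i: "T = {i}" "i < length xs" unfolding faces1 by blast
        show ?thesis using d0[OF i(2) M.zero_closed, of 0] True elt1[OF i(2)] g[OF i(2)] i(1)
          by (simp add: cech_cochains_def localization_zero)
      next
        case False
        thus ?thesis by (simp add: cech_differential_def cech_cochains_def)
      qed
    qed
    ultimately show ?thesis unfolding B by (metis imageI)
  qed
  have "\<one>\<^bsub>?C\<^esub> \<otimes>\<^bsub>?C\<^esub> c = c"
  proof
    fix S show "(\<one>\<^bsub>?C\<^esub> \<otimes>\<^bsub>?C\<^esub> c) S = c S"
    proof (cases "S \<in> cech_faces xs 1")
      case True
      then obtain i where i: "S = {i}" "i < length xs" unfolding faces1 by blast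
      have Lm: "abelian_monoid (localization R M (g i))"
        using localization_abelian_group[OF g[OF i(2)]] by (simp add: abelian_group_def)
      have "c S \<in> carrier (localization R M (g i))"
        unfolding i(1) c1[OF i(2)] localization_carrier using \<nu>c[OF i(2)] by blast
      thus ?thesis using True abelian_monoid.l_zero[OF Lm] elt1[OF i(2)] i(1) by (simp add: cech_cochains_def)
    next
      case False
      thus ?thesis by (simp add: cech_cochains_def c_def)
    qed
  qed
  hence "c \<in> ?B #>\<^bsub>?C\<lparr>carrier := cech_cocycles R M Ng xs 1 n\<rparr>\<^esub> c"
    using zero_cob by (force simp: r_coset_def)
  moreover have "?B #>\<^bsub>?C\<lparr>carrier := cech_cocycles R M Ng xs 1 n\<rparr>\<^esub> c = ?B"
    using vanish c_cocycle unfolding cech_cohomology_def FactGroup_def RCOSETS_def by auto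
  ultimately have "c \<in> ?B" by simp
  then obtain c0 where c0: "c0 \<in> carrier ?D" and d: "c = cech_differential R M xs 0 c0"
    unfolding B by blast
  from c0 have c0P: "c0 \<in> (\<Pi>\<^sub>E S\<in>{{}}. localization_component R M Ng (cech_elt R xs S) (cech_deg xs S) n)"
    by (simp add: cech_cochains_def faces0)
  hence "c0 {} \<in> localization_component R M Ng (cech_elt R xs {}) (cech_deg xs {}) n" by (rule PiE_mem) simp
  then obtain w k where w: "w \<in> Ng n" and wk: "c0 {} = fraction R M \<one> w k"
    by (auto simp: localization_component_def elt0 deg0)
  have wc: "w \<in> carrier M" using w Ng by blast
  have c0_eq: "c0 = (\<lambda>S\<in>cech_faces xs 0. fraction R M \<one> w k)"
  proof
    fix S show "c0 S = (\<lambda>S\<in>cech_faces xs 0. fraction R M \<one> w k) S"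
      using wk PiE_arb[OF c0P, of S] by (cases "S = {}") (simp_all add: faces0)
  qed
  have "\<exists>l. (g i [^] l) \<odot>\<^bsub>M\<^esub> \<nu> i = (g i [^] (l + s)) \<odot>\<^bsub>M\<^esub> w" if i: "i < length xs" for i
  proof -
    have "fraction R M (g i) (\<nu> i) s = fraction R M (g i) ((g i [^] k) \<odot>\<^bsub>M\<^esub> w) k"
      using c1[OF i] d0[OF i wc, of k] unfolding d c0_eq by simp
    then obtain l where l: "(g i [^] (l + k)) \<odot>\<^bsub>M\<^esub> \<nu> i = (g i [^] (l + s)) \<odot>\<^bsub>M\<^esub> ((g i [^] k) \<odot>\<^bsub>M\<^esub> w)"
      using fraction_eq_iff[OF g[OF i] \<nu>c[OF i]] g[OF i] wc by auto
    have "(g i [^] (l + s)) \<odot>\<^bsub>M\<^esub> ((g i [^] k) \<odot>\<^bsub>M\<^esub> w) = (g i [^] ((l + k) + s)) \<odot>\<^bsub>M\<^esub> w"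
      using g[OF i] wc by (simp add: smult_pow_add[symmetric] ac_simps)
    thus ?thesis using l by metis
  qed
  thus ?thesis using w by blast
qed


section \<open>Ratliff-Rush submodules and the first local cohomology\<close>

context adic_module
begin

abbreviation "Gplus \<equiv> gr_irrelevant R I"

lemma cls_mem_Gplus_iff: "h \<in> Rgr.rep_seqs \<Longrightarrow> Rgr.cls h \<in> Gplus \<longleftrightarrow> h 0 \<in> Ipow 1"
  unfolding gr_irrelevant_def GA_simps
  using Rgr.cls_mem_seqs[of h] Rgr.coset_F_eq_zero_iff[of "h 0" 1] Rgr.rep_seqs_closed[of h 0]
  by (simp add: Rgr.cls_def)

lemma Gplus_subset: "Gplus \<subseteq> carrier GA"
  by (auto simp: gr_irrelevant_def)

lemma Gplus_ideal: "ideal Gplus GA"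
proof (rule cring.ideal_of_closed[OF GA_cring Gplus_subset])
  have rep: "\<exists>h\<in>Rgr.rep_seqs. f = Rgr.cls h" if "f \<in> carrier GA" for f
    using that Rgr.seqs_cls GA_simps(1) by metis
  show "\<zero>\<^bsub>GA\<^esub> \<in> Gplus"
    using cls_mem_Gplus_iff[OF Rgr.rep_seqs_zero] by (simp add: GA_simps Rgr.cls_zero)
  fix f assume f: "f \<in> Gplus"
  then obtain h where h: "h \<in> Rgr.rep_seqs" "f = Rgr.cls h" using rep Gplus_subset by blast
  have h0: "h 0 \<in> Ipow 1" using f h cls_mem_Gplus_iff by blast
  {
    fix g assume g: "g \<in> Gplus"
    then obtain k where k: "k \<in> Rgr.rep_seqs" "g = Rgr.cls k" using rep Gplus_subset by blast
    have k0: "k 0 \<in> Ipow 1" using g k cls_mem_Gplus_iff by blast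
    have "Rgr.cls (\<lambda>n. h n \<oplus> k n) \<in> Gplus"
      using cls_mem_Gplus_iff[OF Rgr.rep_seqs_add[OF h(1) k(1)]] Ipow_add_mem[OF h0 k0] by simp
    thus "f \<oplus>\<^bsub>GA\<^esub> g \<in> Gplus" using Rgr.cls_add[OF h(1) k(1)] h k by (simp add: GA_simps)
  next
    fix g assume g: "g \<in> carrier GA"
    then obtain k where k: "k \<in> Rgr.rep_seqs" "g = Rgr.cls k" using rep by blast
    have "k 0 \<otimes> h 0 \<in> Ipow 1"
      using Ipow_mult[OF Rgr.rep_seqs_mem[OF k(1), of 0] h0] by simp
    hence "conv k h 0 \<in> Ipow 1"
      using Rgr.rep_seqs_closed[OF h(1), of 0] Rgr.rep_seqs_closed[OF k(1), of 0] by (simp add: conv_def)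
    hence "Rgr.cls (conv k h) \<in> Gplus" using cls_mem_Gplus_iff[OF conv_mem[OF k(1) h(1)]] by simp
    thus "g \<otimes>\<^bsub>GA\<^esub> f \<in> Gplus" using GA_mult_cls[OF k(1) h(1)] h k by simp
  }
qed

lemma rcl_mem_Gplus: "a \<in> Ipow (Suc p) \<Longrightarrow> rcl (Suc p) a \<in> Gplus"
  unfolding rcl_def using cls_mem_Gplus_iff[OF Rgr.single_mem] by (simp add: Rgr.single_def)

text \<open>Local cohomology is computed on an arbitrary choice of homogeneous generators, so there must be
  one: the classes in degree 1 of generators of \<open>I\<close>.\<close>

lemma homogeneous_generators_exist:
  assumes "noetherian_ring R"
  shows "\<exists>xs. homogeneous_generators GA (gr_component GA) Gplus xs"
proof -
  interpret G: cring GA by (rule GA_cring)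
  obtain S where S: "S \<subseteq> carrier R" "finite S" and I: "I = Idl S"
    using noetherian_ring.finetely_gen[OF assms ideal_I] by blast
  obtain bs where bs: "set bs = S" using finite_list[OF S(2)] by blast
  define xs where "xs = map (\<lambda>b. (rcl 1 b, 1::int)) bs"
  define Y where "Y = rcl 1 ` S"
  have "S \<subseteq> I" using R.genideal_self[OF S(1)] I by simp
  hence SI: "S \<subseteq> Ipow 1" by (simp add: Ipow_1)
  have Yc: "Y \<subseteq> carrier GA" using SI rcl_closed by (auto simp: Y_def)
  have Y: "fst ` set xs = Y" by (auto simp: xs_def Y_def bs image_image)
  let ?K = "genideal GA Y"
  interpret K: ideal ?K GA by (rule G.genideal_ideal[OF Yc])
  have rcl1: "rcl 1 a \<in> ?K" if a: "a \<in> I" for a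
  proof -
    have "ideal {a \<in> Ipow 1. rcl 1 a \<in> ?K} R"
    proof (rule R.ideal_of_closed)
      show "{a \<in> Ipow 1. rcl 1 a \<in> ?K} \<subseteq> carrier R" by auto
      show "\<zero> \<in> {a \<in> Ipow 1. rcl 1 a \<in> ?K}" using rcl_zero[of \<zero> 1] by simp
    next
      fix a b assume "a \<in> {a \<in> Ipow 1. rcl 1 a \<in> ?K}" "b \<in> {a \<in> Ipow 1. rcl 1 a \<in> ?K}"
      thus "a \<oplus> b \<in> {a \<in> Ipow 1. rcl 1 a \<in> ?K}"
        using rcl_add[of a 1 b] K.a_closed[of "rcl 1 a" "rcl 1 b"] Ipow_add_mem[of a 1 b] by simp
    next
      fix a r assume a: "a \<in> {a \<in> Ipow 1. rcl 1 a \<in> ?K}" and r: "r \<in> carrier R"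
      have r0: "r \<in> Ipow 0" using r by (simp add: Ipow_0)
      have "rcl 0 r \<otimes>\<^bsub>GA\<^esub> rcl 1 a \<in> ?K" using a by (intro K.I_l_closed rcl_closed[OF r0]) simp
      thus "r \<otimes> a \<in> {a \<in> Ipow 1. rcl 1 a \<in> ?K}"
        using rcl_mult[OF r0, of a 1] Ipow_mult[OF r0, of a 1] a by simp
    qed
    moreover have "S \<subseteq> {a \<in> Ipow 1. rcl 1 a \<in> ?K}"
      using SI G.genideal_self[OF Yc] by (auto simp: Y_def)
    ultimately have "I \<subseteq> {a \<in> Ipow 1. rcl 1 a \<in> ?K}" unfolding I by (rule R.genideal_minimal)
    thus ?thesis using a by blast
  qed
  have comp: "rcl (Suc q) c \<in> ?K" if "c \<in> Ipow (Suc 0 + q)" for c q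
    using that
  proof (induction rule: Ipow_add_induct)
    case (prod a b)
    have "rcl 1 a \<otimes>\<^bsub>GA\<^esub> rcl q b \<in> ?K"
      using rcl1[of a] prod(1) by (intro K.I_r_closed rcl_closed[OF prod(2)]) (simp add: Ipow_1)
    thus ?case using rcl_mult[OF prod] by simp
  next
    case (sum a b)
    thus ?case using rcl_add[of a "Suc q" b] K.a_closed[OF sum(3,4)] by simp
  qed
  have "Gplus \<subseteq> ?K"
  proof
    fix f assume f: "f \<in> Gplus"
    then obtain h where h: "h \<in> Rgr.rep_seqs" "f = Rgr.cls h"
      using Rgr.seqs_cls GA_simps(1) Gplus_subset by (metis subsetD)
    have h0: "h 0 \<in> Ipow 1" using f h cls_mem_Gplus_iff by blast
    have "Rgr.cls h \<in> ?K"
    proof (rule Rgr.cls_mem_additive[OF h(1)])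
      show "(\<lambda>n. Ipow (n + 1)) \<in> ?K" using K.zero_closed by (simp add: GA_simps)
      show "(\<lambda>n. f n <+>\<^bsub>R\<^esub> g n) \<in> ?K" if "f \<in> ?K" "g \<in> ?K" for f g
        using K.a_closed[OF that] by (simp add: GA_simps)
      show "Rgr.cls (Rgr.single p (h p)) \<in> ?K" for p
      proof (cases p)
        case 0
        thus ?thesis using rcl_zero[of "h 0" 0] h0 K.zero_closed by (simp add: rcl_def)
      next
        case (Suc q)
        thus ?thesis using comp[of "h p" q] Rgr.rep_seqs_mem[OF h(1), of p] by (simp add: rcl_def)
      qed
    qed
    thus "f \<in> ?K" using h by simp
  qed
  moreover have "?K \<subseteq> Gplus"
  proof (rule G.genideal_minimal[OF Gplus_ideal])
    show "Y \<subseteq> Gplus" using SI rcl_mem_Gplus[of _ 0] by (auto simp: Y_def)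
  qed
  ultimately have "Gplus = genideal GA (fst ` set xs)" unfolding Y by blast
  moreover have "rcl 1 b \<in> gr_component GA 1" if "b \<in> S" for b
    using that SI by (auto simp: GA_component)
  ultimately have "homogeneous_generators GA (gr_component GA) Gplus xs"
    by (auto simp: homogeneous_generators_def xs_def bs)
  thus ?thesis by blast
qed

lemma rcl_mem_Gplus_pow: "c \<in> Ipow p \<Longrightarrow> rcl p c \<in> ideal_pow GA Gplus p"
proof (induction p arbitrary: c)
  case 0
  thus ?case using rcl_closed by (simp add: ideal_pow_0)
next
  case (Suc p)
  have "c \<in> Ipow (p + Suc 0)" using Suc.prems by simp
  thus ?case
  proof (induction rule: Ipow_add_induct)
    case (prod a b)
    have "rcl p a \<otimes>\<^bsub>GA\<^esub> rcl (Suc 0) b \<in> ideal_prod GA (ideal_pow GA Gplus p) Gplus"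
      by (rule ideal_prod.prod[OF Suc.IH[OF prod(1)] rcl_mem_Gplus[OF prod(2)]])
    thus ?case using rcl_mult[OF prod] by (simp add: ideal_pow_Suc)
  next
    case (sum a b)
    have "rcl (Suc p) a \<oplus>\<^bsub>GA\<^esub> rcl (Suc p) b \<in> ideal_prod GA (ideal_pow GA Gplus p) Gplus"
      using sum(3,4) by (intro ideal_prod.sum) (simp_all add: ideal_pow_Suc)
    thus ?case using rcl_add[of a "Suc p" b] sum(1,2) by (simp add: ideal_pow_Suc)
  qed
qed

text \<open>Let \<open>u\<close> satisfy $I^q u \subseteq I^{q+n}M$ for $q \ge s$. Multiplication by \<open>u\<close> then induces a
  map from the part of $G_I(A)$ in degrees at least \<open>s\<close> to $G_I(M)$. The elements of $I^p$ in
  \<open>push_deeper s n u p\<close> represent the degree \<open>p\<close> part of the annihilator of that map. The bound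
  \<open>s\<close> is needed: below it, multiplication by \<open>u\<close> is not defined on classes.\<close>

definition push_deeper :: "nat \<Rightarrow> nat \<Rightarrow> 'c \<Rightarrow> nat \<Rightarrow> 'a set" where
  "push_deeper s n u p =
     {a \<in> carrier R. \<forall>q\<ge>s. \<forall>c\<in>Ipow q. a \<odot>\<^bsub>M\<^esub> (c \<odot>\<^bsub>M\<^esub> u) \<in> IM (Suc (p + q + n))}"

definition annihilator_ideal :: "nat \<Rightarrow> nat \<Rightarrow> 'c \<Rightarrow> (nat \<Rightarrow> 'a set) set" where
  "annihilator_ideal s n u = {Rgr.cls h | h. h \<in> Rgr.rep_seqs \<and> (\<forall>p. h p \<in> push_deeper s n u p)}"

lemma push_deeper_ideal:
  assumes u: "u \<in> carrier M"
  shows "ideal (push_deeper s n u p) R"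
proof (rule R.ideal_of_closed)
  show "push_deeper s n u p \<subseteq> carrier R" by (auto simp: push_deeper_def)
  have cu: "c \<odot>\<^bsub>M\<^esub> u \<in> carrier M" if "c \<in> Ipow q" for c q using that u by simp
  show "\<zero> \<in> push_deeper s n u p" using cu by (simp add: push_deeper_def)
  show "a \<oplus> b \<in> push_deeper s n u p" if "a \<in> push_deeper s n u p" "b \<in> push_deeper s n u p" for a b
    using that cu by (simp add: push_deeper_def smult_l_distr IM_add_mem)
  show "r \<otimes> a \<in> push_deeper s n u p" if "a \<in> push_deeper s n u p" "r \<in> carrier R" for a r
    using that cu submoduleE(4)[OF IM_submodule] by (simp add: push_deeper_def smult_assoc1)
qed

lemma push_deeper_mult:
  assumes u: "u \<in> carrier M" and k: "k \<in> Ipow i" and a: "a \<in> push_deeper s n u p"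
  shows "k \<otimes> a \<in> push_deeper s n u (i + p)"
proof -
  have kc: "k \<in> carrier R" and ac: "a \<in> carrier R" using k a by (auto simp: push_deeper_def)
  have "(k \<otimes> a) \<odot>\<^bsub>M\<^esub> (c \<odot>\<^bsub>M\<^esub> u) \<in> IM (Suc (i + p + q + n))" if c: "q \<ge> s" "c \<in> Ipow q" for q c
  proof -
    have "a \<odot>\<^bsub>M\<^esub> (c \<odot>\<^bsub>M\<^esub> u) \<in> IM (Suc (p + q + n))" using a c by (simp add: push_deeper_def)
    from IM_smult[OF k this] show ?thesis
      using kc ac c(2) u by (simp add: smult_assoc1 add.assoc)
  qed
  thus ?thesis using kc ac by (simp add: push_deeper_def)
qed

lemma Ipow_Suc_push_deeper:
  assumes u: "u \<in> carrier M" and push: "\<And>q c. q \<ge> s \<Longrightarrow> c \<in> Ipow q \<Longrightarrow> c \<odot>\<^bsub>M\<^esub> u \<in> IM (q + n)"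
  shows "Ipow (Suc p) \<subseteq> push_deeper s n u p"
proof
  fix a assume a: "a \<in> Ipow (Suc p)"
  have "a \<odot>\<^bsub>M\<^esub> (c \<odot>\<^bsub>M\<^esub> u) \<in> IM (Suc (p + q + n))" if "q \<ge> s" "c \<in> Ipow q" for q c
    using IM_smult[OF a push[OF that]] by (simp add: add.assoc)
  thus "a \<in> push_deeper s n u p" using a by (simp add: push_deeper_def)
qed

lemma annihilator_ideal_ideal:
  assumes u: "u \<in> carrier M"
  shows "ideal (annihilator_ideal s n u) GA"
proof (rule cring.ideal_of_closed[OF GA_cring])
  have D: "additive_subgroup (push_deeper s n u p) R" for p
    by (rule ideal.axioms(1)[OF push_deeper_ideal[OF u]])
  show "annihilator_ideal s n u \<subseteq> carrier GA"
    using Rgr.cls_mem_seqs by (auto simp: annihilator_ideal_def GA_simps)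
  have "Rgr.cls (\<lambda>n. \<zero>) \<in> annihilator_ideal s n u"
    using Rgr.rep_seqs_zero additive_subgroup.zero_closed[OF D] by (auto simp: annihilator_ideal_def)
  thus "\<zero>\<^bsub>GA\<^esub> \<in> annihilator_ideal s n u" by (simp add: GA_simps Rgr.cls_zero)
  fix f assume "f \<in> annihilator_ideal s n u"
  then obtain h where h: "h \<in> Rgr.rep_seqs" "f = Rgr.cls h" and hD: "\<And>p. h p \<in> push_deeper s n u p"
    by (auto simp: annihilator_ideal_def)
  {
    fix g assume "g \<in> annihilator_ideal s n u"
    then obtain k where k: "k \<in> Rgr.rep_seqs" "g = Rgr.cls k" and kD: "\<And>p. k p \<in> push_deeper s n u p"
      by (auto simp: annihilator_ideal_def)
    have "Rgr.cls (\<lambda>p. h p \<oplus> k p) \<in> annihilator_ideal s n u"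
      unfolding annihilator_ideal_def
      using Rgr.rep_seqs_add[OF h(1) k(1)] additive_subgroup.a_closed[OF D hD kD] by blast
    thus "f \<oplus>\<^bsub>GA\<^esub> g \<in> annihilator_ideal s n u"
      using Rgr.cls_add[OF h(1) k(1)] h k by (simp add: GA_simps)
  next
    fix g assume "g \<in> carrier GA"
    then obtain k where k: "k \<in> Rgr.rep_seqs" "g = Rgr.cls k"
      using Rgr.seqs_cls GA_simps(1) by metis
    have "conv k h p \<in> push_deeper s n u p" for p
      unfolding conv_def
    proof (rule additive_subgroup.finsum_mem[OF D R.abelian_group_axioms])
      fix i assume "i \<in> {..p}"
      thus "k i \<otimes> h (p - i) \<in> push_deeper s n u p"
        using push_deeper_mult[OF u Rgr.rep_seqs_mem[OF k(1), of i] hD[of "p - i"]] by simp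
    qed
    hence "Rgr.cls (conv k h) \<in> annihilator_ideal s n u"
      unfolding annihilator_ideal_def using conv_mem[OF k(1) h(1)] by blast
    thus "g \<otimes>\<^bsub>GA\<^esub> f \<in> annihilator_ideal s n u" using GA_mult_cls[OF k(1) h(1)] h k by simp
  }
qed

text \<open>Membership in the annihilator does not depend on the representative \<open>a\<close>, because the elements
  of $I^{p+1}$ push \<open>u\<close> deeper in degree \<open>p\<close> anyway.\<close>

lemma rcl_mem_annihilator_iff:
  assumes u: "u \<in> carrier M" and push: "\<And>q c. q \<ge> s \<Longrightarrow> c \<in> Ipow q \<Longrightarrow> c \<odot>\<^bsub>M\<^esub> u \<in> IM (q + n)"
    and a: "a \<in> Ipow p"
  shows "rcl p a \<in> annihilator_ideal s n u \<longleftrightarrow> a \<in> push_deeper s n u p"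
proof
  have D: "additive_subgroup (push_deeper s n u p) R" for p
    by (rule ideal.axioms(1)[OF push_deeper_ideal[OF u]])
  {
    assume "a \<in> push_deeper s n u p"
    hence "Rgr.single p a k \<in> push_deeper s n u k" for k
      using additive_subgroup.zero_closed[OF D] by (simp add: Rgr.single_def)
    thus "rcl p a \<in> annihilator_ideal s n u"
      unfolding annihilator_ideal_def rcl_def using Rgr.single_mem[OF a] by blast
  next
    assume "rcl p a \<in> annihilator_ideal s n u"
    then obtain h where h: "h \<in> Rgr.rep_seqs" "rcl p a = Rgr.cls h" and hD: "h p \<in> push_deeper s n u p"
      unfolding annihilator_ideal_def by blast
    have ac: "a \<in> carrier R" using a by simp
    have hc: "h p \<in> carrier R" by (rule Rgr.rep_seqs_closed[OF h(1)])
    have "Rgr.single p a p \<ominus> h p \<in> Ipow (Suc p)"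
      using h(2) Rgr.cls_eq_iff[OF Rgr.single_mem[OF a] h(1)] by (simp add: rcl_def)
    moreover have "Ipow (Suc p) \<subseteq> push_deeper s n u p"
      by (rule Ipow_Suc_push_deeper[OF u]) (rule push)
    ultimately have "a \<ominus> h p \<in> push_deeper s n u p" by (auto simp: Rgr.single_def)
    from additive_subgroup.a_closed[OF D this hD] show "a \<in> push_deeper s n u p"
      using ac hc by (simp add: a_minus_def R.a_assoc R.l_neg)
  }
qed

text \<open>A list of homogeneous generators may contain zeros, and these may carry any degree.\<close>

lemma nonpositive_generator_zero:
  assumes "x \<in> gr_component GA d" "x \<in> Gplus" "d \<le> 0"
  shows "x = \<zero>\<^bsub>GA\<^esub>"
proof
  fix k
  show "x k = \<zero>\<^bsub>GA\<^esub> k"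
    using assms by (cases "k = 0") (auto simp: gr_component_def gr_irrelevant_def)
qed

lemma mcl_component: "m \<in> IM k \<Longrightarrow> mcl k m \<in> gr_component GM (int k)"
  by (auto simp: GM_component)

abbreviation H1 :: "int \<Rightarrow> (nat set \<Rightarrow> ((nat \<Rightarrow> 'c set) \<times> nat) set) set monoid" where
  "H1 \<equiv> local_cohomology GA (gr_component GA) GM (gr_component GM) Gplus 1"

text \<open>The element \<open>y\<close> yields the 1-cocycle $[a_i^s y]/x_i^s$. A 0-cochain that bounds it is given by
  some $v \in I^nM$, and the equality of fractions says that a power of $x_i$ annihilates the map
  induced by $u = y - v$. Hence a power of $G_+$ does.\<close>

lemma ratliff_rush_descent:
  assumes noeth: "noetherian_ring R" and n: "n > 0"
    and vanish: "carrier (H1 (int n)) = {\<one>\<^bsub>H1 (int n)\<^esub>}"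
    and y: "y \<in> ratliff_rush R M (Ipow n)"
  shows "\<exists>v\<in>IM n. y \<ominus>\<^bsub>M\<^esub> v \<in> ratliff_rush R M (Ipow (Suc n))"
proof -
  interpret G: cring GA by (rule GA_cring)
  interpret GMod: module GA GM by (rule GM_module)
  define xs where "xs = (SOME xs. homogeneous_generators GA (gr_component GA) Gplus xs)"
  have gens: "homogeneous_generators GA (gr_component GA) Gplus xs"
    unfolding xs_def by (rule someI_ex[OF homogeneous_generators_exist[OF noeth]])
  have vanish': "carrier (cech_cohomology GA GM (gr_component GM) xs 1 (int n)) =
      {\<one>\<^bsub>cech_cohomology GA GM (gr_component GM) xs 1 (int n)\<^esub>}"
    using vanish unfolding local_cohomology_def xs_def by simp
  define g d where "g i = fst (xs ! i)" and "d i = snd (xs ! i)" for i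
  have g_comp: "g i \<in> gr_component GA (d i)" if "i < length xs" for i
    using gens nth_mem[OF that] unfolding homogeneous_generators_def g_def d_def by (auto simp: split_def)
  have g_closed: "g i \<in> carrier GA" if "i < length xs" for i
    using g_comp[OF that] by (simp add: gr_component_def)
  have S: "fst ` set xs = g ` {..<length xs}"
    by (auto simp: g_def set_conv_nth image_iff)
  have Gplus_gen: "Gplus = genideal GA (g ` {..<length xs})"
    using gens unfolding homogeneous_generators_def S by blast
  have Sc: "g ` {..<length xs} \<subseteq> carrier GA" using g_closed by auto
  have g_Gplus: "g i \<in> Gplus" if "i < length xs" for i
    using G.genideal_self[OF Sc] that unfolding Gplus_gen by blast
  have g_zero: "g i = \<zero>\<^bsub>GA\<^esub>" if "i < length xs" "d i \<le> 0" for i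
    using nonpositive_generator_zero[OF g_comp[OF that(1)] g_Gplus[OF that(1)] that(2)] .
  have "\<exists>a\<in>Ipow (nat (d i)). g i = rcl (nat (d i)) a" if "i < length xs" "d i > 0" for i
    using g_comp[OF that(1)] that(2) by (auto simp: GA_component)
  then obtain a where a: "\<And>i. i < length xs \<Longrightarrow> d i > 0 \<Longrightarrow> a i \<in> Ipow (nat (d i))"
    and ga: "\<And>i. i < length xs \<Longrightarrow> d i > 0 \<Longrightarrow> g i = rcl (nat (d i)) (a i)" by metis
  from y n have yc: "y \<in> carrier M" and "\<exists>s. \<forall>p\<ge>s. \<forall>b\<in>Ipow p. b \<odot>\<^bsub>M\<^esub> y \<in> IM (p + n)"
    using ratliff_rush_iff[of n y] by auto
  then obtain s0 where s0: "\<And>p b. p \<ge> s0 \<Longrightarrow> b \<in> Ipow p \<Longrightarrow> b \<odot>\<^bsub>M\<^esub> y \<in> IM (p + n)" by blast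
  \<comment> \<open>The exponent must be positive, so that the power of a generator that is zero vanishes as well.\<close>
  define s where "s = Suc s0"
  define e where "e i = nat (d i)" for i
  have e: "e i > 0" "int (e i) = d i" if "d i > 0" for i using that by (auto simp: e_def)
  have as: "(a i [^] k) \<in> Ipow (k * e i)" if "i < length xs" "d i > 0" for i and k :: nat
    using Ipow_power[OF a[OF that]] by (simp add: e_def)
  have ac: "a i \<in> carrier R" if "i < length xs" "d i > 0" for i using a[OF that] by simp
  have gpow: "g i [^]\<^bsub>GA\<^esub> k = rcl (k * e i) (a i [^] k)" if "i < length xs" "d i > 0" for i and k :: nat
    using rcl_pow[OF a[OF that]] ga[OF that] by (simp add: e_def)
  have asy: "(a i [^] s) \<odot>\<^bsub>M\<^esub> y \<in> IM (s * e i + n)" if "i < length xs" "d i > 0" for i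
  proof (rule s0[OF _ as[OF that]])
    have "s * 1 \<le> s * e i" using e(1)[OF that(2)] by (intro mult_le_mono2) simp
    thus "s0 \<le> s * e i" by (simp add: s_def)
  qed
  define \<nu> where "\<nu> i = (if d i > 0 then mcl (s * e i + n) ((a i [^] s) \<odot>\<^bsub>M\<^esub> y) else \<zero>\<^bsub>GM\<^esub>)" for i
  have zero_pow: "\<zero>\<^bsub>GA\<^esub> [^]\<^bsub>GA\<^esub> s = \<zero>\<^bsub>GA\<^esub>" by (simp add: s_def)
  have comp_zero: "\<zero>\<^bsub>GM\<^esub> \<in> gr_component GM k" for k by (simp add: gr_component_def)
  have comp_sub: "gr_component GM k \<subseteq> carrier GM" for k by (auto simp: gr_component_def)
  have \<nu>_comp: "\<nu> i \<in> gr_component GM (int n + int s * d i)" if "i < length xs" for i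
  proof (cases "d i > 0")
    case True
    have "int n + int s * d i = int (s * e i + n)" using e(2)[OF True] by simp
    moreover have "\<nu> i = mcl (s * e i + n) ((a i [^] s) \<odot>\<^bsub>M\<^esub> y)" using True by (simp add: \<nu>_def)
    ultimately show ?thesis using mcl_component[OF asy[OF that True]] by (simp only:)
  next
    case False
    thus ?thesis using comp_zero by (simp add: \<nu>_def)
  qed
  have \<nu>_closed: "\<nu> i \<in> carrier GM" if "i < length xs" for i using \<nu>_comp[OF that] comp_sub by blast
  have agree: "(g j [^]\<^bsub>GA\<^esub> s) \<odot>\<^bsub>GM\<^esub> \<nu> i = (g i [^]\<^bsub>GA\<^esub> s) \<odot>\<^bsub>GM\<^esub> \<nu> j"
    if i: "i < length xs" and j: "j < length xs" for i j
  proof (cases "d i > 0 \<and> d j > 0")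
    case True
    hence di: "d i > 0" and dj: "d j > 0" by auto
    have "(a j [^] s) \<odot>\<^bsub>M\<^esub> ((a i [^] s) \<odot>\<^bsub>M\<^esub> y) = (a i [^] s) \<odot>\<^bsub>M\<^esub> ((a j [^] s) \<odot>\<^bsub>M\<^esub> y)"
      using ac[OF i di] ac[OF j dj] yc by (intro smult_commute) auto
    thus ?thesis
      using di dj mcl_smult[OF as[OF j dj] asy[OF i di]] mcl_smult[OF as[OF i di] asy[OF j dj]]
      by (simp add: gpow[OF i di] gpow[OF j dj] \<nu>_def add.left_commute)
  next
    case False
    have z: "(g k [^]\<^bsub>GA\<^esub> s) \<odot>\<^bsub>GM\<^esub> \<nu> l = \<zero>\<^bsub>GM\<^esub>"
      if "k < length xs" "l < length xs" "\<not> (d k > 0 \<and> d l > 0)" for k l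
    proof (cases "d l > 0")
      case True
      hence "g k = \<zero>\<^bsub>GA\<^esub>" using g_zero[of k] that by auto
      thus ?thesis using zero_pow \<nu>_closed[OF that(2)] by simp
    next
      case False
      thus ?thesis using g_closed[OF that(1)] by (simp add: \<nu>_def)
    qed
    show ?thesis using z[of j i] z[of i j] False i j by auto
  qed
  have "\<exists>w\<in>gr_component GM (int n). \<forall>i<length xs. \<exists>l.
      (fst (xs ! i) [^]\<^bsub>GA\<^esub> l) \<odot>\<^bsub>GM\<^esub> \<nu> i = (fst (xs ! i) [^]\<^bsub>GA\<^esub> (l + s)) \<odot>\<^bsub>GM\<^esub> w"
    by (rule GMod.cech_cohomology_1_vanishes[OF _ comp_sub comp_zero vanish'])
       (use g_closed \<nu>_comp agree in \<open>auto simp: g_def d_def\<close>)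
  then obtain w where w: "w \<in> gr_component GM (int n)"
    and wl: "\<And>i. i < length xs \<Longrightarrow> \<exists>l. (g i [^]\<^bsub>GA\<^esub> l) \<odot>\<^bsub>GM\<^esub> \<nu> i = (g i [^]\<^bsub>GA\<^esub> (l + s)) \<odot>\<^bsub>GM\<^esub> w"
    unfolding g_def by blast
  from w obtain v where v: "v \<in> IM n" and wv: "w = mcl n v" by (auto simp: GM_component)
  have vc: "v \<in> carrier M" using v by simp
  define u where "u = y \<ominus>\<^bsub>M\<^esub> v"
  have uc: "u \<in> carrier M" using yc vc by (simp add: u_def)
  have push: "c \<odot>\<^bsub>M\<^esub> u \<in> IM (q + n)" if "q \<ge> s0" "c \<in> Ipow q" for q c
    using submodule_minus_mem[OF IM_submodule s0[OF that] IM_smult[OF that(2) v]] that(2) yc vc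
    by (simp add: u_def smult_minus_distr)
  let ?Q = "annihilator_ideal s0 n u"
  have Q: "ideal ?Q GA" by (rule annihilator_ideal_ideal[OF uc])
  have ann: "rcl p b \<in> ?Q \<longleftrightarrow> b \<in> push_deeper s0 n u p" if "b \<in> Ipow p" for b p
    by (rule rcl_mem_annihilator_iff[OF uc _ that]) (rule push)
  have nilp: "\<exists>k::nat. x [^]\<^bsub>GA\<^esub> k \<in> ?Q" if x: "x \<in> g ` {..<length xs}" for x
  proof -
    from x obtain i where i: "i < length xs" and xi: "x = g i" by blast
    show ?thesis
    proof (cases "d i > 0")
      case False
      have "x [^]\<^bsub>GA\<^esub> (1::nat) \<in> ?Q"
        using g_zero[OF i] False additive_subgroup.zero_closed[OF ideal.axioms(1)[OF Q]] by (simp add: xi)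
      thus ?thesis by blast
    next
      case True
      obtain l where l: "(g i [^]\<^bsub>GA\<^esub> l) \<odot>\<^bsub>GM\<^esub> \<nu> i = (g i [^]\<^bsub>GA\<^esub> (l + s)) \<odot>\<^bsub>GM\<^esub> w"
        using wl[OF i] by blast
      let ?p = "(l + s) * e i"
      let ?b = "a i [^] (l + s)"
      have b: "?b \<in> Ipow ?p" by (rule as[OF i True])
      have bc: "?b \<in> carrier R" using ac[OF i True] by simp
      have asl: "(a i [^] l) \<odot>\<^bsub>M\<^esub> ((a i [^] s) \<odot>\<^bsub>M\<^esub> y) = ?b \<odot>\<^bsub>M\<^esub> y"
        using ac[OF i True] yc by (simp add: smult_pow_add)
      have deg: "l * e i + (s * e i + n) = ?p + n" by (simp add: algebra_simps)
      have "(g i [^]\<^bsub>GA\<^esub> l) \<odot>\<^bsub>GM\<^esub> \<nu> i = mcl (?p + n) (?b \<odot>\<^bsub>M\<^esub> y)"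
        using mcl_smult[OF as[OF i True] asy[OF i True], of l] True
        by (simp only: gpow[OF i True] \<nu>_def if_True asl deg)
      moreover have "(g i [^]\<^bsub>GA\<^esub> (l + s)) \<odot>\<^bsub>GM\<^esub> w = mcl (?p + n) (?b \<odot>\<^bsub>M\<^esub> v)"
        unfolding gpow[OF i True] wv by (rule mcl_smult[OF b v])
      ultimately have eq: "mcl (?p + n) (?b \<odot>\<^bsub>M\<^esub> y) = mcl (?p + n) (?b \<odot>\<^bsub>M\<^esub> v)" using l by simp
      have by1: "?b \<odot>\<^bsub>M\<^esub> y \<in> IM (?p + n)"
        using IM_smult[OF as[OF i True] asy[OF i True], of l] unfolding asl deg .
      have "?b \<odot>\<^bsub>M\<^esub> y \<ominus>\<^bsub>M\<^esub> ?b \<odot>\<^bsub>M\<^esub> v \<in> IM (Suc (?p + n))"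
        using eq mcl_eq_iff[OF by1 IM_smult[OF b v]] by simp
      hence bu: "?b \<odot>\<^bsub>M\<^esub> u \<in> IM (Suc (?p + n))" using smult_minus_distr[OF bc yc vc] by (simp add: u_def)
      have "?b \<odot>\<^bsub>M\<^esub> (c \<odot>\<^bsub>M\<^esub> u) \<in> IM (Suc (?p + q + n))" if c: "c \<in> Ipow q" for c q
      proof -
        have "?b \<odot>\<^bsub>M\<^esub> (c \<odot>\<^bsub>M\<^esub> u) = c \<odot>\<^bsub>M\<^esub> (?b \<odot>\<^bsub>M\<^esub> u)" using c bc uc by (intro smult_commute) auto
        moreover have "q + Suc (?p + n) = Suc (?p + q + n)" by simp
        ultimately show ?thesis using IM_smult[OF c bu] by metis
      qed
      hence "?b \<in> push_deeper s0 n u ?p" using bc by (simp add: push_deeper_def)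
      hence "rcl ?p ?b \<in> ?Q" using ann[OF b] by simp
      hence "x [^]\<^bsub>GA\<^esub> (l + s) \<in> ?Q" by (simp only: xi gpow[OF i True])
      thus ?thesis by blast
    qed
  qed
  have "\<exists>N. ideal_pow GA (genideal GA (g ` {..<length xs})) N \<subseteq> ?Q"
    by (rule G.genideal_pow_subset_of_nilpotent[OF Sc _ Q nilp]) simp_all
  then obtain N where N: "ideal_pow GA Gplus N \<subseteq> ?Q" unfolding Gplus_gen by blast
  have "c \<odot>\<^bsub>M\<^esub> u \<in> IM (p + Suc n)" if p: "p \<ge> N + s0" and c: "c \<in> Ipow p" for p c
  proof -
    obtain q where q: "p = N + q" "q \<ge> s0" using p by (metis add_le_imp_le_left le_Suc_ex le_add1 le_trans)
    from c have "c \<in> Ipow (N + q)" by (simp add: q)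
    thus ?thesis
    proof (induction rule: Ipow_add_induct)
      case (prod b b')
      have "rcl N b \<in> ?Q" using N rcl_mem_Gplus_pow[OF prod(1)] by blast
      hence "b \<in> push_deeper s0 n u N" using ann[OF prod(1)] by simp
      hence "b \<odot>\<^bsub>M\<^esub> (b' \<odot>\<^bsub>M\<^esub> u) \<in> IM (Suc (N + q + n))" using q(2) prod(2) by (simp add: push_deeper_def)
      thus ?case using prod uc q by (simp add: smult_assoc1)
    next
      case (sum b b')
      thus ?case using uc by (simp add: smult_l_distr IM_add_mem)
    qed
  qed
  hence "u \<in> ratliff_rush R M (Ipow (Suc n))"
    using ratliff_rush_iff[of "Suc n" u] uc by blast
  thus ?thesis using v unfolding u_def by blast
qed

text \<open>By repeated descent an element of the Ratliff-Rush submodule of $I^n$ is congruent modulo $I^nM$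
  to one of the Ratliff-Rush submodule of $I^p$, which for large \<open>p\<close> is $I^pM \subseteq I^nM$.\<close>

lemma ratliff_rush_eq_of_vanishing:
  assumes noeth: "noetherian_ring R" and acc: submodule_acc
    and x: "x \<in> I" and reg: "\<And>m. m \<in> carrier M \<Longrightarrow> x \<odot>\<^bsub>M\<^esub> m = \<zero>\<^bsub>M\<^esub> \<Longrightarrow> m = \<zero>\<^bsub>M\<^esub>"
    and n: "n > 0"
    and vanish: "\<And>k. k \<ge> n \<Longrightarrow> carrier (H1 (int k)) = {\<one>\<^bsub>H1 (int k)\<^esub>}"
  shows "ratliff_rush R M (Ipow n) = IM n"
proof
  show "IM n \<subseteq> ratliff_rush R M (Ipow n)" by (rule IM_subset_ratliff_rush)
  show "ratliff_rush R M (Ipow n) \<subseteq> IM n"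
  proof
    fix y assume y: "y \<in> ratliff_rush R M (Ipow n)"
    have yc: "y \<in> carrier M" by (rule ratliff_rush_closed[OF y])
    have step: "\<exists>v\<in>IM n. y \<ominus>\<^bsub>M\<^esub> v \<in> ratliff_rush R M (Ipow p)" if "n \<le> p" for p
      using that
    proof (induction p rule: dec_induct)
      case base
      show ?case using y Mgr.minus_zero_eq[OF yc] by (intro bexI[of _ "\<zero>\<^bsub>M\<^esub>"]) simp_all
    next
      case (step p)
      then obtain v where v: "v \<in> IM n" "y \<ominus>\<^bsub>M\<^esub> v \<in> ratliff_rush R M (Ipow p)" by blast
      obtain v' where v': "v' \<in> IM p" "(y \<ominus>\<^bsub>M\<^esub> v) \<ominus>\<^bsub>M\<^esub> v' \<in> ratliff_rush R M (Ipow (Suc p))"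
        using ratliff_rush_descent[OF noeth _ vanish v(2)] step n by auto
      have "v' \<in> IM n" using v'(1) IM_antimono[OF step(1)] by blast
      hence "v \<oplus>\<^bsub>M\<^esub> v' \<in> IM n" using v(1) by (rule IM_add_mem[rotated])
      moreover have "y \<ominus>\<^bsub>M\<^esub> (v \<oplus>\<^bsub>M\<^esub> v') = (y \<ominus>\<^bsub>M\<^esub> v) \<ominus>\<^bsub>M\<^esub> v'"
        using yc v(1) v'(1) by (simp add: a_minus_def M.minus_add M.a_assoc)
      ultimately show ?case using v'(2) by force
    qed
    obtain c where c: "\<And>p. p \<ge> c \<Longrightarrow> ratliff_rush R M (Ipow p) \<subseteq> IM p"
      using ratliff_rush_eventually[OF noeth acc x reg] by blast
    obtain v where v: "v \<in> IM n" "y \<ominus>\<^bsub>M\<^esub> v \<in> ratliff_rush R M (Ipow (max n c))"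
      using step[of "max n c"] by auto
    have "y \<ominus>\<^bsub>M\<^esub> v \<in> IM n" using v(2) c[of "max n c"] IM_antimono[of n "max n c"] by auto
    from IM_add_mem[OF this v(1)] show "y \<in> IM n"
      using yc v(1) by (simp add: a_minus_def M.a_assoc M.l_neg)
  qed
qed

end

lemma (in module) ideal_smult_zero: "ideal_smult R M {\<zero>} = {\<zero>\<^bsub>M\<^esub>}"
proof
  show "ideal_smult R M {\<zero>} \<subseteq> {\<zero>\<^bsub>M\<^esub>}" by (rule ideal_smult_least[OF zero_submodule]) simp
  show "{\<zero>\<^bsub>M\<^esub>} \<subseteq> ideal_smult R M {\<zero>}"
    using submodule_zero_mem[OF ideal_smult_submodule[of "{\<zero>}"]] by simp
qed

text \<open>The first member of a regular sequence is regular on $M/0M$, which is \<open>M\<close> up to passing to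
  singletons.\<close>

lemma (in module) regular_of_quotient_zero:
  assumes "regular_element R (quot_module R M {\<zero>\<^bsub>M\<^esub>}) x" and m: "m \<in> carrier M"
    and xm: "x \<odot>\<^bsub>M\<^esub> m = \<zero>\<^bsub>M\<^esub>"
  shows "m = \<zero>\<^bsub>M\<^esub>"
proof -
  have coset: "{\<zero>\<^bsub>M\<^esub>} +>\<^bsub>M\<^esub> y = {y}" if "y \<in> carrier M" for y
    using that by (simp add: a_r_coset_def r_coset_def)
  have "{m} \<in> carrier (quot_module R M {\<zero>\<^bsub>M\<^esub>})"
    using m coset[OF m] by (auto simp: quot_module_def A_RCOSETS_def')
  moreover have "x \<odot>\<^bsub>quot_module R M {\<zero>\<^bsub>M\<^esub>}\<^esub> {m} = \<zero>\<^bsub>quot_module R M {\<zero>\<^bsub>M\<^esub>}\<^esub>"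
    using xm coset[OF M.zero_closed] by (simp add: quot_module_def)
  ultimately have "{m} = \<zero>\<^bsub>quot_module R M {\<zero>\<^bsub>M\<^esub>}\<^esub>"
    using assms(1) by (simp add: regular_element_def)
  thus ?thesis by (simp add: quot_module_def)
qed

lemma (in module) positive_grade:
  assumes "grade R I M > 0" "ideal_smult R M I \<noteq> carrier M"
  shows "\<exists>x\<in>I. \<forall>m\<in>carrier M. x \<odot>\<^bsub>M\<^esub> m = \<zero>\<^bsub>M\<^esub> \<longrightarrow> m = \<zero>\<^bsub>M\<^esub>"
proof -
  have "0 < Sup {enat (length xs) | xs. set xs \<subseteq> I \<and> regular_sequence R M xs}"
    using assms by (simp add: grade_def)
  then obtain xs where xs: "set xs \<subseteq> I" "regular_sequence R M xs" and len: "0 < enat (length xs)"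
    unfolding less_Sup_iff by blast
  have len0: "0 < length xs" using len by (simp add: zero_enat_def)
  have "Idl {} = {\<zero>}"
    using R.genideal_minimal[OF R.zeroideal, of "{}"] additive_subgroup.zero_closed[OF ideal.axioms(1)[OF R.genideal_ideal[of "{}"]]]
    by auto
  hence "regular_element R (quot_module R M {\<zero>\<^bsub>M\<^esub>}) (xs ! 0)"
    using xs(2) len0 ideal_smult_zero unfolding regular_sequence_def by force
  moreover have "xs ! 0 \<in> I" using xs(1) len0 by auto
  ultimately show ?thesis using regular_of_quotient_zero by blast
qed

text \<open>$IM = M$ is the case of infinite grade; then $I^nM = M$ for all \<open>n\<close>.\<close>

lemma (in adic_module) ratliff_rush_trivial:
  assumes "ideal_smult R M I = carrier M"
  shows "ratliff_rush R M (Ipow n) = IM n"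
proof -
  have "carrier M \<subseteq> IM k" for k
  proof (induction k)
    case (Suc k)
    have "IM (Suc 0 + 0) \<subseteq> IM (Suc k)"
      by (rule IM_least[OF IM_submodule]) (use IM_smult[of _ "Suc 0" _ k] Suc in \<open>auto simp: IM_0\<close>)
    thus ?case using assms by (simp add: Ipow_1)
  qed (simp add: IM_0)
  thus ?thesis using ratliff_rush_closed IM_subset_ratliff_rush by blast
qed

text \<open>If $\rho > 0$ then the Ratliff-Rush submodule of $I^i$ differs from $I^iM$ for some
  $i \ge \rho - 1$, and so the first local cohomology does not vanish in some degree $k \ge i$.\<close>

lemma (in adic_module) rho_le:
  assumes noeth: "noetherian_ring R" and fg: "finitely_generated_module R M"
    and grade: "grade R I M > 0"
  shows "ereal (real (rho R I M)) \<le> max 0 (a_invariant 1 R I M + 1)"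
proof (cases "rho R I M")
  case 0
  thus ?thesis by (simp add: zero_ereal_def[symmetric])
next
  case (Suc d)
  have acc: submodule_acc by (rule finitely_generated_acc[OF noeth fg])
  have "\<not> (\<forall>i\<ge>d. ratliff_rush R M (Ipow i) = IM i)"
    by (rule not_less_Least) (use Suc in \<open>simp add: rho_def\<close>)
  then obtain i where i: "i \<ge> d" and ne: "ratliff_rush R M (Ipow i) \<noteq> IM i" by blast
  have "ratliff_rush R M (Ipow 0) = IM 0"
    using ratliff_rush_closed IM_subset_ratliff_rush[of 0] IM_0 by blast
  hence i0: "i > 0" using ne by (cases i) auto
  have "ideal_smult R M I \<noteq> carrier M" using ne ratliff_rush_trivial by blast
  then obtain x where x: "x \<in> I" and reg: "\<And>m. m \<in> carrier M \<Longrightarrow> x \<odot>\<^bsub>M\<^esub> m = \<zero>\<^bsub>M\<^esub> \<Longrightarrow> m = \<zero>\<^bsub>M\<^esub>"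
    using positive_grade[OF grade] by blast
  obtain k where k: "k \<ge> i" and nz: "carrier (H1 (int k)) \<noteq> {\<one>\<^bsub>H1 (int k)\<^esub>}"
    using ratliff_rush_eq_of_vanishing[OF noeth acc x reg i0] ne by blast
  have "ereal (of_int (int k)) \<le> a_invariant 1 R I M"
    unfolding a_invariant_def graded_end_def by (rule Sup_upper) (use nz in blast)
  hence "ereal (real k) + 1 \<le> a_invariant 1 R I M + 1" by (intro add_right_mono) simp
  moreover have "ereal (real (rho R I M)) \<le> ereal (real k) + 1" using Suc i k by simp
  ultimately have "ereal (real (rho R I M)) \<le> a_invariant 1 R I M + 1" by (rule order_trans[rotated])
  thus ?thesis by (rule max.coboundedI2)
qed

theorem theorem4p3:
  fixes A :: "('a, 'r) ring_scheme" and \<mm> I :: "'a set"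
    and M :: "('a, 'b, 'm) module_scheme"
  assumes "noetherian_local_ring A \<mm>"
    and "finitely_generated_module A M"
    and "ideal I A"
    and "grade A I M > 0"
  shows "ereal (real (rho A I M)) \<le> max 0 (a_invariant 1 A I M + 1)"
proof (rule adic_module.rho_le)
  show "adic_module A M I"
    using assms(2,3) by (simp add: adic_module_def adic_module_axioms_def finitely_generated_module_def)
  show "noetherian_ring A" using assms(1) by (simp add: noetherian_local_ring_def)
qed (fact assms)+

end
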